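(* Let $H$ be a cocommutative Hopf algebra over a field $k$, $A$ a faithfully flat $H$-Galois extension of $B=A^{\mathrm{co}H}$, and assume that $\underline M=(B,B,M,N,\alpha,\beta)\in\underline{\underline{\mathrm{Pic}}}(B)$ is $H$-stable. Let $E={}_{A^{\square e}}\mathrm{END}(A^{\square e}\otimes_{B^e}M)^{\mathrm{op}}$. The corresponding left $H$-action $\bullet$ on $E^{\mathrm{co}H}$ is given by $$h\bullet\lambda_x=\lambda_{h\cdot x}$$ for all $h\in H$ and $x\in Z(B)$. This means that the action on $Z(B)$ transported from $E^{\mathrm{co}H}$ along $x\mapsto\lambda_x$ is the Miyashita–Ulbrich action $h\cdot x=\sum_il_i(S^{-1}(h))\,x\,r_i(S^{-1}(h))$.
   Context: **Conventions.** $\otimes=\otimes_k$; $S$ is the antipode of $H$; $\Delta(h)=h_{(1)}\otimes h_{(2)}$; right coactions are written $\rho(m)=m_{[0]}\otimes m_{[1]}$, $M^{\mathrm{co}H}=\{m:\rho(m)=m\otimes1\}$. A right $H$-comodule algebra $A$ is a faithfully flat $H$-Galois extension of $B=A^{\mathrm{co}H}$ if $\mathrm{can}:A\otimes_BA\to A\otimes H$, $a\otimes_Bb\mapsto ab_{[0]}\otimes b_{[1]}$, is bijective and $A$ is faithfully flat as a left $B$-module. Write $\mathrm{can}^{-1}(1\otimes h)=\sum_il_i(h)\otimes_Br_i(h)$. $Z(B)$ is the center of $B$. $A^e=A\otimes A^{\mathrm{op}}$, $B^e=B\otimes B^{\mathrm{op}}$, $A^{\square e}=\{\sum_ka_k\otimes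 a'_k\in A^e:\sum_ka_{k[0]}\otimes a'_k\otimes a_{k[1]}=\sum_ka_k\otimes a'_{k[0]}\otimes S(a'_{k[1]})\}$, a subalgebra of $A^e$ containing $B^e$, with right coaction $\sum a_k\otimes a'_k\mapsto\sum a_{k[0]}\otimes a'_k\otimes a_{k[1]}$. $B$-bimodules are left $B^e$-modules via $(b\otimes b')m=bmb'$. **$H$-stability.** Objects of $\underline{\underline{\mathrm{Pic}}}(B)$ are strict Morita contexts $(B,B,M,N,\alpha,\beta)$ ($\alpha:M\otimes_BN\to B$, $\beta:N\otimes_BM\to B$). ${}_B\mathcal M_B^H$ is the category of $B$-bimodules $P$ with right $H$-coaction such that $\rho(bpb')=bp_{[0]}b'\otimes p_{[1]}$. For $P,Q$ in it, $P\otimes_B^HQ=\{\sum p_i\otimes_Bq_i\in P\otimes_BQ:\sum p_{i[0]}\otimes_Bq_i\otimes p_{i[1]}=\sum p_i\otimes_Bq_{i[0]}\otimes q_{i[1]}\}$. For a $B$-bimodule $M$, $M\otimes H$ (bimodule structure from $M$, coaction $M\otimes\Delta$) and $A^{\square e}\otimes_{B^e}M$ (left $B^e$-action and coaction from $A^{\square e}$) lie in ${}_B\mathcal M_B^H$. Given isomorphisms $\varphi_M:A^{\square e}\otimes_{B^e}M\to M\otimes H$ and $\varphi_{M'}:A^{\square e}\otimes_{B^e}M'\to M'\otimes H$ in ${}_B\mathcal M_B^H$, put $\varphi_{M\otimes_BM'}=\kappa^{-1}\circ(\varphi_M\otimes_B^H\varphi_{M'})\circ g$, where $\kappa:M\otimes_BM'\otimes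 H\to(M\otimes H)\otimes_B^H(M'\otimes H)$, $\kappa(m\otimes m'\otimes h)=(m\otimes h_{(1)})\otimes_B(m'\otimes h_{(2)})$, and $g:A^{\square e}\otimes_{B^e}(M\otimes_BM')\to(A^{\square e}\otimes_{B^e}M)\otimes_B^H(A^{\square e}\otimes_{B^e}M')$, $g(\sum_k(a_k\otimes a'_k)\otimes(m\otimes m'))=\sum_{i,k}((a_{k[0]}\otimes l_i(a_{k[1]}))\otimes m)\otimes_B((r_i(a_{k[1]})\otimes a'_k)\otimes m')$, are isomorphisms. Let $\varphi_B(\sum_k(a_k\otimes a'_k)\otimes b)=\sum_ka_{k[0]}ba'_k\otimes a_{k[1]}$. $\underline M$ is $H$-stable if there exist isomorphisms $\varphi_M:A^{\square e}\otimes_{B^e}M\to M\otimes H$ and $\varphi_N:A^{\square e}\otimes_{B^e}N\to N\otimes H$ in ${}_B\mathcal M_B^H$ with $\varphi_B\circ(A^{\square e}\otimes_{B^e}\alpha)=(\alpha\otimes H)\circ\varphi_{M\otimes_BN}$ and $\varphi_B\circ(A^{\square e}\otimes_{B^e}\beta)=(\beta\otimes H)\circ\varphi_{N\otimes_BM}$. **The algebra $E$ and the action.** With $P=A^{\square e}\otimes_{B^e}M$, a left $A^{\square e}$-linear $f:P\to P$ is rational if there is an element $f_{[0]}\otimes f_{[1]}\in{}_{A^{\square e}}\mathrm{End}(P)\otimes H$ with $\rho(f(p))=f_{[0]}(p_{[0]})\otimes p_{[1]}f_{[1]}$ for all $p\in P$. ${}_{A^{\square e}}\mathrm{END}(P)$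 is the algebra of rational endomorphisms under composition; its opposite $E$ is a right $H$-comodule algebra via $f\mapsto f_{[0]}\otimes f_{[1]}$. The map $\lambda:Z(B)\to E^{\mathrm{co}H}$, $\lambda_x(a\otimes m)=a\otimes xm$ ($a\in A^{\square e}$), is an algebra isomorphism. Since $\underline M$ is $H$-stable, there is a convolution invertible right $H$-colinear map $t:H\to E$ with $t(1)=1$ (for instance from an isomorphism $\varphi:A^{\square e}\otimes_{B^e}M\to M\otimes H$ in ${}_B\mathcal M_B^H$ with $\varphi^{-1}(m\otimes1)=1\otimes m$, by $t(h)(a\otimes m)=a\,\varphi^{-1}(m\otimes h)$); let $u$ be its convolution inverse. The corresponding action on $E^{\mathrm{co}H}$ is $h\bullet e=t(h_{(1)})\,e\,u(h_{(2)})$, with products in $E$ (i.e. $u(h_{(2)})\circ e\circ t(h_{(1)})$ as composition of maps); it does not depend on the choice of $t$. *)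

theory Defs
  imports Complex_Main "HOL-Library.Poly_Mapping" "HOL-Library.Function_Algebras"
begin

section \<open>Vector spaces and tensor products\<close>

text \<open>
  The field \<open>k\<close> is a type of class \<open>field\<close>. A vector space is a subspace \<open>carr X\<close> of an ambient type,
  whose addition is the one of the type and whose scalar multiplication is \<open>scl X\<close>.
  A right module, a bimodule, and a bimodule with a coaction extend this record; the algebra
  \<open>B\<close> acting on them is a subset of a type \<open>'r\<close>, and only the values of the actions at elements of
  \<open>B\<close> matter.
\<close>

record ('k, 'v) vsp =
  carr :: "'v set"
  scl :: "'k \<Rightarrow> 'v \<Rightarrow> 'v"

record ('k, 'r, 'v) rmod = "('k, 'v) vsp" +
  ract :: "'v \<Rightarrow> 'r \<Rightarrow> 'v"

record ('k, 'r, 'v) bimod = "('k, 'r, 'v) rmod" +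
  lact :: "'r \<Rightarrow> 'v \<Rightarrow> 'v"

record (overloaded) ('k, 'r, 'h, 'v) hbimod = "('k, 'r, 'v) bimod" +
  coact :: "'v \<Rightarrow> ('v \<times> 'h \<Rightarrow>\<^sub>0 'k)"

definition vspace :: "('k::field, 'v::ab_group_add, 'e) vsp_scheme \<Rightarrow> bool" where
  "vspace X \<longleftrightarrow> vector_space (scl X) \<and> module.subspace (scl X) (carr X)"

definition lin :: "('k::field, 'v::ab_group_add, 'e) vsp_scheme \<Rightarrow>
    ('k, 'w::ab_group_add, 'f) vsp_scheme \<Rightarrow> ('v \<Rightarrow> 'w) \<Rightarrow> bool" where
  "lin X Y f \<longleftrightarrow> (\<forall>x\<in>carr X. f x \<in> carr Y)
     \<and> (\<forall>x\<in>carr X. \<forall>y\<in>carr X. f (x + y) = f x + f y)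
     \<and> (\<forall>c. \<forall>x\<in>carr X. f (scl X c x) = scl Y c (f x))"

definition pm_scale :: "'k::field \<Rightarrow> ('i \<Rightarrow>\<^sub>0 'k) \<Rightarrow> ('i \<Rightarrow>\<^sub>0 'k)" where
  "pm_scale c p = Poly_Mapping.map (\<lambda>d. c * d) p"

abbreviation basis_elt :: "'x \<Rightarrow> 'y \<Rightarrow> ('x \<times> 'y \<Rightarrow>\<^sub>0 'k::field)" where
  "basis_elt x y \<equiv> Poly_Mapping.single (x, y) 1"

text \<open>
  \<open>X \<otimes>\<^sub>R Y\<close> is the quotient of the free vector space on \<open>carr X \<times> carr Y\<close> by the usual relations
  (\<open>k\<close>-bilinearity and balancedness with respect to a set \<open>R\<close> acting by \<open>ra\<close> and \<open>la\<close>). To have the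
  elements of the quotient in a type with an addition, the quotient is realised as a linear complement
  of the span of the relations, that is, as the image of a chosen idempotent linear map \<open>bal_proj\<close> whose
  kernel is that span. Hence an element of a tensor product is at the same time a formal
  combination \<open>\<Sum> c\<^sub>i (x\<^sub>i, y\<^sub>i)\<close> with \<open>x\<^sub>i \<in> carr X\<close>, \<open>y\<^sub>i \<in> carr Y\<close> that represents it.
\<close>

definition bal_rels :: "'r set \<Rightarrow> ('x \<Rightarrow> 'r \<Rightarrow> 'x) \<Rightarrow> ('r \<Rightarrow> 'y \<Rightarrow> 'y) \<Rightarrow>
    ('k::field, 'x::ab_group_add, 'e) vsp_scheme \<Rightarrow> ('k, 'y::ab_group_add, 'f) vsp_scheme \<Rightarrow>
    ('x \<times> 'y \<Rightarrow>\<^sub>0 'k) set" where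
  "bal_rels R ra la X Y =
     {basis_elt (x + x') y - basis_elt x y - basis_elt x' y | x x' y.
        x \<in> carr X \<and> x' \<in> carr X \<and> y \<in> carr Y}
   \<union> {basis_elt x (y + y') - basis_elt x y - basis_elt x y' | x y y'.
        x \<in> carr X \<and> y \<in> carr Y \<and> y' \<in> carr Y}
   \<union> {basis_elt (scl X c x) y - pm_scale c (basis_elt x y) | c x y. x \<in> carr X \<and> y \<in> carr Y}
   \<union> {basis_elt x (scl Y c y) - pm_scale c (basis_elt x y) | c x y. x \<in> carr X \<and> y \<in> carr Y}
   \<union> {basis_elt (ra x r) y - basis_elt x (la r y) | r x y. r \<in> R \<and> x \<in> carr X \<and> y \<in> carr Y}"

definition bal_proj :: "'r set \<Rightarrow> ('x \<Rightarrow> 'r \<Rightarrow> 'x) \<Rightarrow> ('r \<Rightarrow> 'y \<Rightarrow> 'y) \<Rightarrow>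
    ('k::field, 'x::ab_group_add, 'e) vsp_scheme \<Rightarrow> ('k, 'y::ab_group_add, 'f) vsp_scheme \<Rightarrow>
    ('x \<times> 'y \<Rightarrow>\<^sub>0 'k) \<Rightarrow> ('x \<times> 'y \<Rightarrow>\<^sub>0 'k)" where
  "bal_proj R ra la X Y = (SOME \<pi>. Vector_Spaces.linear pm_scale pm_scale \<pi>
     \<and> (\<forall>p. \<pi> (\<pi> p) = \<pi> p)
     \<and> (\<forall>p. \<pi> p = 0 \<longleftrightarrow> p \<in> module.span pm_scale (bal_rels R ra la X Y)))"

lemma vector_space_pm_scale:
  "vector_space (pm_scale :: 'k::field \<Rightarrow> ('i \<Rightarrow>\<^sub>0 'k) \<Rightarrow> ('i \<Rightarrow>\<^sub>0 'k))"
proof -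
  have l: "Poly_Mapping.lookup (pm_scale c p) i = c * Poly_Mapping.lookup p i"
    for c :: 'k and p and i :: 'i
    unfolding pm_scale_def by (simp add: Poly_Mapping.map.rep_eq when_def)
  show ?thesis
    by (unfold_locales; rule poly_mapping_eqI; simp add: l lookup_add algebra_simps)
qed

lemma exists_projection_along:
  fixes s :: "'k::field \<Rightarrow> 'v::ab_group_add \<Rightarrow> 'v"
  assumes "vector_space s"
  shows "\<exists>\<pi>. Vector_Spaces.linear s s \<pi> \<and> (\<forall>p. \<pi> (\<pi> p) = \<pi> p)
    \<and> (\<forall>p. \<pi> p = 0 \<longleftrightarrow> p \<in> module.span s W)"
proof -
  interpret V: vector_space s by fact
  interpret VP: vector_space_pair s s ..
  obtain B where B: "B \<subseteq> W" "V.independent B" "W \<subseteq> V.span B"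
    using V.maximal_independent_subset[of W] by blast
  define E where "E = V.extend_basis B"
  have E: "V.independent E" "V.span E = UNIV" "B \<subseteq> E"
    using B(2) V.extend_basis_superset[OF B(2)] V.independent_extend_basis[OF B(2)]
      V.span_extend_basis[OF B(2)] by (simp_all add: E_def)
  have spanB: "V.span B = V.span W"
    using V.span_mono[OF B(1)] V.span_minimal[OF B(3) V.subspace_span] by (rule equalityI)
  define \<pi> where "\<pi> = VP.construct E (\<lambda>b. if b \<in> B then 0 else b)"
  have lin: "Vector_Spaces.linear s s \<pi>"
    unfolding \<pi>_def by (rule VP.linear_construct) fact
  interpret P: Vector_Spaces.linear s s \<pi> by fact
  have \<pi>b: "\<pi> b = (if b \<in> B then 0 else b)" if "b \<in> E" for b
    unfolding \<pi>_def using VP.construct_basis[OF E(1) that] by simp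
  have kerB: "\<pi> p = 0" if "p \<in> V.span B" for p
    using that by (induction rule: V.span_induct_alt)
      (use \<pi>b E(3) in \<open>auto simp: P.add P.scale P.zero\<close>)
  have diff: "p - \<pi> p \<in> V.span B" for p
  proof -
    have "p \<in> V.span E" using E(2) by simp
    then show ?thesis
    proof (induction rule: V.span_induct_alt)
      case base then show ?case by (simp add: P.zero V.span_zero)
    next
      case (step c x y)
      have "x - \<pi> x \<in> V.span B"
        using \<pi>b[OF step(1)] by (auto simp: V.span_base V.span_zero)
      then have "s c (x - \<pi> x) + (y - \<pi> y) \<in> V.span B"
        using step by (intro V.span_add V.span_scale)
      then show ?case
        by (simp add: P.add P.scale V.scale_right_diff_distrib algebra_simps)
    qed
  qed
  have "\<pi> (\<pi> p) = \<pi> p" for p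
    using kerB[OF diff[of p]] by (simp add: P.diff)
  moreover have "\<pi> p = 0 \<longleftrightarrow> p \<in> V.span W" for p
  proof
    assume "\<pi> p = 0"
    with diff[of p] have "p \<in> V.span B" by simp
    then show "p \<in> V.span W" by (simp only: spanB)
  next
    assume "p \<in> V.span W"
    then show "\<pi> p = 0" by (intro kerB) (simp only: spanB)
  qed
  ultimately show ?thesis using lin by blast
qed

lemma bal_proj:
  "Vector_Spaces.linear pm_scale pm_scale (bal_proj R ra la X Y)"
  "bal_proj R ra la X Y (bal_proj R ra la X Y p) = bal_proj R ra la X Y p"
  "bal_proj R ra la X Y p = 0 \<longleftrightarrow> p \<in> module.span pm_scale (bal_rels R ra la X Y)"
  using someI_ex[OF exists_projection_along[OF vector_space_pm_scale,
      of "bal_rels R ra la X Y"], folded bal_proj_def] by (blast, blast, blast)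

definition bal_pure :: "'r set \<Rightarrow> ('x \<Rightarrow> 'r \<Rightarrow> 'x) \<Rightarrow> ('r \<Rightarrow> 'y \<Rightarrow> 'y) \<Rightarrow>
    ('k::field, 'x::ab_group_add, 'e) vsp_scheme \<Rightarrow> ('k, 'y::ab_group_add, 'f) vsp_scheme \<Rightarrow>
    'x \<Rightarrow> 'y \<Rightarrow> ('x \<times> 'y \<Rightarrow>\<^sub>0 'k)" where
  "bal_pure R ra la X Y x y = bal_proj R ra la X Y (basis_elt x y)"

definition bal_carr :: "'r set \<Rightarrow> ('x \<Rightarrow> 'r \<Rightarrow> 'x) \<Rightarrow> ('r \<Rightarrow> 'y \<Rightarrow> 'y) \<Rightarrow>
    ('k::field, 'x::ab_group_add, 'e) vsp_scheme \<Rightarrow> ('k, 'y::ab_group_add, 'f) vsp_scheme \<Rightarrow>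
    ('x \<times> 'y \<Rightarrow>\<^sub>0 'k) set" where
  "bal_carr R ra la X Y =
     module.span pm_scale {bal_pure R ra la X Y x y | x y. x \<in> carr X \<and> y \<in> carr Y}"

text \<open>
  \<open>linext s g p\<close> is \<open>\<Sum> c\<^sub>i g x\<^sub>i y\<^sub>i\<close> for \<open>p = \<Sum> c\<^sub>i (x\<^sub>i, y\<^sub>i)\<close>. For bilinear (balanced) \<open>g\<close> it
  vanishes on the relations, and so it is the linear map on the tensor product with
  \<open>x \<otimes> y \<mapsto> g x y\<close>. It also renders the Sweedler notation: \<open>linext s (\<lambda>x y. \<dots>) (\<Delta> h)\<close> binds
  \<open>x = h\<^sub>(\<^sub>1\<^sub>)\<close> and \<open>y = h\<^sub>(\<^sub>2\<^sub>)\<close>.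
\<close>

definition linext :: "('k::field \<Rightarrow> 'z \<Rightarrow> 'z) \<Rightarrow> ('x \<Rightarrow> 'y \<Rightarrow> 'z::ab_group_add) \<Rightarrow>
    ('x \<times> 'y \<Rightarrow>\<^sub>0 'k) \<Rightarrow> 'z" where
  "linext s g p =
     (\<Sum>i\<in>Poly_Mapping.keys p. s (Poly_Mapping.lookup p i) (g (fst i) (snd i)))"

abbreviation tlin :: "('x \<Rightarrow> 'y \<Rightarrow> ('i \<Rightarrow>\<^sub>0 'k::field)) \<Rightarrow> ('x \<times> 'y \<Rightarrow>\<^sub>0 'k) \<Rightarrow> ('i \<Rightarrow>\<^sub>0 'k)" where
  "tlin \<equiv> linext pm_scale"

text \<open>
  \<open>tensor\<close> and \<open>tpure\<close> are over \<open>k\<close> (nothing to balance besides \<open>k\<close>-bilinearity), \<open>btensor\<close> and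
  \<open>bpure\<close> over a subalgebra \<open>B\<close>.
\<close>

definition tpure :: "('k::field, 'x::ab_group_add, 'e) vsp_scheme \<Rightarrow>
    ('k, 'y::ab_group_add, 'f) vsp_scheme \<Rightarrow> 'x \<Rightarrow> 'y \<Rightarrow> ('x \<times> 'y \<Rightarrow>\<^sub>0 'k)" where
  "tpure X Y = bal_pure ({} :: unit set) (\<lambda>x _. x) (\<lambda>_ y. y) X Y"

definition tensor :: "('k::field, 'x::ab_group_add, 'e) vsp_scheme \<Rightarrow>
    ('k, 'y::ab_group_add, 'f) vsp_scheme \<Rightarrow> ('k, 'x \<times> 'y \<Rightarrow>\<^sub>0 'k) vsp" where
  "tensor X Y =
     \<lparr>carr = bal_carr ({} :: unit set) (\<lambda>x _. x) (\<lambda>_ y. y) X Y, scl = pm_scale\<rparr>"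

definition bpure :: "'r set \<Rightarrow> ('k::field, 'r, 'x::ab_group_add, 'e) rmod_scheme \<Rightarrow>
    ('k, 'r, 'y::ab_group_add, 'f) bimod_scheme \<Rightarrow> 'x \<Rightarrow> 'y \<Rightarrow> ('x \<times> 'y \<Rightarrow>\<^sub>0 'k)" where
  "bpure B X Y = bal_pure B (ract X) (lact Y) X Y"

definition btensor_carr :: "'r set \<Rightarrow> ('k::field, 'r, 'x::ab_group_add, 'e) rmod_scheme \<Rightarrow>
    ('k, 'r, 'y::ab_group_add, 'f) bimod_scheme \<Rightarrow> ('x \<times> 'y \<Rightarrow>\<^sub>0 'k) set" where
  "btensor_carr B X Y = bal_carr B (ract X) (lact Y) X Y"

definition btensor :: "'r set \<Rightarrow> ('k::field, 'r, 'x::ab_group_add, 'e) bimod_scheme \<Rightarrow>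
    ('k, 'r, 'y::ab_group_add, 'f) bimod_scheme \<Rightarrow> ('k, 'r, 'x \<times> 'y \<Rightarrow>\<^sub>0 'k) bimod" where
  "btensor B X Y =
     \<lparr>carr = btensor_carr B X Y, scl = pm_scale,
      ract = (\<lambda>w b. tlin (\<lambda>x y. bpure B X Y x (ract Y y b)) w),
      lact = (\<lambda>b w. tlin (\<lambda>x y. bpure B X Y (lact X b x) y) w)\<rparr>"


section \<open>Hopf algebras and comodule algebras\<close>

definition k_algebra :: "('k::field, 'a::{ring,monoid_mult}, 'e) vsp_scheme \<Rightarrow> bool" where
  "k_algebra A \<longleftrightarrow> vspace A \<and> carr A = UNIV
     \<and> (\<forall>c x y. scl A c (x * y) = scl A c x * y \<and> scl A c (x * y) = x * scl A c y)"

record (overloaded) ('k, 'h) hopf = "('k, 'h) vsp" +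
  comult :: "'h \<Rightarrow> ('h \<times> 'h \<Rightarrow>\<^sub>0 'k)"
  counit :: "'h \<Rightarrow> 'k"
  antipode :: "'h \<Rightarrow> 'h"

definition hopf_algebra :: "('k::field, 'h::ring_1) hopf \<Rightarrow> bool" where
  "hopf_algebra H \<longleftrightarrow> k_algebra H
     \<and> lin H (tensor H H) (comult H)
     \<and> (\<forall>g h. counit H (g + h) = counit H g + counit H h)
     \<and> (\<forall>c h. counit H (scl H c h) = c * counit H h)
     \<and> (\<forall>h. tlin (\<lambda>x y. tlin (\<lambda>x1 x2. tpure (tensor H H) H (tpure H H x1 x2) y) (comult H x))
               (comult H h)
          = tlin (\<lambda>x y. tlin (\<lambda>y1 y2. tpure (tensor H H) H (tpure H H x y1) y2) (comult H y))
               (comult H h))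
     \<and> (\<forall>h. linext (scl H) (\<lambda>x y. scl H (counit H x) y) (comult H h) = h)
     \<and> (\<forall>h. linext (scl H) (\<lambda>x y. scl H (counit H y) x) (comult H h) = h)
     \<and> comult H 1 = tpure H H 1 1
     \<and> (\<forall>g h. comult H (g * h)
          = tlin (\<lambda>g1 g2. tlin (\<lambda>h1 h2. tpure H H (g1 * h1) (g2 * h2)) (comult H h)) (comult H g))
     \<and> counit H 1 = 1
     \<and> (\<forall>g h. counit H (g * h) = counit H g * counit H h)
     \<and> lin H H (antipode H)
     \<and> (\<forall>h. linext (scl H) (\<lambda>x y. antipode H x * y) (comult H h) = scl H (counit H h) 1)
     \<and> (\<forall>h. linext (scl H) (\<lambda>x y. x * antipode H y) (comult H h) = scl H (counit H h) 1)"

definition cocommutative :: "('k::field, 'h::ring_1) hopf \<Rightarrow> bool" where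
  "cocommutative H \<longleftrightarrow> (\<forall>h. tlin (\<lambda>x y. tpure H H y x) (comult H h) = comult H h)"

definition comodule :: "('k::field, 'h::ring_1) hopf \<Rightarrow> ('k, 'v::ab_group_add, 'e) vsp_scheme \<Rightarrow>
    ('v \<Rightarrow> ('v \<times> 'h \<Rightarrow>\<^sub>0 'k)) \<Rightarrow> bool" where
  "comodule H X \<rho> \<longleftrightarrow> lin X (tensor X H) \<rho>
     \<and> (\<forall>v\<in>carr X.
          tlin (\<lambda>x h. tlin (\<lambda>x0 x1. tpure (tensor X H) H (tpure X H x0 x1) h) (\<rho> x)) (\<rho> v)
        = tlin (\<lambda>x h. tlin (\<lambda>h1 h2. tpure (tensor X H) H (tpure X H x h1) h2) (comult H h)) (\<rho> v))
     \<and> (\<forall>v\<in>carr X. linext (scl X) (\<lambda>x h. scl X (counit H h) x) (\<rho> v) = v)"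

record (overloaded) ('k, 'a, 'h) comod_alg = "('k, 'a) vsp" +
  rho :: "'a \<Rightarrow> ('a \<times> 'h \<Rightarrow>\<^sub>0 'k)"

definition comodule_algebra :: "('k::field, 'h::ring_1) hopf \<Rightarrow>
    ('k, 'a::{ring,monoid_mult}, 'h) comod_alg \<Rightarrow> bool" where
  "comodule_algebra H A \<longleftrightarrow> k_algebra A \<and> comodule H A (rho A)
     \<and> rho A 1 = tpure A H 1 1
     \<and> (\<forall>a b. rho A (a * b)
          = tlin (\<lambda>a0 a1. tlin (\<lambda>b0 b1. tpure A H (a0 * b0) (a1 * b1)) (rho A b)) (rho A a))"

definition coinv :: "('k::field, 'h::ring_1) hopf \<Rightarrow>
    ('k, 'a::{ring,monoid_mult}, 'h) comod_alg \<Rightarrow> 'a set" where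
  "coinv H A = {a. rho A a = tpure A H a 1}"

definition center :: "'a::{ring,monoid_mult} set \<Rightarrow> 'a set" where
  "center B = {x \<in> B. \<forall>b\<in>B. x * b = b * x}"

definition mult_bimod :: "'a set \<Rightarrow> ('k::field, 'a::{ring,monoid_mult}, 'e) vsp_scheme \<Rightarrow>
    ('k, 'a, 'a) bimod" where
  "mult_bimod S A = \<lparr>carr = S, scl = scl A, ract = (*), lact = (*)\<rparr>"


section \<open>Faithfully flat Hopf-Galois extensions\<close>

definition right_module :: "'a::{ring,monoid_mult} set \<Rightarrow> ('k::field, 'a, 'e) vsp_scheme \<Rightarrow>
    ('k, 'a, 'v::ab_group_add, 'f) rmod_scheme \<Rightarrow> bool" where
  "right_module B A X \<longleftrightarrow> vspace X
     \<and> (\<forall>x\<in>carr X. \<forall>b\<in>B. ract X x b \<in> carr X)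
     \<and> (\<forall>x\<in>carr X. \<forall>y\<in>carr X. \<forall>b\<in>B. ract X (x + y) b = ract X x b + ract X y b)
     \<and> (\<forall>x\<in>carr X. \<forall>b\<in>B. \<forall>b'\<in>B. ract X x (b + b') = ract X x b + ract X x b')
     \<and> (\<forall>x\<in>carr X. \<forall>b\<in>B. \<forall>b'\<in>B. ract X x (b * b') = ract X (ract X x b) b')
     \<and> (\<forall>x\<in>carr X. ract X x 1 = x)
     \<and> (\<forall>c. \<forall>x\<in>carr X. \<forall>b\<in>B. ract X (scl X c x) b = scl X c (ract X x b)
          \<and> ract X x (scl A c b) = scl X c (ract X x b))"

definition rmod_hom :: "'a set \<Rightarrow> ('k::field, 'a, 'v::ab_group_add, 'e) rmod_scheme \<Rightarrow>
    ('k, 'a, 'w::ab_group_add, 'f) rmod_scheme \<Rightarrow> ('v \<Rightarrow> 'w) \<Rightarrow> bool" where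
  "rmod_hom B X Y f \<longleftrightarrow> lin X Y f
     \<and> (\<forall>x\<in>carr X. \<forall>b\<in>B. f (ract X x b) = ract Y (f x) b)"

definition exact_at :: "'x set \<Rightarrow> ('x \<Rightarrow> 'y) \<Rightarrow> 'y set \<Rightarrow> ('y \<Rightarrow> 'z::zero) \<Rightarrow> bool" where
  "exact_at X f Y g \<longleftrightarrow> f ` X = {y \<in> Y. g y = 0}"

text \<open>
  \<open>A\<close> is faithfully flat as a left \<open>B\<close>-module: a sequence \<open>X \<rightarrow> Y \<rightarrow> Z\<close> of right \<open>B\<close>-modules is exact
  iff \<open>X \<otimes>\<^sub>B A \<rightarrow> Y \<otimes>\<^sub>B A \<rightarrow> Z \<otimes>\<^sub>B A\<close> is. HOL cannot quantify over the types of
  \<open>X\<close>, \<open>Y\<close>, \<open>Z\<close>, so their carriers are taken to be arbitrary subspaces of the type \<open>'a\<close> of \<open>A\<close>, with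
  arbitrary right actions. This is no restriction: up to isomorphism it covers the inclusions
  \<open>I \<rightarrow> B\<close> of right ideals and the cyclic modules \<open>B/I\<close> (carried by a linear complement of \<open>I\<close> in \<open>B\<close>),
  and flatness is detected by the former, faithfulness by the latter.
\<close>

definition faithfully_flat :: "'a set \<Rightarrow> ('k::field, 'a::{ring,monoid_mult}, 'e) vsp_scheme \<Rightarrow> bool"
  where
  "faithfully_flat B A \<longleftrightarrow> (\<forall>(X :: ('k, 'a, 'a) rmod) (Y :: ('k, 'a, 'a) rmod)
       (Z :: ('k, 'a, 'a) rmod) f g.
     right_module B A X \<and> right_module B A Y \<and> right_module B A Z
       \<and> rmod_hom B X Y f \<and> rmod_hom B Y Z g \<longrightarrow>
     (let A' = mult_bimod UNIV A in
       exact_at (carr X) f (carr Y) g \<longleftrightarrow>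
       exact_at (btensor_carr B X A') (tlin (\<lambda>x a. bpure B Y A' (f x) a))
         (btensor_carr B Y A') (tlin (\<lambda>y a. bpure B Z A' (g y) a))))"

definition can :: "('k::field, 'h::ring_1) hopf \<Rightarrow>
    ('k, 'a::{ring,monoid_mult}, 'h) comod_alg \<Rightarrow> ('a \<times> 'a \<Rightarrow>\<^sub>0 'k) \<Rightarrow> ('a \<times> 'h \<Rightarrow>\<^sub>0 'k)" where
  "can H A = tlin (\<lambda>a b. tlin (\<lambda>b0 b1. tpure A H (a * b0) b1) (rho A b))"

definition can_dom :: "('k::field, 'h::ring_1) hopf \<Rightarrow>
    ('k, 'a::{ring,monoid_mult}, 'h) comod_alg \<Rightarrow> ('a \<times> 'a \<Rightarrow>\<^sub>0 'k) set" where
  "can_dom H A = btensor_carr (coinv H A) (mult_bimod UNIV A) (mult_bimod UNIV A)"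

definition ff_hopf_galois :: "('k::field, 'h::ring_1) hopf \<Rightarrow>
    ('k, 'a::{ring,monoid_mult}, 'h) comod_alg \<Rightarrow> bool" where
  "ff_hopf_galois H A \<longleftrightarrow> comodule_algebra H A
     \<and> bij_betw (can H A) (can_dom H A) (carr (tensor A H))
     \<and> faithfully_flat (coinv H A) A"

text \<open>\<open>\<Sum>\<^sub>i l\<^sub>i(h) \<otimes>\<^sub>B r\<^sub>i(h)\<close>\<close>

definition lr :: "('k::field, 'h::ring_1) hopf \<Rightarrow>
    ('k, 'a::{ring,monoid_mult}, 'h) comod_alg \<Rightarrow> 'h \<Rightarrow> ('a \<times> 'a \<Rightarrow>\<^sub>0 'k)" where
  "lr H A h = inv_into (can_dom H A) (can H A) (tpure A H 1 h)"

definition miyashita_ulbrich :: "('k::field, 'h::ring_1) hopf \<Rightarrow>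
    ('k, 'a::{ring,monoid_mult}, 'h) comod_alg \<Rightarrow> 'h \<Rightarrow> 'a \<Rightarrow> 'a" where
  "miyashita_ulbrich H A h x = linext (scl A) (\<lambda>l r. l * x * r) (lr H A (inv (antipode H) h))"


section \<open>The algebra \<open>A\<^sup>\<box>\<^sup>e\<close> and the induced bimodules\<close>

text \<open>Multiplication of \<open>A\<^sup>e = A \<otimes> A\<^sup>o\<^sup>p\<close>.\<close>

definition ae_mult :: "('k::field, 'a::{ring,monoid_mult}, 'e) vsp_scheme \<Rightarrow>
    ('a \<times> 'a \<Rightarrow>\<^sub>0 'k) \<Rightarrow> ('a \<times> 'a \<Rightarrow>\<^sub>0 'k) \<Rightarrow> ('a \<times> 'a \<Rightarrow>\<^sub>0 'k)" where
  "ae_mult A z w = tlin (\<lambda>a a'. tlin (\<lambda>c c'. tpure A A (a * c) (c' * a')) w) z"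

definition ae_coact :: "('k::field, 'h::ring_1) hopf \<Rightarrow>
    ('k, 'a::{ring,monoid_mult}, 'h) comod_alg \<Rightarrow>
    ('a \<times> 'a \<Rightarrow>\<^sub>0 'k) \<Rightarrow> (('a \<times> 'a \<Rightarrow>\<^sub>0 'k) \<times> 'h \<Rightarrow>\<^sub>0 'k)" where
  "ae_coact H A z =
     tlin (\<lambda>a a'. tlin (\<lambda>a0 a1. tpure (tensor A A) H (tpure A A a0 a') a1) (rho A a)) z"

definition sq :: "('k::field, 'h::ring_1) hopf \<Rightarrow>
    ('k, 'a::{ring,monoid_mult}, 'h) comod_alg \<Rightarrow> ('k, 'a \<times> 'a \<Rightarrow>\<^sub>0 'k) vsp" where
  "sq H A = \<lparr>carr = {z \<in> carr (tensor A A). ae_coact H A z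
       = tlin (\<lambda>a a'. tlin (\<lambda>a0' a1'. tpure (tensor A A) H (tpure A A a a0') (antipode H a1'))
                (rho A a')) z},
     scl = pm_scale\<rparr>"

text \<open>
  For \<open>z = \<Sum> a \<otimes> a' \<in> A\<^sup>\<box>\<^sup>e\<close> the element \<open>\<Sum> a\<^sub>[\<^sub>0\<^sub>] \<otimes> a' \<otimes> a\<^sub>[\<^sub>1\<^sub>]\<close> of \<open>A\<^sup>e \<otimes> H\<close> lies in the
  subspace \<open>A\<^sup>\<box>\<^sup>e \<otimes> H\<close>, although the single summands need not do so; \<open>sq_coact z\<close> is this element of
  \<open>A\<^sup>\<box>\<^sup>e \<otimes> H\<close>. (\<open>tensor (sq H A) H\<close> and \<open>tensor (tensor A A) H\<close> have different
  representatives, so that the inclusion has to be written out.)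
\<close>

definition sq_coact :: "('k::field, 'h::ring_1) hopf \<Rightarrow>
    ('k, 'a::{ring,monoid_mult}, 'h) comod_alg \<Rightarrow>
    ('a \<times> 'a \<Rightarrow>\<^sub>0 'k) \<Rightarrow> (('a \<times> 'a \<Rightarrow>\<^sub>0 'k) \<times> 'h \<Rightarrow>\<^sub>0 'k)" where
  "sq_coact H A z = (THE w. w \<in> carr (tensor (sq H A) H)
     \<and> tlin (\<lambda>y h. tpure (tensor A A) H y h) w = ae_coact H A z)"

text \<open>
  \<open>S \<otimes>\<^bsub>B\<^sup>e\<^esub> M\<close> for a subspace \<open>S\<close> of \<open>A\<^sup>e\<close> that is stable under multiplication by \<open>B\<^sup>e\<close> on both sides
  (\<open>S = A\<^sup>\<box>\<^sup>e\<close> or \<open>S = A\<^sup>e\<close>). As \<open>B\<^sup>e\<close> is additively generated by the \<open>b \<otimes> b'\<close>, it suffices to balance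
  with respect to these. The right \<open>B\<close>-action is the action of \<open>1 \<otimes> b\<close>, the left one that of
  \<open>b \<otimes> 1\<close>, both on the factor \<open>S\<close>.
\<close>

definition ext_ra :: "('k::field, 'a::{ring,monoid_mult}, 'e) vsp_scheme \<Rightarrow>
    ('a \<times> 'a \<Rightarrow>\<^sub>0 'k) \<Rightarrow> 'a \<times> 'a \<Rightarrow> ('a \<times> 'a \<Rightarrow>\<^sub>0 'k)" where
  "ext_ra A z r = ae_mult A z (tpure A A (fst r) (snd r))"

definition ext_la :: "('k, 'a, 'm, 'e) bimod_scheme \<Rightarrow> 'a \<times> 'a \<Rightarrow> 'm \<Rightarrow> 'm" where
  "ext_la M r m = lact M (fst r) (ract M m (snd r))"

definition ext_pure :: "('k::field, 'a \<times> 'a \<Rightarrow>\<^sub>0 'k) vsp \<Rightarrow> ('k, 'h::ring_1) hopf \<Rightarrow>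
    ('k, 'a::{ring,monoid_mult}, 'h) comod_alg \<Rightarrow> ('k, 'a, 'm::ab_group_add, 'e) bimod_scheme \<Rightarrow>
    ('a \<times> 'a \<Rightarrow>\<^sub>0 'k) \<Rightarrow> 'm \<Rightarrow> (('a \<times> 'a \<Rightarrow>\<^sub>0 'k) \<times> 'm \<Rightarrow>\<^sub>0 'k)" where
  "ext_pure S H A M =
     bal_pure (coinv H A \<times> coinv H A) (ext_ra A) (ext_la M) S M"

definition ext_act :: "('k::field, 'a \<times> 'a \<Rightarrow>\<^sub>0 'k) vsp \<Rightarrow> ('k, 'h::ring_1) hopf \<Rightarrow>
    ('k, 'a::{ring,monoid_mult}, 'h) comod_alg \<Rightarrow> ('k, 'a, 'm::ab_group_add, 'e) bimod_scheme \<Rightarrow>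
    ('a \<times> 'a \<Rightarrow>\<^sub>0 'k) \<Rightarrow> (('a \<times> 'a \<Rightarrow>\<^sub>0 'k) \<times> 'm \<Rightarrow>\<^sub>0 'k) \<Rightarrow> (('a \<times> 'a \<Rightarrow>\<^sub>0 'k) \<times> 'm \<Rightarrow>\<^sub>0 'k)" where
  "ext_act S H A M w p = tlin (\<lambda>z m. ext_pure S H A M (ae_mult A w z) m) p"

definition ext_bimod :: "('k::field, 'a \<times> 'a \<Rightarrow>\<^sub>0 'k) vsp \<Rightarrow> ('k, 'h::ring_1) hopf \<Rightarrow>
    ('k, 'a::{ring,monoid_mult}, 'h) comod_alg \<Rightarrow> ('k, 'a, 'm::ab_group_add, 'e) bimod_scheme \<Rightarrow>
    ('k, 'a, ('a \<times> 'a \<Rightarrow>\<^sub>0 'k) \<times> 'm \<Rightarrow>\<^sub>0 'k) bimod" where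
  "ext_bimod S H A M =
     \<lparr>carr = bal_carr (coinv H A \<times> coinv H A) (ext_ra A) (ext_la M) S M, scl = pm_scale,
      ract = (\<lambda>p b. ext_act S H A M (tpure A A 1 b) p),
      lact = (\<lambda>b p. ext_act S H A M (tpure A A b 1) p)\<rparr>"

text \<open>\<open>A\<^sup>\<box>\<^sup>e \<otimes>\<^bsub>B\<^sup>e\<^esub> M\<close> and \<open>M \<otimes> H\<close> as objects of \<open>\<^bsub>B\<^esub>M\<^bsub>B\<^esub>\<^sup>H\<close>.\<close>

definition ind :: "('k::field, 'h::ring_1) hopf \<Rightarrow>
    ('k, 'a::{ring,monoid_mult}, 'h) comod_alg \<Rightarrow> ('k, 'a, 'm::ab_group_add, 'e) bimod_scheme \<Rightarrow>
    ('k, 'a, 'h, ('a \<times> 'a \<Rightarrow>\<^sub>0 'k) \<times> 'm \<Rightarrow>\<^sub>0 'k) hbimod" where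
  "ind H A M = (let P = ext_bimod (sq H A) H A M in
     bimod.extend P (hbimod.fields
       (\<lambda>p. tlin (\<lambda>z m. tlin (\<lambda>z0 z1. tpure P H (ext_pure (sq H A) H A M z0 m) z1)
                              (sq_coact H A z)) p)))"

definition tensorH :: "('k::field, 'h::ring_1) hopf \<Rightarrow>
    ('k, 'a, 'm::ab_group_add, 'e) bimod_scheme \<Rightarrow> ('k, 'a, 'h, 'm \<times> 'h \<Rightarrow>\<^sub>0 'k) hbimod" where
  "tensorH H M =
     \<lparr>carr = carr (tensor M H), scl = pm_scale,
      ract = (\<lambda>w b. tlin (\<lambda>m h. tpure M H (ract M m b) h) w),
      lact = (\<lambda>b w. tlin (\<lambda>m h. tpure M H (lact M b m) h) w),
      coact = (\<lambda>w. tlin (\<lambda>m h. tlin (\<lambda>h1 h2. tpure (tensor M H) H (tpure M H m h1) h2)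
                                     (comult H h)) w)\<rparr>"

definition hbimod_iso :: "'a set \<Rightarrow> ('k::field, 'h::ring_1) hopf \<Rightarrow>
    ('k, 'a, 'h, 'v::ab_group_add) hbimod \<Rightarrow> ('k, 'a, 'h, 'w::ab_group_add) hbimod \<Rightarrow>
    ('v \<Rightarrow> 'w) \<Rightarrow> bool" where
  "hbimod_iso B H X Y f \<longleftrightarrow> lin X Y f \<and> bij_betw f (carr X) (carr Y)
     \<and> (\<forall>b\<in>B. \<forall>x\<in>carr X. f (lact X b x) = lact Y b (f x) \<and> f (ract X x b) = ract Y (f x) b)
     \<and> (\<forall>x\<in>carr X. coact Y (f x) = tlin (\<lambda>v h. tpure Y H (f v) h) (coact X x))"

text \<open>\<open>P \<otimes>\<^sub>B\<^sup>H Q\<close>\<close>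

definition cotensor_carr :: "'a set \<Rightarrow> ('k::field, 'h::ring_1) hopf \<Rightarrow>
    ('k, 'a, 'h, 'v::ab_group_add) hbimod \<Rightarrow> ('k, 'a, 'h, 'w::ab_group_add) hbimod \<Rightarrow>
    ('v \<times> 'w \<Rightarrow>\<^sub>0 'k) set" where
  "cotensor_carr B H P Q = {w \<in> carr (btensor B P Q).
       tlin (\<lambda>p q. tlin (\<lambda>p0 p1. tpure (btensor B P Q) H (bpure B P Q p0 q) p1) (coact P p)) w
     = tlin (\<lambda>p q. tlin (\<lambda>q0 q1. tpure (btensor B P Q) H (bpure B P Q p q0) q1) (coact Q q)) w}"


section \<open>Strict Morita contexts and \<open>H\<close>-stability\<close>

definition bimodule :: "'a::{ring,monoid_mult} set \<Rightarrow> ('k::field, 'a, 'e) vsp_scheme \<Rightarrow>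
    ('k, 'a, 'm::ab_group_add, 'f) bimod_scheme \<Rightarrow> bool" where
  "bimodule B A M \<longleftrightarrow> right_module B A M
     \<and> (\<forall>x\<in>carr M. \<forall>b\<in>B. lact M b x \<in> carr M)
     \<and> (\<forall>x\<in>carr M. \<forall>y\<in>carr M. \<forall>b\<in>B. lact M b (x + y) = lact M b x + lact M b y)
     \<and> (\<forall>x\<in>carr M. \<forall>b\<in>B. \<forall>b'\<in>B. lact M (b + b') x = lact M b x + lact M b' x)
     \<and> (\<forall>x\<in>carr M. \<forall>b\<in>B. \<forall>b'\<in>B. lact M (b * b') x = lact M b (lact M b' x))
     \<and> (\<forall>x\<in>carr M. lact M 1 x = x)
     \<and> (\<forall>c. \<forall>x\<in>carr M. \<forall>b\<in>B. lact M b (scl M c x) = scl M c (lact M b x)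
          \<and> lact M (scl A c b) x = scl M c (lact M b x))
     \<and> (\<forall>x\<in>carr M. \<forall>b\<in>B. \<forall>b'\<in>B. ract M (lact M b x) b' = lact M b (ract M x b'))"

definition bimod_iso :: "'a set \<Rightarrow> ('k::field, 'a, 'v::ab_group_add, 'e) bimod_scheme \<Rightarrow>
    ('k, 'a, 'w::ab_group_add, 'f) bimod_scheme \<Rightarrow> ('v \<Rightarrow> 'w) \<Rightarrow> bool" where
  "bimod_iso B X Y f \<longleftrightarrow> lin X Y f \<and> bij_betw f (carr X) (carr Y)
     \<and> (\<forall>b\<in>B. \<forall>x\<in>carr X. f (lact X b x) = lact Y b (f x) \<and> f (ract X x b) = ract Y (f x) b)"

definition strict_morita_context :: "'a::{ring,monoid_mult} set \<Rightarrow>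
    ('k::field, 'a, 'e) vsp_scheme \<Rightarrow> ('k, 'a, 'm::ab_group_add) bimod \<Rightarrow>
    ('k, 'a, 'n::ab_group_add) bimod \<Rightarrow> (('m \<times> 'n \<Rightarrow>\<^sub>0 'k) \<Rightarrow> 'a) \<Rightarrow>
    (('n \<times> 'm \<Rightarrow>\<^sub>0 'k) \<Rightarrow> 'a) \<Rightarrow> bool" where
  "strict_morita_context B A M N \<alpha> \<beta> \<longleftrightarrow> bimodule B A M \<and> bimodule B A N
     \<and> bimod_iso B (btensor B M N) (mult_bimod B A) \<alpha>
     \<and> bimod_iso B (btensor B N M) (mult_bimod B A) \<beta>
     \<and> (\<forall>m\<in>carr M. \<forall>n\<in>carr N. \<forall>m'\<in>carr M.
          lact M (\<alpha> (bpure B M N m n)) m' = ract M m (\<beta> (bpure B N M n m')))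
     \<and> (\<forall>n\<in>carr N. \<forall>m\<in>carr M. \<forall>n'\<in>carr N.
          lact N (\<beta> (bpure B N M n m)) n' = ract N n (\<alpha> (bpure B M N m n')))"

definition kappa :: "'a set \<Rightarrow> ('k::field, 'h::ring_1) hopf \<Rightarrow>
    ('k, 'a, 'm::ab_group_add) bimod \<Rightarrow> ('k, 'a, 'n::ab_group_add) bimod \<Rightarrow>
    (('m \<times> 'n \<Rightarrow>\<^sub>0 'k) \<times> 'h \<Rightarrow>\<^sub>0 'k) \<Rightarrow> (('m \<times> 'h \<Rightarrow>\<^sub>0 'k) \<times> ('n \<times> 'h \<Rightarrow>\<^sub>0 'k) \<Rightarrow>\<^sub>0 'k)" where
  "kappa B H M M' = tlin (\<lambda>y h. tlin (\<lambda>m m'. tlin (\<lambda>h1 h2.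
     bpure B (tensorH H M) (tensorH H M') (tpure M H m h1) (tpure M' H m' h2)) (comult H h)) y)"

text \<open>
  The summands \<open>((a\<^sub>[\<^sub>0\<^sub>] \<otimes> l\<^sub>i) \<otimes> m) \<otimes>\<^sub>B ((r\<^sub>i \<otimes> a') \<otimes> m')\<close> in the formula for \<open>g\<close> are
  elements of \<open>(A\<^sup>e \<otimes> M) \<otimes>\<^sub>B (A\<^sup>e \<otimes> M')\<close> (with \<open>A\<^sup>e \<otimes> M\<close> over \<open>B\<^sup>e\<close>); only their sum
  lies in \<open>(A\<^sup>\<box>\<^sup>e \<otimes> M) \<otimes>\<^sub>B\<^sup>H (A\<^sup>\<box>\<^sup>e \<otimes> M')\<close>. \<open>g_formula\<close> is the sum in the former space,
  \<open>g_incl\<close> the canonical map from the latter to the former, and \<open>g_map\<close> the map \<open>g\<close>.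
\<close>

definition g_formula :: "('k::field, 'h::ring_1) hopf \<Rightarrow>
    ('k, 'a::{ring,monoid_mult}, 'h) comod_alg \<Rightarrow> ('k, 'a, 'm::ab_group_add) bimod \<Rightarrow>
    ('k, 'a, 'n::ab_group_add) bimod \<Rightarrow> (('a \<times> 'a \<Rightarrow>\<^sub>0 'k) \<times> ('m \<times> 'n \<Rightarrow>\<^sub>0 'k) \<Rightarrow>\<^sub>0 'k) \<Rightarrow>
    ((('a \<times> 'a \<Rightarrow>\<^sub>0 'k) \<times> 'm \<Rightarrow>\<^sub>0 'k) \<times> (('a \<times> 'a \<Rightarrow>\<^sub>0 'k) \<times> 'n \<Rightarrow>\<^sub>0 'k) \<Rightarrow>\<^sub>0 'k)" where
  "g_formula H A M M' = (let Ae = tensor A A in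
     tlin (\<lambda>z y. tlin (\<lambda>a a'. tlin (\<lambda>a0 a1. tlin (\<lambda>l r. tlin (\<lambda>m m'.
       bpure (coinv H A) (ext_bimod Ae H A M) (ext_bimod Ae H A M')
         (ext_pure Ae H A M (tpure A A a0 l) m)
         (ext_pure Ae H A M' (tpure A A r a') m')) y) (lr H A a1)) (rho A a)) z))"

definition g_incl :: "('k::field, 'h::ring_1) hopf \<Rightarrow>
    ('k, 'a::{ring,monoid_mult}, 'h) comod_alg \<Rightarrow> ('k, 'a, 'm::ab_group_add) bimod \<Rightarrow>
    ('k, 'a, 'n::ab_group_add) bimod \<Rightarrow>
    ((('a \<times> 'a \<Rightarrow>\<^sub>0 'k) \<times> 'm \<Rightarrow>\<^sub>0 'k) \<times> (('a \<times> 'a \<Rightarrow>\<^sub>0 'k) \<times> 'n \<Rightarrow>\<^sub>0 'k) \<Rightarrow>\<^sub>0 'k) \<Rightarrow>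
    ((('a \<times> 'a \<Rightarrow>\<^sub>0 'k) \<times> 'm \<Rightarrow>\<^sub>0 'k) \<times> (('a \<times> 'a \<Rightarrow>\<^sub>0 'k) \<times> 'n \<Rightarrow>\<^sub>0 'k) \<Rightarrow>\<^sub>0 'k)" where
  "g_incl H A M M' = (let Ae = tensor A A in
     tlin (\<lambda>p q. bpure (coinv H A) (ext_bimod Ae H A M) (ext_bimod Ae H A M')
       (tlin (ext_pure Ae H A M) p) (tlin (ext_pure Ae H A M') q)))"

definition g_map :: "('k::field, 'h::ring_1) hopf \<Rightarrow>
    ('k, 'a::{ring,monoid_mult}, 'h) comod_alg \<Rightarrow> ('k, 'a, 'm::ab_group_add) bimod \<Rightarrow>
    ('k, 'a, 'n::ab_group_add) bimod \<Rightarrow> (('a \<times> 'a \<Rightarrow>\<^sub>0 'k) \<times> ('m \<times> 'n \<Rightarrow>\<^sub>0 'k) \<Rightarrow>\<^sub>0 'k) \<Rightarrow>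
    ((('a \<times> 'a \<Rightarrow>\<^sub>0 'k) \<times> 'm \<Rightarrow>\<^sub>0 'k) \<times> (('a \<times> 'a \<Rightarrow>\<^sub>0 'k) \<times> 'n \<Rightarrow>\<^sub>0 'k) \<Rightarrow>\<^sub>0 'k)" where
  "g_map H A M M' p = (THE w. w \<in> cotensor_carr (coinv H A) H (ind H A M) (ind H A M')
     \<and> g_incl H A M M' w = g_formula H A M M' p)"

text \<open>\<open>\<phi>\<^bsub>M \<otimes>\<^sub>B M'\<^esub> = \<kappa>\<^sup>-\<^sup>1 \<circ> (\<phi>\<^sub>M \<otimes>\<^sub>B\<^sup>H \<phi>\<^bsub>M'\<^esub>) \<circ> g\<close>\<close>

definition phi_tensor :: "('k::field, 'h::ring_1) hopf \<Rightarrow>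
    ('k, 'a::{ring,monoid_mult}, 'h) comod_alg \<Rightarrow> ('k, 'a, 'm::ab_group_add) bimod \<Rightarrow>
    ('k, 'a, 'n::ab_group_add) bimod \<Rightarrow>
    ((('a \<times> 'a \<Rightarrow>\<^sub>0 'k) \<times> 'm \<Rightarrow>\<^sub>0 'k) \<Rightarrow> ('m \<times> 'h \<Rightarrow>\<^sub>0 'k)) \<Rightarrow>
    ((('a \<times> 'a \<Rightarrow>\<^sub>0 'k) \<times> 'n \<Rightarrow>\<^sub>0 'k) \<Rightarrow> ('n \<times> 'h \<Rightarrow>\<^sub>0 'k)) \<Rightarrow>
    (('a \<times> 'a \<Rightarrow>\<^sub>0 'k) \<times> ('m \<times> 'n \<Rightarrow>\<^sub>0 'k) \<Rightarrow>\<^sub>0 'k) \<Rightarrow> (('m \<times> 'n \<Rightarrow>\<^sub>0 'k) \<times> 'h \<Rightarrow>\<^sub>0 'k)" where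
  "phi_tensor H A M M' \<phi> \<phi>' p = (let B = coinv H A in
     inv_into (carr (tensor (btensor B M M') H)) (kappa B H M M')
       (tlin (\<lambda>x y. bpure B (tensorH H M) (tensorH H M') (\<phi> x) (\<phi>' y)) (g_map H A M M' p)))"

text \<open>
  \<open>\<phi>\<^sub>B\<close> takes values in \<open>B \<otimes> H\<close>, which is embedded in \<open>A \<otimes> H\<close>; its defining formula, and
  likewise \<open>\<alpha> \<otimes> H\<close> in \<open>phi_compat\<close>, is written in \<open>A \<otimes> H\<close>.
\<close>

definition phi_B :: "('k::field, 'h::ring_1) hopf \<Rightarrow>
    ('k, 'a::{ring,monoid_mult}, 'h) comod_alg \<Rightarrow>
    (('a \<times> 'a \<Rightarrow>\<^sub>0 'k) \<times> 'a \<Rightarrow>\<^sub>0 'k) \<Rightarrow> ('a \<times> 'h \<Rightarrow>\<^sub>0 'k)" where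
  "phi_B H A =
     tlin (\<lambda>z b. tlin (\<lambda>a a'. tlin (\<lambda>a0 a1. tpure A H (a0 * b * a') a1) (rho A a)) z)"

definition phi_compat :: "('k::field, 'h::ring_1) hopf \<Rightarrow>
    ('k, 'a::{ring,monoid_mult}, 'h) comod_alg \<Rightarrow> ('k, 'a, 'm::ab_group_add) bimod \<Rightarrow>
    ('k, 'a, 'n::ab_group_add) bimod \<Rightarrow> (('m \<times> 'n \<Rightarrow>\<^sub>0 'k) \<Rightarrow> 'a) \<Rightarrow>
    ((('a \<times> 'a \<Rightarrow>\<^sub>0 'k) \<times> 'm \<Rightarrow>\<^sub>0 'k) \<Rightarrow> ('m \<times> 'h \<Rightarrow>\<^sub>0 'k)) \<Rightarrow>
    ((('a \<times> 'a \<Rightarrow>\<^sub>0 'k) \<times> 'n \<Rightarrow>\<^sub>0 'k) \<Rightarrow> ('n \<times> 'h \<Rightarrow>\<^sub>0 'k)) \<Rightarrow> bool" where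
  "phi_compat H A M N \<alpha> \<phi> \<psi> \<longleftrightarrow> (let B = coinv H A in
     \<forall>p \<in> carr (ind H A (btensor B M N)).
       phi_B H A (tlin (\<lambda>z y. ext_pure (sq H A) H A (mult_bimod B A) z (\<alpha> y)) p)
     = tlin (\<lambda>y h. tpure A H (\<alpha> y) h) (phi_tensor H A M N \<phi> \<psi> p))"

definition H_stable :: "('k::field, 'h::ring_1) hopf \<Rightarrow>
    ('k, 'a::{ring,monoid_mult}, 'h) comod_alg \<Rightarrow> ('k, 'a, 'm::ab_group_add) bimod \<Rightarrow>
    ('k, 'a, 'n::ab_group_add) bimod \<Rightarrow> (('m \<times> 'n \<Rightarrow>\<^sub>0 'k) \<Rightarrow> 'a) \<Rightarrow>
    (('n \<times> 'm \<Rightarrow>\<^sub>0 'k) \<Rightarrow> 'a) \<Rightarrow> bool" where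
  "H_stable H A M N \<alpha> \<beta> \<longleftrightarrow> (\<exists>\<phi> \<psi>.
     hbimod_iso (coinv H A) H (ind H A M) (tensorH H M) \<phi>
     \<and> hbimod_iso (coinv H A) H (ind H A N) (tensorH H N) \<psi>
     \<and> phi_compat H A M N \<alpha> \<phi> \<psi> \<and> phi_compat H A N M \<beta> \<psi> \<phi>)"


section \<open>The algebra \<open>E\<close> and the action on its coinvariants\<close>

text \<open>
  The left \<open>A\<^sup>\<box>\<^sup>e\<close>-linear endomorphisms of \<open>P = A\<^sup>\<box>\<^sup>e \<otimes>\<^bsub>B\<^sup>e\<^esub> M\<close>. They are extended by \<open>0\<close> outside
  the carrier, so that equality, sums and composites of functions are those of endomorphisms.
\<close>

definition sq_End :: "('k::field, 'h::ring_1) hopf \<Rightarrow>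
    ('k, 'a::{ring,monoid_mult}, 'h) comod_alg \<Rightarrow> ('k, 'a, 'm::ab_group_add) bimod \<Rightarrow>
    ('k, (('a \<times> 'a \<Rightarrow>\<^sub>0 'k) \<times> 'm \<Rightarrow>\<^sub>0 'k) \<Rightarrow> (('a \<times> 'a \<Rightarrow>\<^sub>0 'k) \<times> 'm \<Rightarrow>\<^sub>0 'k)) vsp" where
  "sq_End H A M = (let P = ind H A M in
     \<lparr>carr = {f. lin P P f
        \<and> (\<forall>w\<in>carr (sq H A). \<forall>p\<in>carr P.
             f (ext_act (sq H A) H A M w p) = ext_act (sq H A) H A M w (f p))
        \<and> (\<forall>p. p \<notin> carr P \<longrightarrow> f p = 0)},
      scl = (\<lambda>c f p. pm_scale c (f p))\<rparr>)"

text \<open>\<open>E_coacts H A M f w\<close>: \<open>w\<close> is the (unique) element \<open>f\<^sub>[\<^sub>0\<^sub>] \<otimes> f\<^sub>[\<^sub>1\<^sub>]\<close>.\<close>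

definition E_coacts :: "('k::field, 'h::ring_1) hopf \<Rightarrow>
    ('k, 'a::{ring,monoid_mult}, 'h) comod_alg \<Rightarrow> ('k, 'a, 'm::ab_group_add) bimod \<Rightarrow>
    ((('a \<times> 'a \<Rightarrow>\<^sub>0 'k) \<times> 'm \<Rightarrow>\<^sub>0 'k) \<Rightarrow> (('a \<times> 'a \<Rightarrow>\<^sub>0 'k) \<times> 'm \<Rightarrow>\<^sub>0 'k)) \<Rightarrow>
    (((('a \<times> 'a \<Rightarrow>\<^sub>0 'k) \<times> 'm \<Rightarrow>\<^sub>0 'k) \<Rightarrow> (('a \<times> 'a \<Rightarrow>\<^sub>0 'k) \<times> 'm \<Rightarrow>\<^sub>0 'k)) \<times> 'h \<Rightarrow>\<^sub>0 'k) \<Rightarrow>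
    bool" where
  "E_coacts H A M f w \<longleftrightarrow> (let P = ind H A M in
     w \<in> carr (tensor (sq_End H A M) H)
     \<and> (\<forall>p\<in>carr P. coact P (f p)
          = tlin (\<lambda>f0 f1. tlin (\<lambda>p0 p1. tpure P H (f0 p0) (p1 * f1)) (coact P p)) w))"

text \<open>
  The underlying vector space of \<open>E\<close> consists of the rational endomorphisms; the multiplication
  of \<open>E\<close> is opposite to composition.
\<close>

definition E_alg :: "('k::field, 'h::ring_1) hopf \<Rightarrow>
    ('k, 'a::{ring,monoid_mult}, 'h) comod_alg \<Rightarrow> ('k, 'a, 'm::ab_group_add) bimod \<Rightarrow>
    ('k, (('a \<times> 'a \<Rightarrow>\<^sub>0 'k) \<times> 'm \<Rightarrow>\<^sub>0 'k) \<Rightarrow> (('a \<times> 'a \<Rightarrow>\<^sub>0 'k) \<times> 'm \<Rightarrow>\<^sub>0 'k)) vsp" where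
  "E_alg H A M = \<lparr>carr = {f \<in> carr (sq_End H A M). \<exists>w. E_coacts H A M f w},
     scl = scl (sq_End H A M)\<rparr>"

definition E_mult :: "('p \<Rightarrow> 'p) \<Rightarrow> ('p \<Rightarrow> 'p) \<Rightarrow> ('p \<Rightarrow> 'p)" (infixl \<open>\<cdot>\<^sub>E\<close> 70) where
  "e \<cdot>\<^sub>E e' = e' \<circ> e"

definition E_one :: "('k::field, 'h::ring_1) hopf \<Rightarrow>
    ('k, 'a::{ring,monoid_mult}, 'h) comod_alg \<Rightarrow> ('k, 'a, 'm::ab_group_add) bimod \<Rightarrow>
    (('a \<times> 'a \<Rightarrow>\<^sub>0 'k) \<times> 'm \<Rightarrow>\<^sub>0 'k) \<Rightarrow> (('a \<times> 'a \<Rightarrow>\<^sub>0 'k) \<times> 'm \<Rightarrow>\<^sub>0 'k)" where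
  "E_one H A M p = (if p \<in> carr (ind H A M) then p else 0)"

definition E_coinv :: "('k::field, 'h::ring_1) hopf \<Rightarrow>
    ('k, 'a::{ring,monoid_mult}, 'h) comod_alg \<Rightarrow> ('k, 'a, 'm::ab_group_add) bimod \<Rightarrow>
    ((('a \<times> 'a \<Rightarrow>\<^sub>0 'k) \<times> 'm \<Rightarrow>\<^sub>0 'k) \<Rightarrow> (('a \<times> 'a \<Rightarrow>\<^sub>0 'k) \<times> 'm \<Rightarrow>\<^sub>0 'k)) set" where
  "E_coinv H A M =
     {f \<in> carr (E_alg H A M). E_coacts H A M f (tpure (sq_End H A M) H f 1)}"

definition lambda_map :: "('k::field, 'h::ring_1) hopf \<Rightarrow>
    ('k, 'a::{ring,monoid_mult}, 'h) comod_alg \<Rightarrow> ('k, 'a, 'm::ab_group_add) bimod \<Rightarrow> 'a \<Rightarrow>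
    (('a \<times> 'a \<Rightarrow>\<^sub>0 'k) \<times> 'm \<Rightarrow>\<^sub>0 'k) \<Rightarrow> (('a \<times> 'a \<Rightarrow>\<^sub>0 'k) \<times> 'm \<Rightarrow>\<^sub>0 'k)" where
  "lambda_map H A M x p = (if p \<in> carr (ind H A M)
     then tlin (\<lambda>z m. ext_pure (sq H A) H A M z (lact M x m)) p else 0)"

text \<open>\<open>t : H \<rightarrow> E\<close> is colinear with \<open>t(1) = 1\<close>, and \<open>u\<close> is its convolution inverse.\<close>

definition cleaving :: "('k::field, 'h::ring_1) hopf \<Rightarrow>
    ('k, 'a::{ring,monoid_mult}, 'h) comod_alg \<Rightarrow> ('k, 'a, 'm::ab_group_add) bimod \<Rightarrow>
    ('h \<Rightarrow> (('a \<times> 'a \<Rightarrow>\<^sub>0 'k) \<times> 'm \<Rightarrow>\<^sub>0 'k) \<Rightarrow> (('a \<times> 'a \<Rightarrow>\<^sub>0 'k) \<times> 'm \<Rightarrow>\<^sub>0 'k)) \<Rightarrow>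
    ('h \<Rightarrow> (('a \<times> 'a \<Rightarrow>\<^sub>0 'k) \<times> 'm \<Rightarrow>\<^sub>0 'k) \<Rightarrow> (('a \<times> 'a \<Rightarrow>\<^sub>0 'k) \<times> 'm \<Rightarrow>\<^sub>0 'k)) \<Rightarrow> bool" where
  "cleaving H A M t u \<longleftrightarrow> (let E = E_alg H A M in
     lin H E t \<and> lin H E u
     \<and> (\<forall>h. E_coacts H A M (t h)
          (tlin (\<lambda>h1 h2. tpure (sq_End H A M) H (t h1) h2) (comult H h)))
     \<and> t 1 = E_one H A M
     \<and> (\<forall>h. linext (scl E) (\<lambda>h1 h2. t h1 \<cdot>\<^sub>E u h2) (comult H h)
          = scl E (counit H h) (E_one H A M))
     \<and> (\<forall>h. linext (scl E) (\<lambda>h1 h2. u h1 \<cdot>\<^sub>E t h2) (comult H h)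
          = scl E (counit H h) (E_one H A M)))"

definition E_action :: "('k::field, 'h::ring_1) hopf \<Rightarrow>
    ('k, 'a::{ring,monoid_mult}, 'h) comod_alg \<Rightarrow> ('k, 'a, 'm::ab_group_add) bimod \<Rightarrow>
    ('h \<Rightarrow> (('a \<times> 'a \<Rightarrow>\<^sub>0 'k) \<times> 'm \<Rightarrow>\<^sub>0 'k) \<Rightarrow> (('a \<times> 'a \<Rightarrow>\<^sub>0 'k) \<times> 'm \<Rightarrow>\<^sub>0 'k)) \<Rightarrow>
    ('h \<Rightarrow> (('a \<times> 'a \<Rightarrow>\<^sub>0 'k) \<times> 'm \<Rightarrow>\<^sub>0 'k) \<Rightarrow> (('a \<times> 'a \<Rightarrow>\<^sub>0 'k) \<times> 'm \<Rightarrow>\<^sub>0 'k)) \<Rightarrow> 'h \<Rightarrow>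
    ((('a \<times> 'a \<Rightarrow>\<^sub>0 'k) \<times> 'm \<Rightarrow>\<^sub>0 'k) \<Rightarrow> (('a \<times> 'a \<Rightarrow>\<^sub>0 'k) \<times> 'm \<Rightarrow>\<^sub>0 'k)) \<Rightarrow>
    (('a \<times> 'a \<Rightarrow>\<^sub>0 'k) \<times> 'm \<Rightarrow>\<^sub>0 'k) \<Rightarrow> (('a \<times> 'a \<Rightarrow>\<^sub>0 'k) \<times> 'm \<Rightarrow>\<^sub>0 'k)" where
  "E_action H A M t u h e =
     linext (scl (E_alg H A M)) (\<lambda>h1 h2. t h1 \<cdot>\<^sub>E e \<cdot>\<^sub>E u h2) (comult H h)"

end

theory Submission
  imports Defs
begin

text \<open>
  Write \<open>h \<sqdot> x = \<Sum> l\<^sub>i(S h) x r\<^sub>i(S h)\<close> for the Miyashita-Ulbrich action; \<open>S\<close> is its own inverse since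
  \<open>H\<close> is cocommutative. The element \<open>h \<sqdot> x\<close> is central in \<open>B\<close> again, and every \<open>a \<in> A\<close> satisfies
  \<open>a x = (a\<^sub>1 \<sqdot> x) a\<^sub>0\<close> (\<open>\<chi>_center\<close>, \<open>mult_x\<close>). Both facts come from the map \<open>a \<otimes> b \<mapsto> a x b\<close> on
  \<open>A \<otimes>\<^sub>B A\<close>, transported to \<open>A \<otimes> H\<close> along the canonical map.

  Let \<open>P = A\<^sup>\<box>\<^sup>e \<otimes>\<^bsub>B\<^sup>e\<^esub> M\<close>. The endomorphism \<open>\<lambda>\<^sub>x\<close> multiplies by \<open>x\<close> in the middle of this tensor
  product. The commutation rule moves \<open>x\<close> to the outside: \<open>\<lambda>\<^sub>x p = (p\<^sub>1 \<sqdot> x) p\<^sub>0\<close> for all \<open>p \<in> P\<close>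
  (\<open>lam_eq_action\<close>). For \<open>p = 1 \<otimes> m\<close>, which is coinvariant, colinearity of \<open>t\<close> then gives
  \<open>\<lambda>\<^sub>x (t(h) p) = (h\<^sub>2 \<sqdot> x) t(h\<^sub>1) p\<close>. The maps \<open>u(h)\<close> commute with the left action of \<open>B\<close>, so
  \<open>(h \<bullet> \<lambda>\<^sub>x) p = (h\<^sub>2 \<sqdot> x) u(h\<^sub>3) t(h\<^sub>1) p\<close>, and this is \<open>(h \<sqdot> x) p = \<lambda>\<^bsub>h \<sqdot> x\<^esub> p\<close> by
  cocommutativity and because \<open>u\<close> is the convolution inverse of \<open>t\<close> (\<open>E_action_unit\<close>). Since the
  elements \<open>1 \<otimes> m\<close> generate \<open>P\<close>, it follows that \<open>h \<bullet> \<lambda>\<^sub>x = \<lambda>\<^bsub>h \<sqdot> x\<^esub>\<close> (\<open>E_action_lam\<close>).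

  To transport the action back to the center of \<open>B\<close>, the map \<open>x \<mapsto> \<lambda>\<^sub>x\<close> has to be injective there
  (\<open>lam_inj\<close>). An isomorphism \<open>\<phi> : P \<rightarrow> M \<otimes> H\<close> provides coinvariant elements
  \<open>p = \<phi>\<^sup>-\<^sup>1 (m \<otimes> 1)\<close>, for which \<open>\<phi> (\<lambda>\<^sub>x p) = \<phi> (x p) = x m \<otimes> 1\<close>. So \<open>\<lambda>\<^sub>x\<close> determines the action of
  \<open>x\<close> on \<open>M\<close>, and hence \<open>x\<close>, as \<open>M\<close> is part of a strict Morita context.

  The coaction of \<open>P\<close> is only meaningful once the coaction of \<open>A\<^sup>e\<close> is known to map \<open>A\<^sup>\<box>\<^sup>e\<close> into
  \<open>A\<^sup>\<box>\<^sup>e \<otimes> H\<close>. This is checked on the components with respect to a basis of \<open>H\<close>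
  (\<open>slice_ae_coact_in_sq\<close>).

  Identities between Sweedler sums are proved for an arbitrary multilinear summand; the lemmas on
  \<open>linext\<close> and \<open>bal_proj\<close> reduce equations of chosen representatives to such identities.
\<close>

text \<open>
  Linearity on a subspace \<open>V\<close>. Actions and coactions are meaningful on carriers only, whereas
  \<open>linext\<close> is defined on all formal combinations; most maps below are linear on a carrier in their
  arguments and take values in a space that needs no carrier.
\<close>

definition klin :: "'v::plus set \<Rightarrow> ('k \<Rightarrow> 'v \<Rightarrow> 'v) \<Rightarrow> ('k \<Rightarrow> 'w \<Rightarrow> 'w::plus) \<Rightarrow> ('v \<Rightarrow> 'w) \<Rightarrow> bool"
  where "klin V s s' f \<longleftrightarrow> (\<forall>x\<in>V. \<forall>y\<in>V. f (x + y) = f x + f y) \<and> (\<forall>c. \<forall>x\<in>V. f (s c x) = s' c (f x))"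

definition bilin :: "('k::field, 'x::ab_group_add, 'e) vsp_scheme \<Rightarrow>
    ('k, 'y::ab_group_add, 'f) vsp_scheme \<Rightarrow> ('k \<Rightarrow> 'z \<Rightarrow> 'z::ab_group_add) \<Rightarrow>
    ('x \<Rightarrow> 'y \<Rightarrow> 'z) \<Rightarrow> bool" where
  "bilin X Y s g \<longleftrightarrow> (\<forall>y\<in>carr Y. klin (carr X) (scl X) s (\<lambda>x. g x y))
     \<and> (\<forall>x\<in>carr X. klin (carr Y) (scl Y) s (g x))"

lemma lookup_pm_scale [simp]: "Poly_Mapping.lookup (pm_scale c p) i = c * Poly_Mapping.lookup p i"
  unfolding pm_scale_def by (simp add: Poly_Mapping.map.rep_eq when_def)

lemma keys_pm_scale: "Poly_Mapping.keys (pm_scale c p) \<subseteq> Poly_Mapping.keys p"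
  by (auto simp: in_keys_iff)

interpretation PM: vector_space "pm_scale :: 'k::field \<Rightarrow> ('i \<Rightarrow>\<^sub>0 'k) \<Rightarrow> ('i \<Rightarrow>\<^sub>0 'k)"
  by (rule vector_space_pm_scale)

lemma pm_scale_single [simp]: "pm_scale c (Poly_Mapping.single i d) = Poly_Mapping.single i (c * d)"
  by (rule poly_mapping_eqI) (simp add: lookup_single when_def)

lemma klin_zero: "vector_space s \<Longrightarrow> vector_space s' \<Longrightarrow> klin V s s' f \<Longrightarrow> (0::'v::ab_group_add) \<in> V \<Longrightarrow> f 0 = (0::'w::ab_group_add)"
  unfolding klin_def by (metis add_cancel_right_right)

section \<open>Sweedler sums\<close>

lemma linext_superset:
  assumes "vector_space s" "finite F" "Poly_Mapping.keys p \<subseteq> F"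
  shows "linext s g p = (\<Sum>i\<in>F. s (Poly_Mapping.lookup p i) (g (fst i) (snd i)))"
proof -
  interpret vector_space s by fact
  show ?thesis unfolding linext_def
    by (rule sum.mono_neutral_left) (use assms in \<open>auto simp: in_keys_iff\<close>)
qed

lemma linext_add [simp]:
  assumes "vector_space s"
  shows "linext s g (p + q) = linext s g p + linext s g q"
proof -
  interpret vector_space s by fact
  have f: "finite (Poly_Mapping.keys p \<union> Poly_Mapping.keys q)" by simp
  show ?thesis
    using linext_superset[OF assms f, of p g] linext_superset[OF assms f, of q g]
      linext_superset[OF assms f, of "p + q" g] Poly_Mapping.keys_add[of p q]
    by (simp add: lookup_add scale_left_distrib sum.distrib)
qed

lemma linext_scale [simp]:
  assumes "vector_space s"
  shows "linext s g (pm_scale c p) = s c (linext s g p)"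
proof -
  interpret vector_space s by fact
  show ?thesis
    using linext_superset[OF assms Poly_Mapping.finite_keys[of p], of p g]
      linext_superset[OF assms Poly_Mapping.finite_keys[of p], of "pm_scale c p" g] keys_pm_scale[of c p]
    by (simp add: scale_sum_right)
qed

lemma linear_linext: "vector_space s \<Longrightarrow> Vector_Spaces.linear pm_scale s (linext s g)"
  by (intro Vector_Spaces.linear_iff[THEN iffD2] conjI vector_space_pm_scale) auto

lemma linext_zero [simp]: "linext s g 0 = 0"
  by (simp add: linext_def)

lemma linext_diff:
  assumes "vector_space s"
  shows "linext s g (p - q) = linext s g p - linext s g q"
  using Vector_Spaces.linear.axioms(3)[OF linear_linext[OF assms]] module_hom.diff by blast

lemma linext_single [simp]:
  assumes "vector_space s"
  shows "linext s g (Poly_Mapping.single (x, y) c) = s c (g x y)"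
proof -
  interpret vector_space s by fact
  show ?thesis using linext_superset[OF assms, of "{(x,y)}" "Poly_Mapping.single (x, y) c" g]
    by auto
qed

lemma linext_fun_add [simp]:
  assumes "vector_space s"
  shows "linext s (\<lambda>x y. g x y + g' x y) p = linext s g p + linext s g' p"
proof -
  interpret vector_space s by fact
  show ?thesis by (simp add: linext_def scale_right_distrib sum.distrib)
qed

lemma linext_fun_scale:
  assumes "vector_space s"
  shows "linext s (\<lambda>x y. s c (g x y)) p = s c (linext s g p)"
proof -
  interpret vector_space s by fact
  show ?thesis by (simp add: linext_def scale_sum_right mult.commute)
qed

lemmas tlin_fun_scale [simp] = linext_fun_scale[OF vector_space_pm_scale]

lemma linext_fun_zero [simp]:
  assumes "vector_space s"
  shows "linext s (\<lambda>x y. 0) p = 0"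
proof -
  interpret vector_space s by fact
  show ?thesis by (simp add: linext_def)
qed

lemma linext_cong:
  "(\<And>x y. (x, y) \<in> Poly_Mapping.keys p \<Longrightarrow> g x y = g' x y) \<Longrightarrow> linext s g p = linext s g' p"
  unfolding linext_def by (rule sum.cong) auto

lemma linext_simp_cong:
  "p = q \<Longrightarrow> (\<And>x y. (x, y) \<in> Poly_Mapping.keys q \<Longrightarrow> g x y = g' x y) \<Longrightarrow> linext s g p = linext s g' q"
  using linext_cong by blast

lemma linext_in:
  assumes "vector_space s" "module.subspace s V" "\<And>x y. (x, y) \<in> Poly_Mapping.keys p \<Longrightarrow> g x y \<in> V"
  shows "linext s g p \<in> V"
proof -
  interpret vector_space s by fact
  show ?thesis unfolding linext_def using assms(2,3)
    by (intro subspace_sum subspace_scale) auto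
qed

text \<open>
  The values of \<open>g\<close> have to lie in \<open>V\<close> only at the pairs that occur in \<open>p\<close>. This is how a map that
  is linear on a carrier only is moved under a Sweedler sum.
\<close>

lemma klin_linext:
  assumes s: "vector_space s" "vector_space s'" and V: "module.subspace s V"
    and f: "klin V s s' f" and g: "\<And>x y. (x, y) \<in> Poly_Mapping.keys p \<Longrightarrow> g x y \<in> V"
  shows "f (linext s g p) = linext s' (\<lambda>x y. f (g x y)) p"
proof -
  interpret vector_space s by fact
  have "f (\<Sum>i\<in>F. s (Poly_Mapping.lookup p i) (g (fst i) (snd i))) = (\<Sum>i\<in>F. s' (Poly_Mapping.lookup p i) (f (g (fst i) (snd i))))
     \<and> (\<Sum>i\<in>F. s (Poly_Mapping.lookup p i) (g (fst i) (snd i))) \<in> V"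
    if "finite F" "F \<subseteq> Poly_Mapping.keys p" for F
    using that
  proof (induction F)
    case empty
    then show ?case using klin_zero[OF s f] subspace_0[OF V] by simp
  next
    case (insert i F)
    have "g (fst i) (snd i) \<in> V" using insert g by auto
    moreover have "s (Poly_Mapping.lookup p i) (g (fst i) (snd i)) \<in> V"
      using calculation V subspace_scale by blast
    ultimately show ?case using insert f V subspace_add
      by (simp add: klin_def)
  qed
  then show ?thesis unfolding linext_def by auto
qed

lemma klin_linext_UNIV:
  assumes s: "vector_space s" "vector_space s'" and f: "klin UNIV s s' f"
  shows "f (linext s g p) = linext s' (\<lambda>x y. f (g x y)) p"
proof -
  interpret vector_space s by fact
  show ?thesis by (rule klin_linext[OF s subspace_UNIV f]) simp
qed

lemma linext_linext:
  assumes "vector_space s"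
  shows "linext s g (tlin f p) = linext s (\<lambda>x y. linext s g (f x y)) p"
  by (rule klin_linext_UNIV) (use assms vector_space_pm_scale in \<open>auto simp: klin_def\<close>)

lemma linext_swap:
  assumes "vector_space s"
  shows "linext s (\<lambda>x y. linext s (\<lambda>u v. g x y u v) q) p = linext s (\<lambda>u v. linext s (\<lambda>x y. g x y u v) p) q"
proof -
  interpret vector_space s by fact
  show ?thesis
    unfolding linext_def scale_sum_right scale_scale
    by (subst sum.swap) (simp add: mult.commute)
qed

lemma linext_mult_left:
  assumes A: "k_algebra A"
  shows "a * linext (scl A) g p = linext (scl A) (\<lambda>x y. a * g x y) p"
proof (rule klin_linext_UNIV)
  show "klin UNIV (scl A) (scl A) ((*) a)"
    using A unfolding k_algebra_def klin_def by (metis distrib_left)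
qed (use A in \<open>auto simp: k_algebra_def vspace_def\<close>)

section \<open>Balanced tensor products\<close>

lemma bal_proj_diff_in_span:
  "bal_proj R ra la X Y q - q \<in> PM.span (bal_rels R ra la X Y)"
proof -
  interpret L: Vector_Spaces.linear pm_scale pm_scale "bal_proj R ra la X Y" by (rule bal_proj(1))
  show ?thesis by (subst bal_proj(3)[symmetric]) (simp add: L.diff bal_proj(2))
qed

lemma bal_relsI:
  "x \<in> carr X \<Longrightarrow> x' \<in> carr X \<Longrightarrow> y \<in> carr Y \<Longrightarrow>
    basis_elt (x + x') y - basis_elt x y - basis_elt x' y \<in> bal_rels R ra la X Y"
  "x \<in> carr X \<Longrightarrow> y \<in> carr Y \<Longrightarrow> y' \<in> carr Y \<Longrightarrow>
    basis_elt x (y + y') - basis_elt x y - basis_elt x y' \<in> bal_rels R ra la X Y"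
  "x \<in> carr X \<Longrightarrow> y \<in> carr Y \<Longrightarrow>
    basis_elt (scl X c x) y - pm_scale c (basis_elt x y) \<in> bal_rels R ra la X Y"
  "x \<in> carr X \<Longrightarrow> y \<in> carr Y \<Longrightarrow>
    basis_elt x (scl Y c y) - pm_scale c (basis_elt x y) \<in> bal_rels R ra la X Y"
  "r \<in> R \<Longrightarrow> x \<in> carr X \<Longrightarrow> y \<in> carr Y \<Longrightarrow>
    basis_elt (ra x r) y - basis_elt x (la r y) \<in> bal_rels R ra la X Y"
  unfolding bal_rels_def by (simp_all del: pm_scale_single, metis+)

lemma bal_relsE:
  assumes "p \<in> bal_rels R ra la X Y"
  obtains
    (add_left) x x' y where "p = basis_elt (x + x') y - basis_elt x y - basis_elt x' y"
      "x \<in> carr X" "x' \<in> carr X" "y \<in> carr Y"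
  | (add_right) x y y' where "p = basis_elt x (y + y') - basis_elt x y - basis_elt x y'"
      "x \<in> carr X" "y \<in> carr Y" "y' \<in> carr Y"
  | (scale_left) c x y where "p = basis_elt (scl X c x) y - pm_scale c (basis_elt x y)"
      "x \<in> carr X" "y \<in> carr Y"
  | (scale_right) c x y where "p = basis_elt x (scl Y c y) - pm_scale c (basis_elt x y)"
      "x \<in> carr X" "y \<in> carr Y"
  | (balance) r x y where "p = basis_elt (ra x r) y - basis_elt x (la r y)"
      "r \<in> R" "x \<in> carr X" "y \<in> carr Y"
  using assms unfolding bal_rels_def by (elim UnE CollectE exE conjE) blast+

text \<open>
  The universal property of the tensor product: a balanced bilinear map vanishes on the relations,
  so its extension takes the same value at a formal combination and at the chosen representative.
\<close>

lemma linext_bal_proj: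
  assumes s: "vector_space s" and g: "bilin X Y s g"
    and bal: "\<And>r x y. r \<in> R \<Longrightarrow> x \<in> carr X \<Longrightarrow> y \<in> carr Y \<Longrightarrow> g (ra x r) y = g x (la r y)"
  shows "linext s g (bal_proj R ra la X Y q) = linext s g q"
proof -
  interpret S: vector_space s by fact
  interpret L: Vector_Spaces.linear pm_scale s "linext s g" by (rule linear_linext[OF s])
  have rel: "linext s g p = 0" if "p \<in> bal_rels R ra la X Y" for p
    using that
  proof (cases rule: bal_relsE)
    case (add_left x x' y)
    then have "g (x + x') y = g x y + g x' y" using g by (simp add: bilin_def klin_def)
    with add_left(1) show ?thesis by (simp add: linext_diff[OF s] linext_single[OF s])
  next
    case (add_right x y y')
    then have "g x (y + y') = g x y + g x y'" using g by (simp add: bilin_def klin_def)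
    with add_right(1) show ?thesis by (simp add: linext_diff[OF s] linext_single[OF s])
  next
    case (scale_left c x y)
    then have "g (scl X c x) y = s c (g x y)" using g by (simp add: bilin_def klin_def)
    with scale_left(1) show ?thesis by (simp add: linext_diff[OF s] linext_single[OF s])
  next
    case (scale_right c x y)
    then have "g x (scl Y c y) = s c (g x y)" using g by (simp add: bilin_def klin_def)
    with scale_right(1) show ?thesis by (simp add: linext_diff[OF s] linext_single[OF s])
  next
    case (balance r x y)
    with bal[OF balance(2-4)] show ?thesis by (simp add: linext_diff[OF s] linext_single[OF s])
  qed
  have "linext s g p = 0" if "p \<in> PM.span (bal_rels R ra la X Y)" for p
    using that
  proof (induction rule: PM.span_induct_alt)
    case base
    then show ?case by simp
  next
    case (step c p q)
    then show ?case using rel by (simp add: L.add L.scale)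
  qed
  from this[OF bal_proj_diff_in_span[of R ra la X Y q]] show ?thesis by (simp add: L.diff)
qed

lemma linext_bal_pure:
  assumes s: "vector_space s" and g: "bilin X Y s g"
    and bal: "\<And>r x y. r \<in> R \<Longrightarrow> x \<in> carr X \<Longrightarrow> y \<in> carr Y \<Longrightarrow> g (ra x r) y = g x (la r y)"
  shows "linext s g (bal_pure R ra la X Y x y) = g x y"
proof -
  interpret vector_space s by fact
  have "linext s g (bal_pure R ra la X Y x y) = linext s g (basis_elt x y)"
    unfolding bal_pure_def
    by (rule linext_bal_proj[where R=R and ra=ra and la=la and X=X and Y=Y]) (rule s, rule g, rule bal)
  then show ?thesis by (simp add: linext_single[OF s])
qed

lemma bal_proj_eqI:
  assumes "p - q \<in> PM.span (bal_rels R ra la X Y)"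
  shows "bal_proj R ra la X Y p = bal_proj R ra la X Y q"
proof -
  interpret L: Vector_Spaces.linear pm_scale pm_scale "bal_proj R ra la X Y" by (rule bal_proj(1))
  have "bal_proj R ra la X Y (p - q) = 0" by (rule iffD2[OF bal_proj(3) assms])
  then have "bal_proj R ra la X Y p - bal_proj R ra la X Y q = 0" unfolding L.diff .
  then show ?thesis unfolding right_minus_eq .
qed

lemma bilin_bal_pure: "bilin X Y pm_scale (bal_pure R ra la X Y)"
proof -
  interpret L: Vector_Spaces.linear pm_scale pm_scale "bal_proj R ra la X Y" by (rule bal_proj(1))
  have "bal_pure R ra la X Y (x + x') y = bal_pure R ra la X Y x y + bal_pure R ra la X Y x' y"
    if "x \<in> carr X" "x' \<in> carr X" "y \<in> carr Y" for x x' y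
    unfolding bal_pure_def 
    by (subst L.add[symmetric], rule bal_proj_eqI, rule PM.span_base,
        rule bal_relsI(1)[OF that, unfolded diff_diff_eq])
  moreover have "bal_pure R ra la X Y x (y + y') = bal_pure R ra la X Y x y + bal_pure R ra la X Y x y'"
    if "x \<in> carr X" "y \<in> carr Y" "y' \<in> carr Y" for x y y'
    unfolding bal_pure_def 
    by (subst L.add[symmetric], rule bal_proj_eqI, rule PM.span_base,
        rule bal_relsI(2)[OF that, unfolded diff_diff_eq])
  moreover have "bal_pure R ra la X Y (scl X c x) y = pm_scale c (bal_pure R ra la X Y x y)"
    if "x \<in> carr X" "y \<in> carr Y" for x y c
    unfolding bal_pure_def 
    by (subst L.scale[symmetric], rule bal_proj_eqI, rule PM.span_base, rule bal_relsI(3)[OF that])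
  moreover have "bal_pure R ra la X Y x (scl Y c y) = pm_scale c (bal_pure R ra la X Y x y)"
    if "x \<in> carr X" "y \<in> carr Y" for x y c
    unfolding bal_pure_def 
    by (subst L.scale[symmetric], rule bal_proj_eqI, rule PM.span_base, rule bal_relsI(4)[OF that])
  ultimately show ?thesis unfolding bilin_def klin_def by simp
qed

lemma bal_pure_balanced:
  "r \<in> R \<Longrightarrow> x \<in> carr X \<Longrightarrow> y \<in> carr Y \<Longrightarrow>
    bal_pure R ra la X Y (ra x r) y = bal_pure R ra la X Y x (la r y)"
  unfolding bal_pure_def
  by (rule bal_proj_eqI, rule PM.span_base, rule bal_relsI(5))

lemma bal_pure_in_carr: "x \<in> carr X \<Longrightarrow> y \<in> carr Y \<Longrightarrow> bal_pure R ra la X Y x y \<in> bal_carr R ra la X Y"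
  unfolding bal_carr_def by (rule PM.span_base) blast

lemma subspace_bal_carr: "PM.subspace (bal_carr R ra la X Y)"
  unfolding bal_carr_def by (rule PM.subspace_span)

lemma bal_carr_eqI:
  assumes p: "p \<in> bal_carr R ra la X Y"
    and f: "klin UNIV pm_scale s f" and g: "klin UNIV pm_scale s g" and s: "vector_space s"
    and eq: "\<And>x y. x \<in> carr X \<Longrightarrow> y \<in> carr Y \<Longrightarrow> f (bal_pure R ra la X Y x y) = g (bal_pure R ra la X Y x y)"
  shows "f p = g p"
  using p unfolding bal_carr_def
proof (induction rule: PM.span_induct_alt)
  case base
  then show ?case using klin_zero[OF vector_space_pm_scale s f] klin_zero[OF vector_space_pm_scale s g] by simp
next
  case (step c p q)
  then show ?case using f g eq by (auto simp: klin_def)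
qed

lemma tlin_bal_pure:
  assumes "p \<in> bal_carr R ra la X Y"
  shows "tlin (bal_pure R ra la X Y) p = p"
  by (rule bal_carr_eqI[OF assms, where g="\<lambda>p. p"])
   (auto simp: klin_def vector_space_pm_scale linext_bal_pure bilin_bal_pure bal_pure_balanced)

text \<open>
  The representatives involve only pairs from the carriers, although the complement of the span of
  the relations is an arbitrary one: the projection changes a pair from the carriers by a
  combination of relations, and these consist of such pairs.
\<close>

lemma bal_carr_keys:
  fixes X :: "('k::field, 'x::ab_group_add, 'e) vsp_scheme" and Y :: "('k, 'y::ab_group_add, 'f) vsp_scheme"
  assumes X: "vspace X" and Y: "vspace Y"
    and ra: "\<And>r x. r \<in> R \<Longrightarrow> x \<in> carr X \<Longrightarrow> ra x r \<in> carr X"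
    and la: "\<And>r y. r \<in> R \<Longrightarrow> y \<in> carr Y \<Longrightarrow> la r y \<in> carr Y"
    and p: "p \<in> bal_carr R ra la X Y"
  shows "Poly_Mapping.keys p \<subseteq> carr X \<times> carr Y"
proof -
  interpret VX: vector_space "scl X" using X by (simp add: vspace_def)
  interpret VY: vector_space "scl Y" using Y by (simp add: vspace_def)
  have cX: "VX.subspace (carr X)" and cY: "VY.subspace (carr Y)" using X Y by (auto simp: vspace_def)
  define Q :: "(_ \<Rightarrow>\<^sub>0 'k) set" where "Q = {q. Poly_Mapping.keys q \<subseteq> carr X \<times> carr Y}"
  have Q: "PM.subspace Q"
    unfolding Q_def PM.subspace_def
    using Poly_Mapping.keys_add keys_pm_scale by fastforce
  have bas: "basis_elt x y \<in> Q" if "x \<in> carr X" "y \<in> carr Y" for x y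
    using that by (simp add: Q_def)
  have "p \<in> Q" if "p \<in> bal_rels R ra la X Y" for p
    using that
    by (cases rule: bal_relsE)
      (auto intro!: PM.subspace_diff[OF Q] PM.subspace_scale[OF Q] bas ra la
        intro: VX.subspace_add[OF cX] VY.subspace_add[OF cY]
          VX.subspace_scale[OF cX] VY.subspace_scale[OF cY] simp del: pm_scale_single)
  then have "PM.span (bal_rels R ra la X Y) \<subseteq> Q"
    by (intro PM.span_minimal[OF _ Q]) blast
  then have "bal_proj R ra la X Y (basis_elt x y) \<in> Q" if "x \<in> carr X" "y \<in> carr Y" for x y
    using PM.subspace_add[OF Q bas[OF that], of "bal_proj R ra la X Y (basis_elt x y) - basis_elt x y"]
      bal_proj_diff_in_span[of R ra la X Y "basis_elt x y"] by auto
  then have "bal_carr R ra la X Y \<subseteq> Q"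
    unfolding bal_carr_def by (intro PM.span_minimal[OF _ Q]) (auto simp: bal_pure_def)
  then show ?thesis using p by (auto simp: Q_def)
qed

lemma klinI:
  "(\<And>x y. x \<in> V \<Longrightarrow> y \<in> V \<Longrightarrow> f (x + y) = f x + f y) \<Longrightarrow> (\<And>c x. x \<in> V \<Longrightarrow> f (s c x) = s' c (f x))
    \<Longrightarrow> klin V s s' f"
  by (simp add: klin_def)

lemma bilinI:
  assumes "\<And>x x' y. x \<in> carr X \<Longrightarrow> x' \<in> carr X \<Longrightarrow> y \<in> carr Y \<Longrightarrow> g (x + x') y = g x y + g x' y"
    and "\<And>c x y. x \<in> carr X \<Longrightarrow> y \<in> carr Y \<Longrightarrow> g (scl X c x) y = s c (g x y)"
    and "\<And>x y y'. x \<in> carr X \<Longrightarrow> y \<in> carr Y \<Longrightarrow> y' \<in> carr Y \<Longrightarrow> g x (y + y') = g x y + g x y'"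
    and "\<And>c x y. x \<in> carr X \<Longrightarrow> y \<in> carr Y \<Longrightarrow> g x (scl Y c y) = s c (g x y)"
  shows "bilin X Y s g"
  using assms by (simp add: bilin_def klin_def)

definition trilin :: "('k::field, 'x::ab_group_add, 'e) vsp_scheme \<Rightarrow>
    ('k, 'y::ab_group_add, 'f) vsp_scheme \<Rightarrow> ('k, 'w::ab_group_add, 'g) vsp_scheme \<Rightarrow>
    ('k \<Rightarrow> 'z \<Rightarrow> 'z::ab_group_add) \<Rightarrow> ('x \<Rightarrow> 'y \<Rightarrow> 'w \<Rightarrow> 'z) \<Rightarrow> bool" where
  "trilin X Y Z s T \<longleftrightarrow> (\<forall>z\<in>carr Z. bilin X Y s (\<lambda>x y. T x y z))
     \<and> (\<forall>x\<in>carr X. \<forall>y\<in>carr Y. klin (carr Z) (scl Z) s (T x y))"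

section \<open>Tensor products over the ground field\<close>

lemma scl_tensor [simp]: "scl (tensor X Y) = pm_scale"
  by (simp add: tensor_def)

lemma carr_tensor: "carr (tensor X Y) = bal_carr ({} :: unit set) (\<lambda>x _. x) (\<lambda>_ y. y) X Y"
  by (simp add: tensor_def)

lemma vspace_tensor [simp]: "vspace (tensor X Y)"
  by (simp add: vspace_def vector_space_pm_scale carr_tensor subspace_bal_carr)

lemma tpure_in [simp]: "x \<in> carr X \<Longrightarrow> y \<in> carr Y \<Longrightarrow> tpure X Y x y \<in> carr (tensor X Y)"
  by (simp add: tpure_def carr_tensor bal_pure_in_carr)

lemma bilin_tpure: "bilin X Y pm_scale (tpure X Y)"
  by (simp add: tpure_def bilin_bal_pure)

lemma tpure_simps [simp]:
  "x \<in> carr X \<Longrightarrow> x' \<in> carr X \<Longrightarrow> y \<in> carr Y \<Longrightarrow> tpure X Y (x + x') y = tpure X Y x y + tpure X Y x' y"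
  "x \<in> carr X \<Longrightarrow> y \<in> carr Y \<Longrightarrow> y' \<in> carr Y \<Longrightarrow> tpure X Y x (y + y') = tpure X Y x y + tpure X Y x y'"
  "x \<in> carr X \<Longrightarrow> y \<in> carr Y \<Longrightarrow> tpure X Y (scl X c x) y = pm_scale c (tpure X Y x y)"
  "x \<in> carr X \<Longrightarrow> y \<in> carr Y \<Longrightarrow> tpure X Y x (scl Y c y) = pm_scale c (tpure X Y x y)"
  using bilin_tpure[of X Y] by (simp_all add: bilin_def klin_def)

lemma linext_tpure:
  "vector_space s \<Longrightarrow> bilin X Y s g \<Longrightarrow> linext s g (tpure X Y x y) = g x y"
  unfolding tpure_def by (rule linext_bal_pure) auto

lemma tlin_tpure: "p \<in> carr (tensor X Y) \<Longrightarrow> tlin (tpure X Y) p = p"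
  by (simp add: carr_tensor tpure_def tlin_bal_pure)

lemma tensor_keys:
  assumes "vspace X" "vspace Y" "p \<in> carr (tensor X Y)" "(x, y) \<in> Poly_Mapping.keys p"
  shows "x \<in> carr X" "y \<in> carr Y"
  using bal_carr_keys[OF assms(1,2) _ _ assms(3)[unfolded carr_tensor]] assms(4) by auto

lemma tlin_in_tensor:
  "(\<And>x y. (x, y) \<in> Poly_Mapping.keys p \<Longrightarrow> g x y \<in> carr (tensor X Y)) \<Longrightarrow> tlin g p \<in> carr (tensor X Y)"
  by (rule linext_in) (auto simp: vector_space_pm_scale carr_tensor subspace_bal_carr)

lemma vspaceD: "vspace X \<Longrightarrow> vector_space (scl X)" "vspace X \<Longrightarrow> module.subspace (scl X) (carr X)"
  by (auto simp: vspace_def)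

lemma vspace_closed:
  assumes "vspace X" shows "0 \<in> carr X" "x \<in> carr X \<Longrightarrow> y \<in> carr X \<Longrightarrow> x + y \<in> carr X"
    "x \<in> carr X \<Longrightarrow> scl X c x \<in> carr X" "x \<in> carr X \<Longrightarrow> y \<in> carr X \<Longrightarrow> x - y \<in> carr X"
proof -
  interpret vector_space "scl X" using assms by (simp add: vspace_def)
  have "subspace (carr X)" using assms by (simp add: vspace_def)
  then show "0 \<in> carr X" "x \<in> carr X \<Longrightarrow> y \<in> carr X \<Longrightarrow> x + y \<in> carr X"
    "x \<in> carr X \<Longrightarrow> scl X c x \<in> carr X" "x \<in> carr X \<Longrightarrow> y \<in> carr X \<Longrightarrow> x - y \<in> carr X"
    by (auto intro: subspace_0 subspace_add subspace_scale subspace_diff)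
qed

text \<open>
  A trilinear map induces a linear map on \<open>(X \<otimes> Y) \<otimes> Z\<close>. Through it, coassociativity, which is an
  equation in such a triple tensor product, becomes an equation between nested sums of an arbitrary
  trilinear map.
\<close>

lemma linext_tpure3:
  assumes s: "vector_space s" and T: "trilin X Y Z s T" and Y: "vspace X" "vspace Y"
    and "x \<in> carr X" "y \<in> carr Y"
  shows "linext s (\<lambda>p z. linext s (\<lambda>x y. T x y z) p) (tpure (tensor X Y) Z (tpure X Y x y) z)
    = linext s (\<lambda>x y. T x y z) (tpure X Y x y)"
proof (rule linext_tpure[OF s], rule bilinI)
  fix p z z' c assume p: "p \<in> carr (tensor X Y)" and z: "z \<in> carr Z" 
  have T1: "T x y (scl Z c z) = s c (T x y z)" if "(x, y) \<in> Poly_Mapping.keys p" for x y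
    using T tensor_keys[OF Y p that] z by (simp add: trilin_def klin_def)
  have "linext s (\<lambda>x y. T x y (scl Z c z)) p = linext s (\<lambda>x y. s c (T x y z)) p"
    by (rule linext_cong) (rule T1)
  then show "linext s (\<lambda>x y. T x y (scl Z c z)) p = s c (linext s (\<lambda>x y. T x y z) p)"
    by (simp add: linext_fun_scale[OF s])
  assume z': "z' \<in> carr Z"
  have T2: "T x y (z + z') = T x y z + T x y z'" if "(x, y) \<in> Poly_Mapping.keys p" for x y
    using T tensor_keys[OF Y p that] z z' by (simp add: trilin_def klin_def)
  have "linext s (\<lambda>x y. T x y (z + z')) p = linext s (\<lambda>x y. T x y z + T x y z') p"
    by (rule linext_cong) (rule T2)
  then show "linext s (\<lambda>x y. T x y (z + z')) p = linext s (\<lambda>x y. T x y z) p + linext s (\<lambda>x y. T x y z') p"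
    by (simp add: s)
qed (simp_all add: s)

lemma linext_tpure3':
  assumes s: "vector_space s" and T: "trilin X Y Z s T" and Y: "vspace X" "vspace Y"
    and xyz: "x \<in> carr X" "y \<in> carr Y" "z \<in> carr Z"
  shows "linext s (\<lambda>p z. linext s (\<lambda>x y. T x y z) p) (tpure (tensor X Y) Z (tpure X Y x y) z) = T x y z"
  using linext_tpure3[OF s T Y xyz(1,2), of z] linext_tpure[OF s, of X Y "\<lambda>x y. T x y z" x y] T xyz(3)
  by (simp add: trilin_def)

section \<open>Cocommutative Hopf algebras\<close>

locale hopf =
  fixes H :: "('k::field, 'h::ring_1) hopf"
  assumes hopf: "hopf_algebra H"
begin

abbreviation "\<Delta> \<equiv> comult H"
abbreviation "\<epsilon> \<equiv> counit H"
abbreviation "S \<equiv> antipode H"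

lemma alg_H: "k_algebra H" using hopf by (simp add: hopf_algebra_def)
lemma vspace_H [simp]: "vspace H" and carr_H [simp]: "carr H = UNIV"
  using alg_H by (simp_all add: k_algebra_def)
lemma vs_H [simp]: "vector_space (scl H)" using vspace_H by (rule vspaceD)
lemmas linext_fun_scale_H [simp] = linext_fun_scale[OF vs_H]

lemma mult_scale_H [simp]: "scl H c x * y = scl H c (x * y)" "x * scl H c y = scl H c (x * y)"
  using alg_H unfolding k_algebra_def by metis+

lemma comult_add [simp]: "\<Delta> (g + h) = \<Delta> g + \<Delta> h"
  and comult_scale [simp]: "\<Delta> (scl H c h) = pm_scale c (\<Delta> h)"
  and comult_in [simp]: "\<Delta> h \<in> carr (tensor H H)"
  using hopf by (simp_all add: hopf_algebra_def lin_def)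

lemma antipode_add [simp]: "S (g + h) = S g + S h"
  and antipode_scale [simp]: "S (scl H c h) = scl H c (S h)"
  using hopf by (simp_all add: hopf_algebra_def lin_def)

lemma counit_simps [simp]: "\<epsilon> (g + h) = \<epsilon> g + \<epsilon> h" "\<epsilon> (scl H c h) = c * \<epsilon> h" "\<epsilon> (g * h) = \<epsilon> g * \<epsilon> h" "\<epsilon> 1 = 1"
  using hopf by (simp_all add: hopf_algebra_def)

lemma linext_comult_one: "vector_space s \<Longrightarrow> bilin H H s T \<Longrightarrow> linext s T (\<Delta> 1) = T 1 1"
  using hopf by (simp add: hopf_algebra_def linext_tpure)

lemma linext_comult_mult:
  assumes s: "vector_space s" and T: "bilin H H s T"
  shows "linext s T (\<Delta> (g * h)) =
    linext s (\<lambda>g1 g2. linext s (\<lambda>h1 h2. T (g1 * h1) (g2 * h2)) (\<Delta> h)) (\<Delta> g)"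
proof -
  have "\<Delta> (g * h) = tlin (\<lambda>g1 g2. tlin (\<lambda>h1 h2. tpure H H (g1 * h1) (g2 * h2)) (\<Delta> h)) (\<Delta> g)"
    using hopf by (simp add: hopf_algebra_def)
  then show ?thesis by (simp add: linext_linext[OF s] linext_tpure[OF s T])
qed

lemma coassoc:
  assumes s: "vector_space s" and T: "trilin H H H s T"
  shows "linext s (\<lambda>x y. linext s (\<lambda>x1 x2. T x1 x2 y) (\<Delta> x)) (\<Delta> h) =
    linext s (\<lambda>x y. linext s (\<lambda>y1 y2. T x y1 y2) (\<Delta> y)) (\<Delta> h)"
proof -
  have "tlin (\<lambda>x y. tlin (\<lambda>x1 x2. tpure (tensor H H) H (tpure H H x1 x2) y) (\<Delta> x)) (\<Delta> h)
      = tlin (\<lambda>x y. tlin (\<lambda>y1 y2. tpure (tensor H H) H (tpure H H x y1) y2) (\<Delta> y)) (\<Delta> h)"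
    using hopf by (simp add: hopf_algebra_def)
  from arg_cong[OF this, of "linext s (\<lambda>p z. linext s (\<lambda>x y. T x y z) p)"]
  show ?thesis by (simp add: linext_linext[OF s] linext_tpure3'[OF s T])
qed

lemma counit_left:
  assumes s: "vector_space s" and T: "klin UNIV (scl H) s T"
  shows "linext s (\<lambda>x y. s (\<epsilon> x) (T y)) (\<Delta> h) = T h"
proof -
  have "linext (scl H) (\<lambda>x y. scl H (\<epsilon> x) y) (\<Delta> h) = h"
    using hopf by (simp add: hopf_algebra_def)
  from arg_cong[OF this, of T] show ?thesis
    using T by (simp add: klin_linext_UNIV[OF vs_H s T] klin_def)
qed

lemma counit_right:
  assumes s: "vector_space s" and T: "klin UNIV (scl H) s T"
  shows "linext s (\<lambda>x y. s (\<epsilon> y) (T x)) (\<Delta> h) = T h"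
proof -
  have "linext (scl H) (\<lambda>x y. scl H (\<epsilon> y) x) (\<Delta> h) = h"
    using hopf by (simp add: hopf_algebra_def)
  from arg_cong[OF this, of T] show ?thesis
    using T by (simp add: klin_linext_UNIV[OF vs_H s T] klin_def)
qed

lemma antipode_left:
  assumes s: "vector_space s" and T: "klin UNIV (scl H) s T"
  shows "linext s (\<lambda>x y. T (S x * y)) (\<Delta> h) = s (\<epsilon> h) (T 1)"
proof -
  have "linext (scl H) (\<lambda>x y. S x * y) (\<Delta> h) = scl H (\<epsilon> h) 1"
    using hopf by (simp add: hopf_algebra_def)
  from arg_cong[OF this, of T] show ?thesis
    using T by (simp add: klin_linext_UNIV[OF vs_H s T] klin_def)
qed

lemma antipode_right:
  assumes s: "vector_space s" and T: "klin UNIV (scl H) s T"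
  shows "linext s (\<lambda>x y. T (x * S y)) (\<Delta> h) = s (\<epsilon> h) (T 1)"
proof -
  have "linext (scl H) (\<lambda>x y. x * S y) (\<Delta> h) = scl H (\<epsilon> h) 1"
    using hopf by (simp add: hopf_algebra_def)
  from arg_cong[OF this, of T] show ?thesis
    using T by (simp add: klin_linext_UNIV[OF vs_H s T] klin_def)
qed

lemma antipode_one: "S 1 = 1"
proof -
  interpret V: vector_space "scl H" by simp
  have "linext (scl H) (\<lambda>x y. S x * y) (\<Delta> 1) = S 1 * 1"
    by (rule linext_comult_one) (auto intro!: bilinI simp: distrib_left distrib_right)
  moreover have "linext (scl H) (\<lambda>x y. S x * y) (\<Delta> 1) = scl H (\<epsilon> 1) 1"
    using hopf unfolding hopf_algebra_def by blast
  ultimately show ?thesis by simp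
qed

text \<open>
  Both \<open>S (g h)\<close> and \<open>S h S g\<close> are convolution inverses of the multiplication \<open>H \<otimes> H \<rightarrow> H\<close>.
  Concretely, the sum of \<open>S (g\<^sub>1 h\<^sub>1) g\<^sub>2 h\<^sub>2 S h\<^sub>3 S g\<^sub>3\<close> collapses to the one side if the last four
  factors are evaluated first, and to the other if the first three are.
\<close>

lemma antipode_mult: "S (g * h) = S h * S g"
proof -
  interpret V: vector_space "scl H" by simp
  let ?L = "linext (scl H)"
  note d = distrib_left distrib_right mult.assoc
  have K: "?L (\<lambda>x y. ?L (\<lambda>p q. x * p * S q * S y) (\<Delta> h)) (\<Delta> g) = scl H (\<epsilon> g * \<epsilon> h) 1" for g h
  proof -
    have "?L (\<lambda>p q. x * p * S q * S y) (\<Delta> h) = scl H (\<epsilon> h) (x * S y)" for x y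
      using antipode_right[of "scl H" "\<lambda>z. x * z * S y" h] by (simp add: klin_def d)
    then show ?thesis using antipode_right[of "scl H" "\<lambda>z. z" g] by (simp add: klin_def mult.commute)
  qed
  have "S (g * h) = ?L (\<lambda>g1 g2. scl H (\<epsilon> g2) (?L (\<lambda>h1 h2. scl H (\<epsilon> h2) (S (g1 * h1))) (\<Delta> h))) (\<Delta> g)"
    using counit_right[of "scl H" "\<lambda>z. S (z * h)" g] counit_right[of "scl H" "\<lambda>z. S (x * z)" h for x]
    by (simp add: klin_def d)
  also have "\<dots> = ?L (\<lambda>g1 g2. ?L (\<lambda>h1 h2. S (g1 * h1) *
      ?L (\<lambda>x y. ?L (\<lambda>p q. x * p * S q * S y) (\<Delta> h2)) (\<Delta> g2)) (\<Delta> h)) (\<Delta> g)"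
    unfolding K by (simp flip: V.scale_scale del: V.scale_scale)
  also have "\<dots> = ?L (\<lambda>g1 g2. ?L (\<lambda>h1 h2. 
      ?L (\<lambda>x y. ?L (\<lambda>p q. S (g1 * h1) * (x * p * S q * S y)) (\<Delta> h2)) (\<Delta> g2)) (\<Delta> h)) (\<Delta> g)"
    by (simp add: linext_mult_left[OF alg_H])
  also have "\<dots> = ?L (\<lambda>g1 g2. ?L (\<lambda>x y. ?L (\<lambda>h1 h2. 
      ?L (\<lambda>p q. S (g1 * h1) * (x * p * S q * S y)) (\<Delta> h2)) (\<Delta> h)) (\<Delta> g2)) (\<Delta> g)"
    by (subst (2) linext_swap) (rule vs_H, rule refl)
  also have "\<dots> = ?L (\<lambda>g1 g2. ?L (\<lambda>x y. ?L (\<lambda>h1 h2. 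
      ?L (\<lambda>p q. S (g1 * p) * (x * q * S h2 * S y)) (\<Delta> h1)) (\<Delta> h)) (\<Delta> g2)) (\<Delta> g)"
    by (subst coassoc) (auto intro!: bilinI klinI simp: trilin_def d)
  also have "\<dots> = ?L (\<lambda>g1 g2. ?L (\<lambda>x y. ?L (\<lambda>h1 h2. 
      ?L (\<lambda>p q. S (x * p) * (y * q * S h2 * S g2)) (\<Delta> h1)) (\<Delta> h)) (\<Delta> g1)) (\<Delta> g)"
    by (subst coassoc) (auto intro!: bilinI klinI simp: trilin_def d)
  also have "\<dots> = ?L (\<lambda>g1 g2. ?L (\<lambda>h1 h2. ?L (\<lambda>x y.  
      ?L (\<lambda>p q. S (x * p) * (y * q * S h2 * S g2)) (\<Delta> h1)) (\<Delta> g1)) (\<Delta> h)) (\<Delta> g)"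
    by (subst (2) linext_swap) (rule vs_H, rule refl)
  also have "\<dots> = ?L (\<lambda>g1 g2. ?L (\<lambda>h1 h2. scl H (\<epsilon> g1) (scl H (\<epsilon> h1) (S h2 * S g2))) (\<Delta> h)) (\<Delta> g)"
  proof -
    have "?L (\<lambda>x y. ?L (\<lambda>p q. S (x * p) * (y * q * S h2 * S g2)) (\<Delta> h1)) (\<Delta> g1)
       = scl H (\<epsilon> g1 * \<epsilon> h1) (S h2 * S g2)" for g1 g2 h1 h2
      using linext_comult_mult[of "scl H" "\<lambda>x y. S x * y * (S h2 * S g2)" g1 h1]
        antipode_left[of "scl H" "\<lambda>z. z * (S h2 * S g2)" "g1 * h1"]
      by (simp add: klin_def bilin_def d)
    then show ?thesis by simp
  qed
  also have "\<dots> = S h * S g"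
    using counit_left[of "scl H" "\<lambda>z. S h * S z" g] counit_left[of "scl H" "\<lambda>z. S z * S x" h for x]
    by (simp add: klin_def d flip: V.scale_scale del: V.scale_scale)
  finally show ?thesis .
qed

end

locale cocomm_hopf = hopf +
  assumes cocomm: "cocommutative H"
begin

lemma comult_swap:
  assumes s: "vector_space s" and T: "bilin H H s T"
  shows "linext s T (\<Delta> h) = linext s (\<lambda>x y. T y x) (\<Delta> h)"
proof -
  have "tlin (\<lambda>x y. tpure H H y x) (\<Delta> h) = \<Delta> h" using cocomm by (simp add: cocommutative_def)
  from arg_cong[OF this, of "linext s T"] show ?thesis
    by (simp add: linext_linext[OF s] linext_tpure[OF s T])
qed

lemma antipode_left_swap:
  assumes s: "vector_space s" and T: "klin UNIV (scl H) s T"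
  shows "linext s (\<lambda>x y. T (S y * x)) (\<Delta> h) = s (\<epsilon> h) (T 1)"
proof -
  have "linext s (\<lambda>x y. T (S y * x)) (\<Delta> h) = linext s (\<lambda>x y. T (S x * y)) (\<Delta> h)"
    by (rule comult_swap[OF s]) (use T in \<open>auto intro!: bilinI simp: klin_def distrib_left distrib_right\<close>)
  then show ?thesis by (simp add: antipode_left[OF s T])
qed

text \<open>
  Cocommutativity gives \<open>S h\<^sub>2 h\<^sub>1 = \<epsilon> h\<close>, and applying \<open>S\<close> yields \<open>S h\<^sub>1 S (S h\<^sub>2) = \<epsilon> h\<close>. So
  \<open>h = h\<^sub>1 S h\<^sub>2 S (S h\<^sub>3) = S (S h)\<close>.
\<close>

lemma antipode_antipode [simp]: "S (S h) = h"
proof -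
  interpret V: vector_space "scl H" by simp
  let ?L = "linext (scl H)"
  note d = distrib_left distrib_right mult.assoc
  have K: "?L (\<lambda>x y. S x * S (S y)) (\<Delta> h) = scl H (\<epsilon> h) 1" for h
    using antipode_left_swap[of "scl H" S h] by (simp add: klin_def antipode_mult antipode_one)
  have "h = ?L (\<lambda>x y. scl H (\<epsilon> y) x) (\<Delta> h)"
    using counit_right[of "scl H" "\<lambda>z. z" h] by (simp add: klin_def)
  also have "\<dots> = ?L (\<lambda>x y. x * ?L (\<lambda>x y. S x * S (S y)) (\<Delta> y)) (\<Delta> h)"
    unfolding K by simp
  also have "\<dots> = ?L (\<lambda>x y. ?L (\<lambda>y1 y2. x * (S y1 * S (S y2))) (\<Delta> y)) (\<Delta> h)"
    by (simp add: linext_mult_left[OF alg_H])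
  also have "\<dots> = ?L (\<lambda>x y. ?L (\<lambda>x1 x2. x1 * S x2 * S (S y)) (\<Delta> x)) (\<Delta> h)"
    by (subst coassoc[symmetric]) (auto intro!: bilinI klinI simp: trilin_def d)
  also have "\<dots> = ?L (\<lambda>x y. scl H (\<epsilon> x) (S (S y))) (\<Delta> h)"
  proof -
    have "?L (\<lambda>x1 x2. x1 * S x2 * S (S y)) (\<Delta> x) = scl H (\<epsilon> x) (S (S y))" for x y
      using antipode_right[of "scl H" "\<lambda>z. z * S (S y)" x] by (simp add: klin_def d)
    then show ?thesis by simp
  qed
  also have "\<dots> = S (S h)"
    using counit_left[of "scl H" "\<lambda>z. S (S z)" h] by (simp add: klin_def)
  finally show ?thesis by simp
qed

lemma inv_antipode [simp]: "inv S = S"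
  by (rule inv_equality) simp_all

end

lemma tlin_in_tensor' [simp]:
  "(\<And>x y. g x y \<in> carr (tensor X Y)) \<Longrightarrow> tlin g p \<in> carr (tensor X Y)"
  by (rule tlin_in_tensor)

section \<open>The canonical map\<close>

locale galois = cocomm_hopf H for H :: "('k::field, 'h::ring_1) hopf" +
  fixes A :: "('k, 'a::{ring,monoid_mult}, 'h) comod_alg"
  assumes comod_alg: "comodule_algebra H A"
    and can_bij: "bij_betw (can H A) (can_dom H A) (carr (tensor A H))"
begin

abbreviation "\<rho> \<equiv> rho A"
abbreviation "B \<equiv> coinv H A"
abbreviation "LA \<equiv> linext (scl A)"

lemma alg_A: "k_algebra A" using comod_alg by (simp add: comodule_algebra_def)
lemma vspace_A [simp]: "vspace A" and carr_A [simp]: "carr A = UNIV"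
  using alg_A by (simp_all add: k_algebra_def)
lemma vs_A [simp]: "vector_space (scl A)" using vspace_A by (rule vspaceD)
lemmas linext_fun_scale_A [simp] = linext_fun_scale[OF vs_A]

lemma mult_scale_A [simp]: "scl A c x * y = scl A c (x * y)" "x * scl A c y = scl A c (x * y)"
  using alg_A unfolding k_algebra_def by metis+

lemma comod_A: "comodule H A \<rho>" using comod_alg by (simp add: comodule_algebra_def)

lemma rho_add [simp]: "\<rho> (a + b) = \<rho> a + \<rho> b"
  and rho_scale [simp]: "\<rho> (scl A c a) = pm_scale c (\<rho> a)"
  and rho_in [simp]: "\<rho> a \<in> carr (tensor A H)"
  using comod_A by (simp_all add: comodule_def lin_def)

lemma rho_one: "\<rho> 1 = tpure A H 1 1"
  using comod_alg by (simp add: comodule_algebra_def)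

lemma rho_mult: "\<rho> (a * b) = tlin (\<lambda>a0 a1. tlin (\<lambda>b0 b1. tpure A H (a0 * b0) (a1 * b1)) (\<rho> b)) (\<rho> a)"
  using comod_alg by (simp add: comodule_algebra_def)

lemma linext_rho_mult:
  assumes s: "vector_space s" and T: "bilin A H s T"
  shows "linext s T (\<rho> (a * b)) =
    linext s (\<lambda>a0 a1. linext s (\<lambda>b0 b1. T (a0 * b0) (a1 * b1)) (\<rho> b)) (\<rho> a)"
  by (simp add: rho_mult linext_linext[OF s] linext_tpure[OF s T])

lemma rho_coassoc:
  assumes s: "vector_space s" and T: "trilin A H H s T"
  shows "linext s (\<lambda>x h. linext s (\<lambda>x0 x1. T x0 x1 h) (\<rho> x)) (\<rho> a) =
    linext s (\<lambda>x h. linext s (\<lambda>h1 h2. T x h1 h2) (\<Delta> h)) (\<rho> a)"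
proof -
  have "tlin (\<lambda>x h. tlin (\<lambda>x0 x1. tpure (tensor A H) H (tpure A H x0 x1) h) (\<rho> x)) (\<rho> a)
      = tlin (\<lambda>x h. tlin (\<lambda>h1 h2. tpure (tensor A H) H (tpure A H x h1) h2) (\<Delta> h)) (\<rho> a)"
    using comod_A by (simp add: comodule_def)
  from arg_cong[OF this, of "linext s (\<lambda>p z. linext s (\<lambda>x y. T x y z) p)"]
  show ?thesis by (simp add: linext_linext[OF s] linext_tpure3'[OF s T])
qed

lemma rho_counit:
  assumes s: "vector_space s" and T: "klin UNIV (scl A) s T"
  shows "linext s (\<lambda>x h. s (\<epsilon> h) (T x)) (\<rho> a) = T a"
proof -
  have "LA (\<lambda>x h. scl A (\<epsilon> h) x) (\<rho> a) = a"
    using comod_A by (simp add: comodule_def)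
  from arg_cong[OF this, of T] show ?thesis
    using T by (simp add: klin_linext_UNIV[OF vs_A s T] klin_def)
qed

lemma linext_rho_coinv:
  "b \<in> B \<Longrightarrow> vector_space s \<Longrightarrow> bilin A H s T \<Longrightarrow> linext s T (\<rho> b) = T b 1"
  by (simp add: coinv_def linext_tpure)

lemma coinv_one [simp]: "1 \<in> B"
  by (simp add: coinv_def rho_one)

lemma coinv_mult [simp]: "b \<in> B \<Longrightarrow> b' \<in> B \<Longrightarrow> b * b' \<in> B"
  unfolding coinv_def
  by (simp add: rho_mult linext_tpure bilin_def klin_def vector_space_pm_scale distrib_left distrib_right)

lemma coinv_add [simp]: "b \<in> B \<Longrightarrow> b' \<in> B \<Longrightarrow> b + b' \<in> B"
  and coinv_scale [simp]: "b \<in> B \<Longrightarrow> scl A c b \<in> B"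
  by (simp_all add: coinv_def)

abbreviation "pure_B \<equiv> bpure B (mult_bimod UNIV A) (mult_bimod UNIV A)"

lemma mult_bimod_simps [simp]: "carr (mult_bimod V A) = V" "scl (mult_bimod V A) = scl A"
  "ract (mult_bimod V A) = (*)" "lact (mult_bimod V A) = (*)"
  by (simp_all add: mult_bimod_def)

lemma can_pure_B: "can H A (pure_B a b) = tlin (\<lambda>b0 b1. tpure A H (a * b0) b1) (\<rho> b)"
  unfolding can_def bpure_def
proof (rule linext_bal_pure)
  fix r x y assume r: "r \<in> B"
  have "tlin (\<lambda>b0 b1. tpure A H (x * b0) b1) (\<rho> (r * y)) = tlin (\<lambda>b0 b1. tpure A H (x * r * b0) b1) (\<rho> y)"
    using r by (simp add: linext_rho_mult linext_rho_coinv bilin_def klin_def vector_space_pm_scale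
        distrib_left distrib_right mult.assoc)
  then show "tlin (\<lambda>b0 b1. tpure A H (ract (mult_bimod UNIV A) x r * b0) b1) (\<rho> y) =
     tlin (\<lambda>b0 b1. tpure A H (x * b0) b1) (\<rho> (lact (mult_bimod UNIV A) r y))"
    by simp
qed (simp_all add: vector_space_pm_scale bilin_def klin_def distrib_right cong: linext_simp_cong)

lemma pure_B_in [simp]: "pure_B a b \<in> can_dom H A"
  by (simp add: can_dom_def bpure_def btensor_carr_def bal_pure_in_carr)

lemma can_dom_eqI:
  assumes "w \<in> can_dom H A" "klin UNIV pm_scale s f" "klin UNIV pm_scale s g" "vector_space s"
    "\<And>a b. f (pure_B a b) = g (pure_B a b)"
  shows "f w = g w"
  using bal_carr_eqI[OF assms(1)[unfolded can_dom_def btensor_carr_def] assms(2-4)] assms(5)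
  unfolding bpure_def by blast

lemma can_in [simp]: "can H A w \<in> carr (tensor A H)"
  by (simp add: can_def)

lemma can_linear: "can H A (p + q) = can H A p + can H A q" "can H A (pm_scale c p) = pm_scale c (can H A p)"
  by (simp_all add: can_def vector_space_pm_scale)

end

section \<open>The Miyashita-Ulbrich action on the center\<close>

text \<open>
  For central \<open>x\<close> the map \<open>a \<otimes> b \<mapsto> a x b\<close> is well defined on \<open>A \<otimes>\<^sub>B A\<close>. Transporting it
  along the canonical map gives a linear map \<open>A \<otimes> H \<rightarrow> A\<close>, and \<open>\<chi> h\<close>, its value at \<open>1 \<otimes> h\<close>, is
  the element \<open>\<Sum> l\<^sub>i(h) x r\<^sub>i(h)\<close>. In this way all identities for the elements \<open>l\<^sub>i(h)\<close> and \<open>r\<^sub>i(h)\<close> are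
  replaced by computations on the images \<open>a b\<^sub>0 \<otimes> b\<^sub>1\<close> of \<open>a \<otimes> b\<close>, which exhaust \<open>A \<otimes> H\<close>.
\<close>

locale galois_central = galois H A
  for H :: "('k::field, 'h::ring_1) hopf" and A :: "('k, 'a::{ring,monoid_mult}, 'h) comod_alg" +
  fixes x :: 'a
  assumes central: "x \<in> center B"
begin

lemma x_in [simp]: "x \<in> B" and x_comm: "b \<in> B \<Longrightarrow> b * x = x * b"
  using central by (auto simp: center_def)

definition "sandwich = LA (\<lambda>l r. l * x * r)"
definition "sandwich_can v = sandwich (inv_into (can_dom H A) (can H A) v)"
definition "\<chi> h = sandwich_can (tpure A H 1 h)"

lemma sandwich_linear [simp]: "sandwich (p + q) = sandwich p + sandwich q" "sandwich (pm_scale c p) = scl A c (sandwich p)"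
  by (simp_all add: sandwich_def)

lemma sandwich_pure: "sandwich (pure_B a b) = a * x * b"
  unfolding sandwich_def bpure_def
proof (rule linext_bal_pure)
  fix r a b assume r: "r \<in> B"
  have "a * r * x * b = a * x * (r * b)" using x_comm[OF r] by (metis mult.assoc)
  then show "ract (mult_bimod UNIV A) a r * x * b = a * x * lact (mult_bimod UNIV A) r b" by simp
qed (simp_all add: bilin_def klin_def distrib_left distrib_right)

lemma sandwich_can_can: "w \<in> can_dom H A \<Longrightarrow> sandwich_can (can H A w) = sandwich w"
  using can_bij by (simp add: sandwich_can_def bij_betw_def)

lemma in_can: assumes "v \<in> carr (tensor A H)" obtains w where "w \<in> can_dom H A" "v = can H A w"
  using can_bij assms unfolding bij_betw_def by blast

lemma can_dom_closed: "w \<in> can_dom H A \<Longrightarrow> w' \<in> can_dom H A \<Longrightarrow> w + w' \<in> can_dom H A"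
  "w \<in> can_dom H A \<Longrightarrow> pm_scale c w \<in> can_dom H A"
  unfolding can_dom_def btensor_carr_def
  by (simp_all add: PM.subspace_add PM.subspace_scale subspace_bal_carr)

lemma klin_sandwich_can: "klin (carr (tensor A H)) pm_scale (scl A) sandwich_can"
proof (rule klinI)
  fix v v' assume "v \<in> carr (tensor A H)" "v' \<in> carr (tensor A H)"
  then obtain w w' where "w \<in> can_dom H A" "v = can H A w" "w' \<in> can_dom H A" "v' = can H A w'"
    by (metis in_can)
  then show "sandwich_can (v + v') = sandwich_can v + sandwich_can v'" by (simp flip: can_linear add: sandwich_can_can can_dom_closed)
next
  fix c v assume "v \<in> carr (tensor A H)"
  then obtain w where "w \<in> can_dom H A" "v = can H A w" by (metis in_can)
  then show "sandwich_can (pm_scale c v) = scl A c (sandwich_can v)" by (simp flip: can_linear add: sandwich_can_can can_dom_closed)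
qed

lemma sandwich_can_tlin: "(\<And>y z. f y z \<in> carr (tensor A H)) \<Longrightarrow> sandwich_can (tlin f p) = LA (\<lambda>y z. sandwich_can (f y z)) p"
  by (rule klin_linext[OF _ _ _ klin_sandwich_can]) (simp_all add: vector_space_pm_scale vspaceD(2)[OF vspace_tensor, simplified])

lemma sandwich_can_simps: "v \<in> carr (tensor A H) \<Longrightarrow> v' \<in> carr (tensor A H) \<Longrightarrow> sandwich_can (v + v') = sandwich_can v + sandwich_can v'"
  "v \<in> carr (tensor A H) \<Longrightarrow> sandwich_can (pm_scale c v) = scl A c (sandwich_can v)"
  using klin_sandwich_can by (auto simp: klin_def)

text \<open>
  The canonical map is left \<open>A\<close>-linear and turns right multiplication by \<open>a\<close> into multiplication by
  \<open>\<rho> a\<close>, and \<open>a \<otimes> b \<mapsto> a x b\<close> is linear on both sides.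
\<close>

lemma sandwich_can_mult:
  assumes "v \<in> carr (tensor A H)"
  shows "sandwich_can (tlin (\<lambda>b g. tlin (\<lambda>a0 a1. tpure A H (c * b * a0) (g * a1)) (\<rho> a)) v) = c * sandwich_can v * a"
proof -
  obtain w where w: "w \<in> can_dom H A" "v = can H A w" using assms by (rule in_can)
  have "sandwich_can (tlin (\<lambda>b g. tlin (\<lambda>a0 a1. tpure A H (c * b * a0) (g * a1)) (\<rho> a)) (can H A w)) = c * sandwich w * a"
  proof (rule can_dom_eqI[where f="\<lambda>w. sandwich_can (tlin (\<lambda>b g. tlin (\<lambda>a0 a1. tpure A H (c * b * a0) (g * a1)) (\<rho> a)) (can H A w))"
      and s="scl A", OF w(1)])
    fix p q
    have "tlin (\<lambda>b g. tlin (\<lambda>a0 a1. tpure A H (c * b * a0) (g * a1)) (\<rho> a)) (can H A (pure_B p q))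
        = tlin (\<lambda>q0 q1. tlin (\<lambda>a0 a1. tpure A H (c * p * q0 * a0) (q1 * a1)) (\<rho> a)) (\<rho> q)"
      by (simp add: can_pure_B linext_linext linext_tpure vector_space_pm_scale bilin_def klin_def
          distrib_left distrib_right mult.assoc)
    also have "\<dots> = can H A (pure_B (c * p) (q * a))"
      by (simp add: can_pure_B linext_rho_mult vector_space_pm_scale bilin_def klin_def
          distrib_left distrib_right mult.assoc)
    finally show "sandwich_can (tlin (\<lambda>b g. tlin (\<lambda>a0 a1. tpure A H (c * b * a0) (g * a1)) (\<rho> a)) (can H A (pure_B p q)))
        = c * sandwich (pure_B p q) * a"
      by (simp add: sandwich_can_can sandwich_pure mult.assoc)
  qed (simp_all add: klin_def can_linear vector_space_pm_scale sandwich_can_simps distrib_left distrib_right)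
  then show ?thesis using w by (simp add: sandwich_can_can)
qed

lemma \<chi>_linear [simp]: "\<chi> (g + h) = \<chi> g + \<chi> h" "\<chi> (scl H c h) = scl A c (\<chi> h)"
  by (simp_all add: \<chi>_def sandwich_can_simps)

lemma sandwich_can_tpure: "sandwich_can (tpure A H a h) = a * \<chi> h"
  using sandwich_can_mult[of "tpure A H 1 h" a 1]
  by (simp add: \<chi>_def rho_one linext_tpure vector_space_pm_scale bilin_def klin_def
          distrib_left distrib_right)

lemma \<chi>_mult: "LA (\<lambda>a0 a1. a0 * \<chi> (h * a1)) (\<rho> a) = \<chi> h * a"
  using sandwich_can_mult[of "tpure A H 1 h" 1 a]
  by (simp add: linext_tpure vector_space_pm_scale bilin_def klin_def sandwich_can_tlin sandwich_can_tpure
          distrib_left distrib_right flip: \<chi>_def)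

lemma \<chi>_one: "\<chi> 1 = x"
proof -
  have "can H A (pure_B 1 1) = tpure A H 1 1"
    by (simp add: can_pure_B rho_one linext_tpure vector_space_pm_scale bilin_def klin_def)
  then show ?thesis using sandwich_can_can[of "pure_B 1 1"] by (simp add: \<chi>_def sandwich_pure)
qed

lemma \<chi>_comm: "b \<in> B \<Longrightarrow> b * \<chi> h = \<chi> h * b"
  using \<chi>_mult[of h b] by (simp add: linext_rho_coinv bilin_def klin_def distrib_left distrib_right)

lemma x_mult: "LA (\<lambda>a0 a1. a0 * \<chi> a1) (\<rho> a) = x * a"
  using \<chi>_mult[of 1 a] by (simp add: \<chi>_one)

text \<open>
  The commutation rule \<open>a x = (a\<^sub>1 \<sqdot> x) a\<^sub>0\<close> on which everything rests. By \<open>\<chi>_mult\<close> the left-hand side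
  is the sum of \<open>a\<^sub>0 \<chi> (S a\<^sub>2 a\<^sub>1)\<close>, and \<open>S a\<^sub>2 a\<^sub>1\<close> cancels by cocommutativity.
\<close>

lemma mult_x: "LA (\<lambda>a0 a1. \<chi> (S a1) * a0) (\<rho> a) = a * x"
proof -
  have "LA (\<lambda>a0 a1. \<chi> (S a1) * a0) (\<rho> a) = LA (\<lambda>a0 a1. LA (\<lambda>p q. p * \<chi> (S a1 * q)) (\<rho> a0)) (\<rho> a)"
    by (simp add: \<chi>_mult)
  also have "\<dots> = LA (\<lambda>a0 a1. LA (\<lambda>u v. a0 * \<chi> (S v * u)) (\<Delta> a1)) (\<rho> a)"
    by (subst rho_coassoc) (auto intro!: bilinI klinI simp: trilin_def distrib_left distrib_right)
  also have "\<dots> = LA (\<lambda>a0 a1. scl A (\<epsilon> a1) (a0 * x)) (\<rho> a)"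
    using antipode_left_swap[of "scl A" "\<lambda>z. a0 * \<chi> z" for a0]
    by (simp add: klin_def distrib_left \<chi>_one)
  also have "\<dots> = a * x"
    using rho_counit[of "scl A" "\<lambda>z. z * x" a] by (simp add: klin_def distrib_right)
  finally show ?thesis .
qed

text \<open>
  At \<open>v = 1 \<otimes> h\<close> this says that \<open>\<chi> h\<close> is coinvariant. Both sides are linear in \<open>v\<close>, and at
  \<open>v = a b\<^sub>0 \<otimes> b\<^sub>1\<close> they agree because \<open>b\<^sub>0 \<chi> b\<^sub>1 = x b\<close>, where cocommutativity allows to apply this
  rule to the first of the two coproduct factors of \<open>b\<close> instead of the second.
\<close>

lemma rho_sandwich_can:
  assumes "v \<in> carr (tensor A H)"
  shows "\<rho> (sandwich_can v) = tlin (\<lambda>a h. tlin (\<lambda>a0 a1. tpure A H (a0 * \<chi> h) a1) (\<rho> a)) v"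
proof -
  note d = distrib_left distrib_right mult.assoc vector_space_pm_scale
  note [cong] = linext_simp_cong
  obtain w where w: "w \<in> can_dom H A" "v = can H A w" using assms by (rule in_can)
  have "\<rho> (sandwich w) = tlin (\<lambda>a h. tlin (\<lambda>a0 a1. tpure A H (a0 * \<chi> h) a1) (\<rho> a)) (can H A w)"
  proof (rule can_dom_eqI[where f="\<lambda>w. \<rho> (sandwich w)" and s=pm_scale, OF w(1)])
    fix a b
    have "tlin (\<lambda>a h. tlin (\<lambda>a0 a1. tpure A H (a0 * \<chi> h) a1) (\<rho> a)) (can H A (pure_B a b))
       = tlin (\<lambda>b0 b1. tlin (\<lambda>u v. tpure A H (u * \<chi> b1) v) (\<rho> (a * b0))) (\<rho> b)"
      by (simp add: can_pure_B linext_linext linext_tpure bilin_def klin_def d cong: linext_simp_cong)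
    also have "\<dots> = tlin (\<lambda>b0 b1. tlin (\<lambda>a0 a1. tlin (\<lambda>p q. tpure A H (a0 * p * \<chi> b1) (a1 * q)) (\<rho> b0)) (\<rho> a)) (\<rho> b)"
      by (simp add: linext_rho_mult bilin_def klin_def d)
    also have "\<dots> = tlin (\<lambda>a0 a1. tlin (\<lambda>b0 b1. tlin (\<lambda>p q. tpure A H (a0 * p * \<chi> b1) (a1 * q)) (\<rho> b0)) (\<rho> b)) (\<rho> a)"
      by (rule linext_swap) (rule vector_space_pm_scale)
    also have "\<dots> = tlin (\<lambda>a0 a1. tlin (\<lambda>b0 b1. tlin (\<lambda>u v. tpure A H (a0 * b0 * \<chi> v) (a1 * u)) (\<Delta> b1)) (\<rho> b)) (\<rho> a)"
      by (subst rho_coassoc) (auto intro!: bilinI klinI simp: trilin_def d)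
    also have "\<dots> = tlin (\<lambda>a0 a1. tlin (\<lambda>b0 b1. tlin (\<lambda>u v. tpure A H (a0 * b0 * \<chi> u) (a1 * v)) (\<Delta> b1)) (\<rho> b)) (\<rho> a)"
      by (subst comult_swap) (auto intro!: bilinI klinI simp: trilin_def d)
    also have "\<dots> = tlin (\<lambda>a0 a1. tlin (\<lambda>b0 b1. tlin (\<lambda>p q. tpure A H (a0 * p * \<chi> q) (a1 * b1)) (\<rho> b0)) (\<rho> b)) (\<rho> a)"
      by (subst rho_coassoc) (auto intro!: bilinI klinI simp: trilin_def d)
    also have "\<dots> = tlin (\<lambda>a0 a1. tlin (\<lambda>b0 b1. tpure A H (a0 * (x * b0)) (a1 * b1)) (\<rho> b)) (\<rho> a)"
    proof -
      have "tlin (\<lambda>p q. tpure A H (a0 * p * \<chi> q) h) (\<rho> b0) = tpure A H (a0 * (x * b0)) h" for a0 b0 h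
        using klin_linext_UNIV[of "scl A" pm_scale "\<lambda>z. tpure A H (a0 * z) h" "\<lambda>p q. p * \<chi> q" "\<rho> b0"]
        by (simp add: x_mult klin_def d)
      then show ?thesis by simp
    qed
    also have "\<dots> = \<rho> (a * (x * b))"
      by (simp add: rho_mult linext_rho_mult linext_linext linext_rho_coinv linext_tpure bilin_def klin_def d)
    finally show "\<rho> (sandwich (pure_B a b)) = tlin (\<lambda>a h. tlin (\<lambda>a0 a1. tpure A H (a0 * \<chi> h) a1) (\<rho> a)) (can H A (pure_B a b))"
      by (simp add: sandwich_pure mult.assoc)
  qed (simp_all add: klin_def can_linear vector_space_pm_scale)
  then show ?thesis using w by (simp add: sandwich_can_can)
qed

lemma \<chi>_center: "\<chi> h \<in> center B"
proof -
  have "\<rho> (\<chi> h) = tlin (\<lambda>a h. tlin (\<lambda>a0 a1. tpure A H (a0 * \<chi> h) a1) (\<rho> a)) (tpure A H 1 h)"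
    using rho_sandwich_can[of "tpure A H 1 h"] by (simp add: \<chi>_def)
  also have "\<dots> = tpure A H (\<chi> h) 1"
    by (simp add: rho_one linext_tpure bilin_def klin_def vector_space_pm_scale
        distrib_left distrib_right cong: linext_simp_cong)
  finally have "\<rho> (\<chi> h) = tpure A H (\<chi> h) 1" .
  then show ?thesis by (simp add: center_def \<chi>_comm) (simp add: coinv_def)
qed

lemma mu_eq: "miyashita_ulbrich H A h x = \<chi> (S h)"
  by (simp add: miyashita_ulbrich_def lr_def \<chi>_def sandwich_can_def sandwich_def)

end

section \<open>Components of elements of \<open>X \<otimes> H\<close>\<close>

lemma linext_tensor_cong:
  assumes "vspace X" "vspace Y" "q \<in> carr (tensor X Y)"
    and "\<And>x y. x \<in> carr X \<Longrightarrow> y \<in> carr Y \<Longrightarrow> g x y = g' x y"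
  shows "linext s g q = linext s g' q"
  using assms by (intro linext_cong) (blast dest: tensor_keys)

lemma tensor_sum_in:
  "(\<And>i. i \<in> I \<Longrightarrow> f i \<in> carr (tensor X Y)) \<Longrightarrow> (\<Sum>i\<in>I. f i) \<in> carr (tensor X Y)"
  by (rule PM.subspace_sum[OF vspaceD(2)[OF vspace_tensor, simplified]])

lemmas tpure_tensor_scale [simp] = tpure_simps(3)[of _ "tensor X Y" for X Y, unfolded scl_tensor]

context hopf
begin

text \<open>
  The coordinates with respect to a basis of \<open>H\<close> cut an element of \<open>X \<otimes> H\<close> into its components
  in \<open>X\<close>. The element is determined by them, and it lies in \<open>X' \<otimes> H\<close> for a subspace \<open>X'\<close> once
  they all lie in \<open>X'\<close>.
\<close>

definition coord :: "'h \<Rightarrow> 'h \<Rightarrow> 'k"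
  where "coord b h = module.representation (scl H) (vector_space.extend_basis (scl H) {}) h b"

lemma coord_add [simp]: "coord b (g + h) = coord b g + coord b h"
  and coord_scale [simp]: "coord b (scl H c h) = c * coord b h"
  and coord_sum: "\<exists>F. finite F \<and> (\<forall>F'. finite F' \<and> F \<subseteq> F' \<longrightarrow> (\<Sum>b\<in>F'. scl H (coord b h) b) = h)"
proof -
  interpret V: vector_space "scl H" by simp
  define E where "E = V.extend_basis {}"
  have E: "V.independent E" "V.span E = UNIV"
    using V.independent_extend_basis[OF V.independent_empty] V.span_extend_basis[OF V.independent_empty]
    by (simp_all add: E_def)
  have coord: "coord b h = V.representation E h b" for b h by (simp add: coord_def E_def)
  show "coord b (g + h) = coord b g + coord b h" "coord b (scl H c h) = c * coord b h"
    using E by (simp_all add: coord V.representation_add V.representation_scale)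
  show "\<exists>F. finite F \<and> (\<forall>F'. finite F' \<and> F \<subseteq> F' \<longrightarrow> (\<Sum>b\<in>F'. scl H (coord b h) b) = h)"
  proof (intro exI conjI allI impI)
    show "finite {b. V.representation E h b \<noteq> 0}" by (rule V.finite_representation)
    fix F' assume F': "finite F' \<and> {b. V.representation E h b \<noteq> 0} \<subseteq> F'"
    have "(\<Sum>b | V.representation E h b \<noteq> 0. scl H (V.representation E h b) b) = h"
      using E by (intro V.sum_nonzero_representation_eq) auto
    moreover have "(\<Sum>b | V.representation E h b \<noteq> 0. scl H (V.representation E h b) b)
        = (\<Sum>b\<in>F'. scl H (V.representation E h b) b)"
      using F' by (intro sum.mono_neutral_left) auto
    ultimately show "(\<Sum>b\<in>F'. scl H (coord b h) b) = h" by (simp add: coord)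
  qed
qed

definition slice :: "('k, 'x::ab_group_add, 'e) vsp_scheme \<Rightarrow> 'h \<Rightarrow> ('x \<times> 'h \<Rightarrow>\<^sub>0 'k) \<Rightarrow> 'x"
  where "slice X b w = linext (scl X) (\<lambda>x h. scl X (coord b h) x) w"

lemma slice_tpure:
  assumes X: "vspace X"
  shows "slice X b (tpure X H x h) = scl X (coord b h) x"
proof -
  interpret V: vector_space "scl X" using X by (rule vspaceD)
  show ?thesis unfolding slice_def
    by (rule linext_tpure) (auto simp: vspaceD[OF X] bilin_def klin_def V.scale_left_distrib V.scale_right_distrib mult.commute)
qed

lemma slice_linear:
  assumes "vspace X"
  shows "slice X b (p + q) = slice X b p + slice X b q" "slice X b (pm_scale c p) = scl X c (slice X b p)"
    "slice X b 0 = 0"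
  using vspaceD(1)[OF assms] by (simp_all add: slice_def)

lemma slice_in:
  assumes "vspace X" "w \<in> carr (tensor X H)"
  shows "slice X b w \<in> carr X"
  unfolding slice_def
  by (rule linext_in[OF vspaceD[OF assms(1)]], rule vspace_closed(3)[OF assms(1)],
      rule tensor_keys(1)[OF assms(1) vspace_H assms(2)])

lemma tensor_slices:
  assumes X: "vspace X" and w: "w \<in> carr (tensor X H)"
  shows "\<exists>F. finite F \<and> (\<forall>F'. finite F' \<and> F \<subseteq> F' \<longrightarrow> (\<Sum>b\<in>F'. tpure X H (slice X b w) b) = w)"
proof -
  interpret V: vector_space "scl X" using X by (rule vspaceD)
  \<comment> \<open>the sum must be stable under enlarging \<open>F\<close>, as the supports of two summands differ\<close>
  define R where "R w F \<longleftrightarrow> finite F \<and> (\<forall>F'. finite F' \<and> F \<subseteq> F' \<longrightarrow> (\<Sum>b\<in>F'. tpure X H (slice X b w) b) = w)"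
    for w F
  have "w \<in> carr (tensor X H) \<and> (\<exists>F. R w F)"
    using w[unfolded carr_tensor bal_carr_def]
  proof (induction rule: PM.span_induct_alt)
    case base
    have z: "tpure X H 0 b = 0" for b
      using tpure_simps(3)[of 0 X b H 0] vspace_closed(1)[OF X] by simp
    have "R 0 {}" by (simp add: R_def z slice_linear[OF X])
    moreover have "0 \<in> carr (tensor X H)" by (rule vspace_closed(1)[OF vspace_tensor])
    ultimately show ?case by (intro conjI exI)
  next
    case (step c p q)
    obtain x h where "p = bal_pure ({} :: unit set) (\<lambda>x _. x) (\<lambda>_ y. y) X H x h" "x \<in> carr X"
      using step(1) by blast
    then have p: "p = tpure X H x h" "x \<in> carr X" by (simp_all add: tpure_def)
    obtain F1 where F1: "finite F1" "\<And>F'. finite F' \<Longrightarrow> F1 \<subseteq> F' \<Longrightarrow> (\<Sum>b\<in>F'. scl H (coord b h) b) = h"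
      using coord_sum by meson
    obtain F2 where F2: "R q F2" using step(2) by (elim conjE exE)
    have q: "q \<in> carr (tensor X H)" using step(2) by (elim conjE)
    have pc: "p \<in> carr (tensor X H)" using p by simp
    have "(\<Sum>b\<in>F'. tpure X H (slice X b (pm_scale c p + q)) b) = pm_scale c p + q"
      if F': "finite F'" "F1 \<union> F2 \<subseteq> F'" for F'
    proof -
      have "tpure X H (slice X b (pm_scale c p + q)) b = pm_scale c (tpure X H x (scl H (coord b h) b)) + tpure X H (slice X b q) b" for b
      proof -
        have "slice X b (pm_scale c p + q) = scl X c (scl X (coord b h) x) + slice X b q"
          unfolding slice_linear[OF X] p(1) slice_tpure[OF X] ..
        moreover have "scl X (coord b h) x \<in> carr X" "scl X c (scl X (coord b h) x) \<in> carr X"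
          using p(2) by (simp_all only: vspace_closed(3)[OF X])
        ultimately show ?thesis using p(2) slice_in[OF X q, of b] by (simp del: V.scale_scale)
      qed
      then have "(\<Sum>b\<in>F'. tpure X H (slice X b (pm_scale c p + q)) b)
        = pm_scale c (\<Sum>b\<in>F'. tpure X H x (scl H (coord b h) b)) + (\<Sum>b\<in>F'. tpure X H (slice X b q) b)"
        by (simp only: sum.distrib PM.scale_sum_right)
      moreover have "(\<Sum>b\<in>F'. tpure X H (slice X b q) b) = q"
        using F2 F' by (simp add: R_def)
      moreover have "(\<Sum>b\<in>F'. tpure X H x (scl H (coord b h) b)) = tpure X H x (\<Sum>b\<in>F'. scl H (coord b h) b)"
        using F'(1)
      proof (induction F')
        case empty
        then show ?case using p(2) tpure_simps(2)[of x X 0 H 0] by simp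
      next
        case (insert b F')
        then show ?case using p(2) by (simp del: tpure_simps(4))
      qed
      ultimately show ?thesis using F1(2)[of F'] F' p(1) by simp
    qed
    then have "R (pm_scale c p + q) (F1 \<union> F2)" using F1(1) F2 by (simp add: R_def)
    moreover have "pm_scale c p + q \<in> carr (tensor X H)"
      using vspace_closed(2)[OF vspace_tensor vspace_closed(3)[OF vspace_tensor pc, of c] q] by simp
    ultimately show ?case by (intro conjI exI)
  qed
  then show ?thesis unfolding R_def by (elim conjE)
qed

lemma tensor_slice_eqI:
  assumes X: "vspace X" and w: "w \<in> carr (tensor X H)" "w' \<in> carr (tensor X H)"
    and eq: "\<And>b. slice X b w = slice X b w'"
  shows "w = w'"
proof -
  define T where "T F w = (\<Sum>b\<in>F. tpure X H (slice X b w) b)" for F w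
  have *: "\<exists>F. finite F \<and> (\<forall>F'. finite F' \<and> F \<subseteq> F' \<longrightarrow> T F' w = w)" if "w \<in> carr (tensor X H)" for w
    unfolding T_def by (rule tensor_slices[OF X that])
  obtain F1 where F1: "finite F1" "\<forall>F'. finite F' \<and> F1 \<subseteq> F' \<longrightarrow> T F' w = w" using *[OF w(1)] by (elim exE conjE)
  obtain F2 where F2: "finite F2" "\<forall>F'. finite F' \<and> F2 \<subseteq> F' \<longrightarrow> T F' w' = w'" using *[OF w(2)] by (elim exE conjE)
  have "finite (F1 \<union> F2)" using F1(1) F2(1) by simp
  then have "T (F1 \<union> F2) w = w" "T (F1 \<union> F2) w' = w'" using F1(2) F2(2) by simp_all
  moreover have "T (F1 \<union> F2) w = T (F1 \<union> F2) w'" unfolding T_def eq ..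
  ultimately show ?thesis by argo
qed

end

section \<open>The algebra \<open>A\<^sup>\<box>\<^sup>e\<close> and its coaction\<close>

context galois
begin

abbreviation "Ae \<equiv> tensor A A"
abbreviation "amul \<equiv> ae_mult A"
abbreviation "apure \<equiv> tpure A A"

lemmas amul_distrib = distrib_left distrib_right mult.assoc vector_space_pm_scale

lemma amul_linear [simp]: "amul (z + z') w = amul z w + amul z' w" "amul z (w + w') = amul z w + amul z w'"
  "amul (pm_scale c z) w = pm_scale c (amul z w)" "amul z (pm_scale c w) = pm_scale c (amul z w)"
  by (simp_all add: ae_mult_def vector_space_pm_scale)

lemma amul_in [simp]: "amul z w \<in> carr Ae"
  by (simp add: ae_mult_def)

lemma amul_tpure_left: "amul (apure a a') w = tlin (\<lambda>c c'. apure (a * c) (c' * a')) w"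
  unfolding ae_mult_def
  by (rule linext_tpure) (auto intro!: bilinI simp: amul_distrib cong: linext_simp_cong)

lemma amul_tpure: "amul (apure a a') (apure c c') = apure (a * c) (c' * a')"
  by (simp add: amul_tpure_left linext_tpure bilin_def klin_def amul_distrib)

lemma amul_tlin_left: "amul (tlin f p) z = tlin (\<lambda>c c'. amul (f c c') z) p"
  by (rule klin_linext_UNIV[where f="\<lambda>y. amul y z"]) (auto simp: klin_def vector_space_pm_scale)

lemma amul_assoc: "amul (amul z w) v = amul z (amul w v)"
proof -
  have "amul (amul z w) v = tlin (\<lambda>a a'. tlin (\<lambda>c c'. tlin (\<lambda>e e'. apure (a * (c * e)) (e' * (c' * a'))) v) w) z"
    unfolding ae_mult_def[of A z w] by (simp add: amul_tlin_left amul_tpure_left mult.assoc)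
  also have "\<dots> = amul z (amul w v)"
    unfolding ae_mult_def
    by (simp add: linext_linext linext_tpure bilin_def klin_def amul_distrib cong: linext_simp_cong)
  finally show ?thesis .
qed

lemma amul_one: "z \<in> carr Ae \<Longrightarrow> amul z (apure 1 1) = z"
  by (subst ae_mult_def) (simp add: linext_tpure bilin_def klin_def amul_distrib tlin_tpure)

lemma ae_coact_tpure: "ae_coact H A (apure a a') = tlin (\<lambda>a0 a1. tpure Ae H (apure a0 a') a1) (\<rho> a)"
  unfolding ae_coact_def by (rule linext_tpure) (auto intro!: bilinI simp: amul_distrib cong: linext_simp_cong)

text \<open>
  The other side of the equation that defines \<open>A\<^sup>\<box>\<^sup>e\<close>.
\<close>

definition "ae_coact' z = tlin (\<lambda>a a'. tlin (\<lambda>a0' a1'. tpure Ae H (apure a a0') (S a1')) (\<rho> a')) z"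

lemma ae_coact'_tpure: "ae_coact' (apure a a') = tlin (\<lambda>a0' a1'. tpure Ae H (apure a a0') (S a1')) (\<rho> a')"
  unfolding ae_coact'_def by (rule linext_tpure) (auto intro!: bilinI simp: amul_distrib cong: linext_simp_cong)

lemma ae_coact_linear [simp]: "ae_coact H A (z + z') = ae_coact H A z + ae_coact H A z'"
  "ae_coact H A (pm_scale c z) = pm_scale c (ae_coact H A z)"
  "ae_coact' (z + z') = ae_coact' z + ae_coact' z'"
  "ae_coact' (pm_scale c z) = pm_scale c (ae_coact' z)"
  "ae_coact H A 0 = 0" "ae_coact' 0 = 0"
  by (simp_all add: ae_coact_def ae_coact'_def vector_space_pm_scale)

lemma ae_coact_tlin: "ae_coact H A (tlin f p) = tlin (\<lambda>c c'. ae_coact H A (f c c')) p"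
  "ae_coact' (tlin f p) = tlin (\<lambda>c c'. ae_coact' (f c c')) p"
  by (rule klin_linext_UNIV; auto simp: klin_def vector_space_pm_scale)+

lemma ae_coact_in [simp]: "ae_coact H A z \<in> carr (tensor Ae H)"
  by (simp add: ae_coact_def)

lemma carr_sq: "carr (sq H A) = {z \<in> carr Ae. ae_coact H A z = ae_coact' z}"
  by (simp add: sq_def ae_coact'_def)

lemma scl_sq [simp]: "scl (sq H A) = pm_scale" by (simp add: sq_def)

lemmas tpure_sq_scale [simp] = tpure_simps(3)[of _ "sq H A", unfolded scl_sq]

lemma vspace_sq [simp]: "vspace (sq H A)"
  using vspace_closed[OF vspace_tensor[of A A]]
  by (simp add: vspace_def vector_space_pm_scale PM.subspace_def carr_sq)

lemma sq_in_Ae: "z \<in> carr (sq H A) \<Longrightarrow> z \<in> carr Ae"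
  by (simp add: carr_sq)

text \<open>
  The multiplication of \<open>A\<^sup>e \<otimes> H\<close>. Both sides of the equation that defines \<open>A\<^sup>\<box>\<^sup>e\<close> are
  multiplicative for it, the second one since \<open>S\<close> reverses products as does \<open>A\<^sup>o\<^sup>p\<close>.
\<close>

definition AeH_mult :: "_ \<Rightarrow> _ \<Rightarrow> (('a \<times> 'a \<Rightarrow>\<^sub>0 'k) \<times> 'h \<Rightarrow>\<^sub>0 'k)" where
  "AeH_mult v v' = tlin (\<lambda>y h. tlin (\<lambda>y' h'. tpure Ae H (amul y y') (h * h')) v') v"

lemma AeH_mult_linear [simp]: "AeH_mult (z + z') w = AeH_mult z w + AeH_mult z' w" "AeH_mult z (w + w') = AeH_mult z w + AeH_mult z w'"
  "AeH_mult (pm_scale c z) w = pm_scale c (AeH_mult z w)" "AeH_mult z (pm_scale c w) = pm_scale c (AeH_mult z w)"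
  by (simp_all add: AeH_mult_def vector_space_pm_scale)

lemma AeH_mult_tlin: "AeH_mult z (tlin f p) = tlin (\<lambda>c c'. AeH_mult z (f c c')) p"
  "AeH_mult (tlin f p) z = tlin (\<lambda>c c'. AeH_mult (f c c') z) p"
  by (rule klin_linext_UNIV klin_linext_UNIV[where f="\<lambda>y. AeH_mult y z"]; auto simp: klin_def vector_space_pm_scale)+

lemma AeH_mult_tpure: "AeH_mult (tpure Ae H y h) (tpure Ae H y' h') = tpure Ae H (amul y y') (h * h')"
proof -
  have "AeH_mult (tpure Ae H y h) v' = tlin (\<lambda>y' h'. tpure Ae H (amul y y') (h * h')) v'" for v'
    unfolding AeH_mult_def
    by (rule linext_tpure) (auto intro!: bilinI simp: amul_distrib cong: linext_simp_cong)
  then show ?thesis by (simp add: linext_tpure bilin_def klin_def amul_distrib)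
qed

lemma ae_coact_amul: "ae_coact H A (amul z w) = AeH_mult (ae_coact H A z) (ae_coact H A w)"
proof -
  have "ae_coact H A (amul z w) = tlin (\<lambda>a a'. tlin (\<lambda>c c'. tlin (\<lambda>a0 a1. tlin (\<lambda>c0 c1. tpure Ae H (apure (a0 * c0) (c' * a')) (a1 * c1)) (\<rho> c)) (\<rho> a)) w) z"
    unfolding ae_mult_def[of A z w] by (simp add: ae_coact_tlin ae_coact_tpure linext_rho_mult bilin_def klin_def amul_distrib cong: linext_simp_cong)
  also have "\<dots> = tlin (\<lambda>a a'. tlin (\<lambda>a0 a1. tlin (\<lambda>c c'. tlin (\<lambda>c0 c1. tpure Ae H (apure (a0 * c0) (c' * a')) (a1 * c1)) (\<rho> c)) w) (\<rho> a)) z"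
    by (subst (2) linext_swap) (rule vector_space_pm_scale, rule refl)
  also have "\<dots> = AeH_mult (ae_coact H A z) (ae_coact H A w)"
    unfolding ae_coact_def AeH_mult_tlin(2) by (simp add: AeH_mult_tlin(1) AeH_mult_tpure amul_tpure)
  finally show ?thesis .
qed

lemma ae_coact'_amul: "ae_coact' (amul z w) = AeH_mult (ae_coact' z) (ae_coact' w)"
proof -
  have "ae_coact' (amul z w) = tlin (\<lambda>a a'. tlin (\<lambda>c c'. tlin (\<lambda>c0 c1. tlin (\<lambda>a0 a1. tpure Ae H (apure (a * c) (c0 * a0)) (S a1 * S c1)) (\<rho> a')) (\<rho> c')) w) z"
    unfolding ae_mult_def[of A z w] by (simp add: ae_coact_tlin ae_coact'_tpure linext_rho_mult bilin_def klin_def amul_distrib antipode_mult cong: linext_simp_cong)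
  also have "\<dots> = tlin (\<lambda>a a'. tlin (\<lambda>c c'. tlin (\<lambda>a0 a1. tlin (\<lambda>c0 c1. tpure Ae H (apure (a * c) (c0 * a0)) (S a1 * S c1)) (\<rho> c')) (\<rho> a')) w) z"
    by (subst (3) linext_swap) (rule vector_space_pm_scale, rule refl)
  also have "\<dots> = tlin (\<lambda>a a'. tlin (\<lambda>a0 a1. tlin (\<lambda>c c'. tlin (\<lambda>c0 c1. tpure Ae H (apure (a * c) (c0 * a0)) (S a1 * S c1)) (\<rho> c')) w) (\<rho> a')) z"
    by (subst (2) linext_swap) (rule vector_space_pm_scale, rule refl)
  also have "\<dots> = AeH_mult (ae_coact' z) (ae_coact' w)"
    unfolding ae_coact'_def AeH_mult_tlin(2) by (simp add: AeH_mult_tlin(1) AeH_mult_tpure amul_tpure)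
  finally show ?thesis .
qed

lemma amul_sq [simp]: "z \<in> carr (sq H A) \<Longrightarrow> w \<in> carr (sq H A) \<Longrightarrow> amul z w \<in> carr (sq H A)"
  by (simp add: carr_sq ae_coact_amul ae_coact'_amul)

lemma ae_coact_coinv: "b \<in> B \<Longrightarrow> ae_coact H A (apure b b') = tpure Ae H (apure b b') 1"
  by (simp add: ae_coact_tpure linext_rho_coinv bilin_def klin_def amul_distrib)

lemma tpure_sq [simp]: "b \<in> B \<Longrightarrow> b' \<in> B \<Longrightarrow> apure b b' \<in> carr (sq H A)"
  by (simp add: carr_sq ae_coact_coinv ae_coact'_tpure linext_rho_coinv bilin_def klin_def amul_distrib antipode_one)

text \<open>
  The inclusion of \<open>A\<^sup>\<box>\<^sup>e \<otimes> H\<close> into \<open>A\<^sup>e \<otimes> H\<close>.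
\<close>

definition "sq_incl w = tlin (\<lambda>y h. tpure Ae H y h) w"

text \<open>
  This makes the coaction of \<open>A\<^sup>\<box>\<^sup>e\<close> well defined. The defining equation
  \<open>a\<^sub>0 \<otimes> a' \<otimes> a\<^sub>1 = a \<otimes> a'\<^sub>0 \<otimes> S a'\<^sub>1\<close> of \<open>z\<close>, with the coaction applied to the first factor, reads
  \<open>a\<^sub>0 \<otimes> a' \<otimes> a\<^sub>1 \<otimes> a\<^sub>2 = a\<^sub>0 \<otimes> a'\<^sub>0 \<otimes> a\<^sub>1 \<otimes> S a'\<^sub>1\<close>. By cocommutativity the last two factors on the
  left may be exchanged, and then taking a coordinate of the third factor on both sides gives the defining
  equation for the component of \<open>a\<^sub>0 \<otimes> a' \<otimes> a\<^sub>1\<close>.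
\<close>

lemma slice_ae_coact_in_sq:
  assumes z: "z \<in> carr (sq H A)"
  shows "slice Ae b (ae_coact H A z) \<in> carr (sq H A)"
proof -
  define \<sigma> where "\<sigma> = slice Ae b (ae_coact H A z)"
  have \<sigma>: "\<sigma> = tlin (\<lambda>a a'. tlin (\<lambda>a0 a1. pm_scale (coord b a1) (apure a0 a')) (\<rho> a)) z"
    using slice_tpure[OF vspace_tensor[of A A], of b]
    unfolding \<sigma>_def ae_coact_def slice_def by (simp add: linext_linext vector_space_pm_scale)
  \<comment> \<open>a coordinate of the coaction on the first factor of \<open>A\<^sup>e \<otimes> H\<close>\<close>
  define \<Theta> where "\<Theta> v = tlin (\<lambda>y h. tlin (\<lambda>y0 y1. pm_scale (coord b y1) (tpure Ae H y0 h)) (ae_coact H A y)) v" for v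
  have \<Theta>_tpure: "\<Theta> (tpure Ae H y h) = tlin (\<lambda>y0 y1. pm_scale (coord b y1) (tpure Ae H y0 h)) (ae_coact H A y)" for y h
    unfolding \<Theta>_def
  proof (rule linext_tpure, rule vector_space_pm_scale, rule bilinI)
    fix y h h' assume "y \<in> carr Ae"
    have "tlin (\<lambda>y0 y1. pm_scale (coord b y1) (tpure Ae H y0 (h + h'))) (ae_coact H A y)
      = tlin (\<lambda>y0 y1. pm_scale (coord b y1) (tpure Ae H y0 h) + pm_scale (coord b y1) (tpure Ae H y0 h')) (ae_coact H A y)"
      by (rule linext_tensor_cong[OF _ _ ae_coact_in]) (simp_all add: PM.scale_right_distrib)
    then show "tlin (\<lambda>y0 y1. pm_scale (coord b y1) (tpure Ae H y0 (h + h'))) (ae_coact H A y) =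
      tlin (\<lambda>y0 y1. pm_scale (coord b y1) (tpure Ae H y0 h)) (ae_coact H A y) +
      tlin (\<lambda>y0 y1. pm_scale (coord b y1) (tpure Ae H y0 h')) (ae_coact H A y)"
      by (simp add: vector_space_pm_scale)
  next
    fix c y h assume "y \<in> carr Ae"
    have "tlin (\<lambda>y0 y1. pm_scale (coord b y1) (tpure Ae H y0 (scl H c h))) (ae_coact H A y)
      = tlin (\<lambda>y0 y1. pm_scale c (pm_scale (coord b y1) (tpure Ae H y0 h))) (ae_coact H A y)"
      by (rule linext_tensor_cong[OF _ _ ae_coact_in]) (simp_all add: mult.commute)
    then show "tlin (\<lambda>y0 y1. pm_scale (coord b y1) (tpure Ae H y0 (scl H c h))) (ae_coact H A y) =
      pm_scale c (tlin (\<lambda>y0 y1. pm_scale (coord b y1) (tpure Ae H y0 h)) (ae_coact H A y))"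
      by (simp only: tlin_fun_scale)
  qed (simp_all add: vector_space_pm_scale)
  have \<Theta>_tlin: "\<Theta> (tlin f p) = tlin (\<lambda>x y. \<Theta> (f x y)) p" for f :: "'x \<Rightarrow> 'y \<Rightarrow> _" and p
    by (rule klin_linext_UNIV) (auto simp: klin_def vector_space_pm_scale \<Theta>_def)
  have T: "tlin (\<lambda>y0 y1. pm_scale (coord b y1) (tpure Ae H y0 h)) (ae_coact H A (apure a a'))
     = tlin (\<lambda>a0 a1. pm_scale (coord b a1) (tpure Ae H (apure a0 a') h)) (\<rho> a)" for a a' h
    unfolding ae_coact_tpure linext_linext[OF vector_space_pm_scale]
    by (subst linext_tpure) (auto intro!: bilinI simp: vector_space_pm_scale PM.scale_left_distrib PM.scale_right_distrib mult.commute)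
  have "ae_coact H A \<sigma> = tlin (\<lambda>a a'. tlin (\<lambda>a0 a1. tlin (\<lambda>p q. pm_scale (coord b a1) (tpure Ae H (apure p a') q)) (\<rho> a0)) (\<rho> a)) z"
    unfolding \<sigma> by (simp add: ae_coact_tlin ae_coact_tpure)
  also have "\<dots> = tlin (\<lambda>a a'. tlin (\<lambda>a0 a1. tlin (\<lambda>u v. pm_scale (coord b v) (tpure Ae H (apure a0 a') u)) (\<Delta> a1)) (\<rho> a)) z"
    by (subst rho_coassoc) (auto intro!: bilinI klinI simp: trilin_def amul_distrib PM.scale_left_distrib PM.scale_right_distrib mult.commute)
  also have "\<dots> = tlin (\<lambda>a a'. tlin (\<lambda>a0 a1. tlin (\<lambda>u v. pm_scale (coord b u) (tpure Ae H (apure a0 a') v)) (\<Delta> a1)) (\<rho> a)) z"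
    by (subst comult_swap) (auto intro!: bilinI klinI simp: trilin_def amul_distrib PM.scale_left_distrib PM.scale_right_distrib mult.commute)
  also have "\<dots> = tlin (\<lambda>a a'. tlin (\<lambda>a0 a1. tlin (\<lambda>p q. pm_scale (coord b q) (tpure Ae H (apure p a') a1)) (\<rho> a0)) (\<rho> a)) z"
    by (subst rho_coassoc) (auto intro!: bilinI klinI simp: trilin_def amul_distrib PM.scale_left_distrib PM.scale_right_distrib mult.commute)
  also have "\<dots> = \<Theta> (ae_coact H A z)"
    unfolding ae_coact_def by (simp add: \<Theta>_tlin \<Theta>_tpure T)
  also have "\<dots> = \<Theta> (ae_coact' z)"
    using z by (simp add: carr_sq)
  also have "\<dots> = tlin (\<lambda>a a'. tlin (\<lambda>p q. tlin (\<lambda>a0 a1. pm_scale (coord b a1) (tpure Ae H (apure a0 p) (S q))) (\<rho> a)) (\<rho> a')) z"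
    by (simp add: ae_coact'_def \<Theta>_tlin \<Theta>_tpure T)
  also have "\<dots> = tlin (\<lambda>a a'. tlin (\<lambda>a0 a1. tlin (\<lambda>p q. pm_scale (coord b a1) (tpure Ae H (apure a0 p) (S q))) (\<rho> a')) (\<rho> a)) z"
    by (subst (2) linext_swap) (rule vector_space_pm_scale, rule refl)
  also have "\<dots> = ae_coact' \<sigma>"
    unfolding \<sigma> by (simp add: ae_coact_tlin ae_coact'_tpure)
  finally show ?thesis using slice_in[OF vspace_tensor ae_coact_in] by (simp add: carr_sq \<sigma>_def)
qed

lemma linext_sq_incl:
  assumes s: "vector_space s" and g: "bilin Ae H s g"
  shows "linext s g (sq_incl w) = linext s g w"
  unfolding sq_incl_def by (simp add: linext_linext[OF s] linext_tpure[OF s g])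

lemma slice_sq_incl: "slice Ae b (sq_incl w) = slice (sq H A) b w"
  unfolding slice_def scl_tensor scl_sq
  by (rule linext_sq_incl) (auto intro!: bilinI simp: vector_space_pm_scale PM.scale_left_distrib PM.scale_right_distrib mult.commute)

lemma sq_incl_inj:
  assumes "w \<in> carr (tensor (sq H A) H)" "w' \<in> carr (tensor (sq H A) H)" "sq_incl w = sq_incl w'"
  shows "w = w'"
  by (rule tensor_slice_eqI[OF vspace_sq assms(1,2)]) (metis slice_sq_incl assms(3))

lemma sq_incl_linear [simp]: "sq_incl (w + w') = sq_incl w + sq_incl w'" "sq_incl (pm_scale c w) = pm_scale c (sq_incl w)"
  by (simp_all add: sq_incl_def vector_space_pm_scale)

lemma sq_incl_tlin: "sq_incl (tlin f p) = tlin (\<lambda>c c'. sq_incl (f c c')) p"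
  by (rule klin_linext_UNIV) (auto simp: klin_def vector_space_pm_scale)

lemma sq_incl_tpure: "y \<in> carr (sq H A) \<Longrightarrow> sq_incl (tpure (sq H A) H y h) = tpure Ae H y h"
  unfolding sq_incl_def
  by (rule linext_tpure) (auto intro!: bilinI simp: vector_space_pm_scale sq_in_Ae)

lemma sq_coact_ex:
  assumes z: "z \<in> carr (sq H A)"
  shows "\<exists>w. w \<in> carr (tensor (sq H A) H) \<and> sq_incl w = ae_coact H A z"
proof -
  obtain F where F: "finite F" "(\<Sum>b\<in>F. tpure Ae H (slice Ae b (ae_coact H A z)) b) = ae_coact H A z"
    using tensor_slices[OF vspace_tensor ae_coact_in, of z] by (elim exE conjE) (rule that, assumption, simp)
  define w where "w = (\<Sum>b\<in>F. tpure (sq H A) H (slice Ae b (ae_coact H A z)) b)"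
  have "w \<in> carr (tensor (sq H A) H)"
    unfolding w_def by (rule tensor_sum_in) (simp add: slice_ae_coact_in_sq[OF z])
  moreover have "sq_incl w = (\<Sum>b\<in>F. tpure Ae H (slice Ae b (ae_coact H A z)) b)"
    unfolding w_def using F(1)
    by induction (simp_all add: sq_incl_tpure slice_ae_coact_in_sq[OF z], simp add: sq_incl_def)
  ultimately show ?thesis using F(2) by auto
qed

lemma sq_coact:
  assumes z: "z \<in> carr (sq H A)"
  shows sq_coact_in [simp]: "sq_coact H A z \<in> carr (tensor (sq H A) H)"
    and sq_incl_sq_coact: "sq_incl (sq_coact H A z) = ae_coact H A z"
proof -
  have "\<exists>!w. w \<in> carr (tensor (sq H A) H) \<and> sq_incl w = ae_coact H A z"
    using sq_coact_ex[OF z] sq_incl_inj by metis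
  from theI'[OF this] show "sq_coact H A z \<in> carr (tensor (sq H A) H)" "sq_incl (sq_coact H A z) = ae_coact H A z"
    unfolding sq_coact_def sq_incl_def by auto
qed

lemma sq_coact_eqI:
  "z \<in> carr (sq H A) \<Longrightarrow> w \<in> carr (tensor (sq H A) H) \<Longrightarrow> sq_incl w = ae_coact H A z \<Longrightarrow> sq_coact H A z = w"
  by (rule sq_incl_inj) (simp_all add: sq_incl_sq_coact)

lemma sq_coact_linear:
  assumes "z \<in> carr (sq H A)" "z' \<in> carr (sq H A)"
  shows "sq_coact H A (z + z') = sq_coact H A z + sq_coact H A z'"
    "sq_coact H A (pm_scale c z) = pm_scale c (sq_coact H A z)"
  using assms vspace_closed[OF vspace_sq] vspace_closed[OF vspace_tensor[of "sq H A" H]]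
  by (auto intro!: sq_coact_eqI simp: sq_incl_sq_coact)

text \<open>
  Sums over the coaction of \<open>A\<^sup>\<box>\<^sup>e\<close> may be computed in \<open>A\<^sup>e \<otimes> H\<close>, where they are given by the coaction
  of \<open>A\<close>, whenever the summand makes sense on \<open>A\<^sup>e\<close>.
\<close>

lemma linext_sq_coact:
  assumes "z \<in> carr (sq H A)" "vector_space s" "bilin Ae H s g"
  shows "linext s g (sq_coact H A z) = linext s g (ae_coact H A z)"
  using linext_sq_incl[OF assms(2,3), of "sq_coact H A z"] by (simp add: sq_incl_sq_coact[OF assms(1)])

lemma sq_coact_coinv: "b \<in> B \<Longrightarrow> b' \<in> B \<Longrightarrow> sq_coact H A (apure b b') = tpure (sq H A) H (apure b b') 1"
  by (rule sq_coact_eqI) (simp_all add: sq_incl_tpure ae_coact_coinv)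

lemma sq_coact_amul_coinv:
  assumes z: "z \<in> carr (sq H A)" and b: "b \<in> B" "b' \<in> B"
  shows "sq_coact H A (amul z (apure b b')) = tlin (\<lambda>z0 z1. tpure (sq H A) H (amul z0 (apure b b')) z1) (sq_coact H A z)"
proof (rule sq_coact_eqI)
  show "tlin (\<lambda>z0 z1. tpure (sq H A) H (amul z0 (apure b b')) z1) (sq_coact H A z) \<in> carr (tensor (sq H A) H)"
    by (rule tlin_in_tensor)
      (use tensor_keys(1)[OF vspace_sq vspace_H sq_coact_in[OF z]] b in simp)
  have "sq_incl (tlin (\<lambda>z0 z1. tpure (sq H A) H (amul z0 (apure b b')) z1) (sq_coact H A z))
     = tlin (\<lambda>z0 z1. sq_incl (tpure (sq H A) H (amul z0 (apure b b')) z1)) (sq_coact H A z)"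
    by (rule sq_incl_tlin)
  also have "\<dots> = tlin (\<lambda>z0 z1. tpure Ae H (amul z0 (apure b b')) z1) (sq_coact H A z)"
    by (rule linext_tensor_cong[OF vspace_sq vspace_H]) (simp_all add: z b sq_incl_tpure)
  also have "\<dots> = tlin (\<lambda>z0 z1. tpure Ae H (amul z0 (apure b b')) z1) (ae_coact H A z)"
    by (rule linext_sq_coact[OF z]) (auto intro!: bilinI simp: vector_space_pm_scale)
  also have "\<dots> = ae_coact H A (amul z (apure b b'))"
  proof -
    have "AeH_mult v (tpure Ae H (apure b b') 1) = tlin (\<lambda>z0 z1. tpure Ae H (amul z0 (apure b b')) z1) v" for v
      unfolding AeH_mult_def by (subst linext_tpure) (auto intro!: bilinI simp: vector_space_pm_scale distrib_left)
    then show ?thesis by (simp add: ae_coact_amul ae_coact_coinv b)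
  qed
  finally show "sq_incl (tlin (\<lambda>z0 z1. tpure (sq H A) H (amul z0 (apure b b')) z1) (sq_coact H A z)) = ae_coact H A (amul z (apure b b'))" .
qed (use z b in simp)

end

section \<open>The induced module \<open>P = A\<^sup>\<box>\<^sup>e \<otimes>\<^bsub>B\<^sup>e\<^esub> M\<close>\<close>

text \<open>
  Bimodules with and without a coaction are records of different types; tensor products depend on
  their underlying vector spaces only.
\<close>

lemma tpure_cong:
  assumes "carr X = carr X'" "scl X = scl X'"
  shows "tpure X Y = tpure X' Y" "tensor X Y = tensor X' Y"
  using assms by (simp_all add: tpure_def tensor_def bal_carr_def bal_pure_def bal_proj_def bal_rels_def fun_eq_iff)

locale galois_bimod = galois H A
  for H :: "('k::field, 'h::ring_1) hopf" and A :: "('k, 'a::{ring,monoid_mult}, 'h) comod_alg" +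
  fixes M :: "('k, 'a, 'm::ab_group_add) bimod"
  assumes bimod: "bimodule B A M"
begin

abbreviation "P \<equiv> ind H A M"
abbreviation "epure \<equiv> ext_pure (sq H A) H A M"
abbreviation "act \<equiv> ext_act (sq H A) H A M"
abbreviation "Q \<equiv> sq H A"

lemma vspace_M [simp]: "vspace M"
  using bimod by (simp add: bimodule_def right_module_def)

lemma M_simps [simp]:
  assumes "b \<in> B" "m \<in> carr M"
  shows "lact M b m \<in> carr M" "ract M m b \<in> carr M" 
    "m' \<in> carr M \<Longrightarrow> lact M b (m + m') = lact M b m + lact M b m'"
    "m' \<in> carr M \<Longrightarrow> ract M (m + m') b = ract M m b + ract M m' b"
    "lact M b (scl M c m) = scl M c (lact M b m)" "ract M (scl M c m) b = scl M c (ract M m b)"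
  using bimod assms by (simp_all add: bimodule_def right_module_def)

lemma M_one [simp]: "m \<in> carr M \<Longrightarrow> lact M 1 m = m" "m \<in> carr M \<Longrightarrow> ract M m 1 = m"
  using bimod by (simp_all add: bimodule_def right_module_def)

lemma M_assoc:
  assumes "m \<in> carr M" "b \<in> B" "b' \<in> B"
  shows "lact M (b * b') m = lact M b (lact M b' m)" "ract M (lact M b m) b' = lact M b (ract M m b')"
  using bimod assms by (simp_all add: bimodule_def)

lemma scl_P [simp]: "scl P = pm_scale"
  and carr_P: "carr P = bal_carr (B \<times> B) (ext_ra A) (ext_la M) Q M"
  and lact_P: "lact P b p = act (apure b 1) p"
  by (simp_all add: ind_def ext_bimod_def Let_def bimod.extend_def hbimod.fields_def)

lemma coact_P: "coact P p = tlin (\<lambda>z m. tlin (\<lambda>z0 z1. tpure P H (epure z0 m) z1) (sq_coact H A z)) p"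
proof -
  have "tpure P H = tpure (ext_bimod Q H A M) H"
    by (rule tpure_cong) (simp_all add: ext_bimod_def carr_P)
  then show ?thesis
    by (simp add: ind_def[of H A M] Let_def bimod.extend_def hbimod.fields_def)
qed

lemma vspace_P [simp]: "vspace P"
  by (simp add: vspace_def vector_space_pm_scale carr_P subspace_bal_carr)

lemma P_closed [simp]: "p \<in> carr P \<Longrightarrow> q \<in> carr P \<Longrightarrow> p + q \<in> carr P"
  "p \<in> carr P \<Longrightarrow> pm_scale c p \<in> carr P" "0 \<in> carr P"
  using vspace_closed[OF vspace_P] by simp_all

lemmas tpure_P_scale [simp] = tpure_simps(3)[of _ P, unfolded scl_P]

lemma epure_in [simp]: "z \<in> carr Q \<Longrightarrow> m \<in> carr M \<Longrightarrow> epure z m \<in> carr P"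
  by (simp add: ext_pure_def carr_P bal_pure_in_carr)

lemma epure_linear [simp]:
  "z \<in> carr Q \<Longrightarrow> z' \<in> carr Q \<Longrightarrow> m \<in> carr M \<Longrightarrow> epure (z + z') m = epure z m + epure z' m"
  "z \<in> carr Q \<Longrightarrow> m \<in> carr M \<Longrightarrow> m' \<in> carr M \<Longrightarrow> epure z (m + m') = epure z m + epure z m'"
  "z \<in> carr Q \<Longrightarrow> m \<in> carr M \<Longrightarrow> epure (pm_scale c z) m = pm_scale c (epure z m)"
  "z \<in> carr Q \<Longrightarrow> m \<in> carr M \<Longrightarrow> epure z (scl M c m) = pm_scale c (epure z m)"
  using bilin_bal_pure[of Q M "B \<times> B" "ext_ra A" "ext_la M"]
  by (simp_all add: bilin_def klin_def ext_pure_def)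

lemma epure_balanced:
  "z \<in> carr Q \<Longrightarrow> m \<in> carr M \<Longrightarrow> b \<in> B \<Longrightarrow> b' \<in> B \<Longrightarrow>
    epure (amul z (apure b b')) m = epure z (lact M b (ract M m b'))"
  using bal_pure_balanced[of "(b, b')" "B \<times> B" z Q m M "ext_ra A" "ext_la M"]
  by (simp add: ext_pure_def ext_ra_def ext_la_def)

lemma linext_epure:
  assumes "vector_space s" "bilin Q M s g"
    "\<And>z m b b'. z \<in> carr Q \<Longrightarrow> m \<in> carr M \<Longrightarrow> b \<in> B \<Longrightarrow> b' \<in> B \<Longrightarrow>
      g (amul z (apure b b')) m = g z (lact M b (ract M m b'))"
  shows "linext s g (epure z m) = g z m"
  unfolding ext_pure_def
proof (rule linext_bal_pure[OF assms(1,2)])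
  fix r z m assume "r \<in> B \<times> B" "z \<in> carr Q" "m \<in> carr M"
  then show "g (ext_ra A z r) m = g z (ext_la M r m)"
    using assms(3) by (auto simp: ext_ra_def ext_la_def)
qed

text \<open>
  Linear maps are compared on the generators \<open>z \<otimes> m\<close>; linearity on the carrier of \<open>P\<close> suffices,
  which matters for endomorphisms that are extended by zero.
\<close>

lemma P_eqI:
  assumes "p \<in> carr P" "klin (carr P) pm_scale s f" "klin (carr P) pm_scale s g" "vector_space s"
    "\<And>z m. z \<in> carr Q \<Longrightarrow> m \<in> carr M \<Longrightarrow> f (epure z m) = g (epure z m)"
  shows "f p = g p"
proof -
  have "p \<in> carr P \<and> f p = g p"
    using assms(1)[unfolded carr_P bal_carr_def]
  proof (induction rule: PM.span_induct_alt)
    case base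
    then show ?case
      using klin_zero[OF vector_space_pm_scale assms(4,2)] klin_zero[OF vector_space_pm_scale assms(4,3)] by simp
  next
    case (step c p q)
    then obtain z m where "z \<in> carr Q" "m \<in> carr M" "p = epure z m" by (auto simp: ext_pure_def)
    then show ?case using step(2) assms(2,3) assms(5)[of z m] by (simp add: klin_def)
  qed
  then show ?thesis ..
qed

lemma act_epure: "w \<in> carr Q \<Longrightarrow> act w (epure z m) = epure (amul w z) m"
  unfolding ext_act_def
  by (rule linext_epure) (simp_all add: vector_space_pm_scale bilin_def klin_def epure_balanced flip: amul_assoc)

lemma act_linear [simp]: "act w (p + q) = act w p + act w q" "act w (pm_scale c p) = pm_scale c (act w p)"
  by (simp_all add: ext_act_def vector_space_pm_scale)

lemma P_induct [consumes 1, case_names zero add epure]: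
  assumes p: "p \<in> carr P" and "R 0" "\<And>c p q. p \<in> carr P \<Longrightarrow> q \<in> carr P \<Longrightarrow> R p \<Longrightarrow> R q \<Longrightarrow> R (pm_scale c p + q)"
    "\<And>z m. z \<in> carr Q \<Longrightarrow> m \<in> carr M \<Longrightarrow> R (epure z m)"
  shows "R p"
proof -
  have "p \<in> carr P \<and> R p"
    using p[unfolded carr_P bal_carr_def]
  proof (induction rule: PM.span_induct_alt)
    case base
    then show ?case using assms(2) by simp
  next
    case (step c p q)
    then obtain z m where "z \<in> carr Q" "m \<in> carr M" "p = epure z m" by (auto simp: ext_pure_def)
    then show ?case using step(2) assms(3,4) by simp
  qed
  then show ?thesis ..
qed

lemma act_in [simp]:
  assumes w: "w \<in> carr Q" and p: "p \<in> carr P" shows "act w p \<in> carr P"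
  using p
proof (induction rule: P_induct)
  case zero
  then show ?case by (simp add: ext_act_def)
qed (simp_all add: w act_epure)

lemma act_add_left:
  assumes "w \<in> carr Q" "w' \<in> carr Q" "p \<in> carr P"
  shows "act (w + w') p = act w p + act w' p"
  using assms(3)
  by (rule P_eqI[where s=pm_scale])
    (use assms(1,2) vspace_closed(2)[OF vspace_sq] in
      \<open>simp_all add: klin_def vector_space_pm_scale act_epure PM.scale_right_distrib\<close>)

lemma act_scale_left:
  assumes "w \<in> carr Q" "p \<in> carr P"
  shows "act (pm_scale c w) p = pm_scale c (act w p)"
  using assms(2)
  by (rule P_eqI[where s=pm_scale])
    (use assms(1) vspace_closed(3)[OF vspace_sq] in
      \<open>simp_all add: klin_def vector_space_pm_scale act_epure PM.scale_right_distrib mult.commute\<close>)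

lemma coact_epure:
  assumes "z \<in> carr Q" "m \<in> carr M"
  shows "coact P (epure z m) = tlin (\<lambda>z0 z1. tpure P H (epure z0 m) z1) (sq_coact H A z)"
proof -
  note cong = linext_tensor_cong[OF vspace_sq vspace_H sq_coact_in]
  show ?thesis unfolding coact_P
  proof (rule linext_epure, rule vector_space_pm_scale, rule bilinI)
    fix z m m' c assume z: "z \<in> carr Q" and m: "m \<in> carr M"
    have "tlin (\<lambda>z0 z1. tpure P H (epure z0 (scl M c m)) z1) (sq_coact H A z)
      = tlin (\<lambda>z0 z1. pm_scale c (tpure P H (epure z0 m) z1)) (sq_coact H A z)"
      by (rule cong) (simp_all add: z m)
    then show "tlin (\<lambda>z0 z1. tpure P H (epure z0 (scl M c m)) z1) (sq_coact H A z)
      = pm_scale c (tlin (\<lambda>z0 z1. tpure P H (epure z0 m) z1) (sq_coact H A z))"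
      by (simp only: tlin_fun_scale)
    assume m': "m' \<in> carr M"
    have "tlin (\<lambda>z0 z1. tpure P H (epure z0 (m + m')) z1) (sq_coact H A z)
      = tlin (\<lambda>z0 z1. tpure P H (epure z0 m) z1 + tpure P H (epure z0 m') z1) (sq_coact H A z)"
      by (rule cong) (simp_all add: z m m')
    then show "tlin (\<lambda>z0 z1. tpure P H (epure z0 (m + m')) z1) (sq_coact H A z)
      = tlin (\<lambda>z0 z1. tpure P H (epure z0 m) z1) (sq_coact H A z) + tlin (\<lambda>z0 z1. tpure P H (epure z0 m') z1) (sq_coact H A z)"
      by (simp add: vector_space_pm_scale)
  next
    fix z m b b' assume zm: "z \<in> carr Q" "m \<in> carr M" and b: "b \<in> B" "b' \<in> B"
    have "tlin (\<lambda>z0 z1. tpure P H (epure z0 m) z1) (sq_coact H A (amul z (apure b b')))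
       = tlin (\<lambda>z0 z1. tpure P H (epure (amul z0 (apure b b')) m) z1) (sq_coact H A z)"
      unfolding sq_coact_amul_coinv[OF zm(1) b] linext_linext[OF vector_space_pm_scale]
      by (rule cong[OF zm(1)], rule linext_tpure) (simp_all add: zm b vector_space_pm_scale bilin_def klin_def)
    also have "\<dots> = tlin (\<lambda>z0 z1. tpure P H (epure z0 (lact M b (ract M m b'))) z1) (sq_coact H A z)"
      by (rule cong) (simp_all add: zm b epure_balanced)
    finally show "tlin (\<lambda>z0 z1. tpure P H (epure z0 m) z1) (sq_coact H A (amul z (apure b b')))
       = tlin (\<lambda>z0 z1. tpure P H (epure z0 (lact M b (ract M m b'))) z1) (sq_coact H A z)" .
  qed (simp_all add: sq_coact_linear vector_space_pm_scale)
qed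

lemma coact_linear [simp]: "coact P (p + q) = coact P p + coact P q" "coact P (pm_scale c p) = pm_scale c (coact P p)"
  "coact P 0 = 0"
  by (simp_all add: coact_P vector_space_pm_scale)

lemma coact_in [simp]:
  assumes "p \<in> carr P" shows "coact P p \<in> carr (tensor P H)"
  using assms
proof (induction rule: P_induct)
  case zero
  then show ?case using vspace_closed(1)[OF vspace_tensor] by simp
next
  case (add c p q)
  then show ?case using vspace_closed(2,3)[OF vspace_tensor[of P H]] by simp
next
  case (epure z m)
  show ?case unfolding coact_epure[OF epure]
    by (rule tlin_in_tensor) (use tensor_keys(1)[OF vspace_sq vspace_H sq_coact_in[OF epure(1)]] epure in simp)
qed

lemma coact_unit: "m \<in> carr M \<Longrightarrow> coact P (epure (apure 1 1) m) = tpure P H (epure (apure 1 1) m) 1"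
  unfolding coact_epure[OF tpure_sq[OF coinv_one coinv_one]] sq_coact_coinv[OF coinv_one coinv_one]
  by (rule linext_tpure) (simp_all add: vector_space_pm_scale bilin_def klin_def)

section \<open>The endomorphisms \<open>\<lambda>\<^sub>x\<close>\<close>

abbreviation "lam \<equiv> lambda_map H A M"
abbreviation "mu \<equiv> miyashita_ulbrich H A"

lemma lam_epure:
  assumes x: "x \<in> center B" and zm: "z \<in> carr Q" "m \<in> carr M"
  shows "lam x (epure z m) = epure z (lact M x m)"
proof -
  have xB: "x \<in> B" and xb: "b \<in> B \<Longrightarrow> x * b = b * x" for b using x by (auto simp: center_def)
  have "tlin (\<lambda>z m. epure z (lact M x m)) (epure z m) = epure z (lact M x m)"
  proof (rule linext_epure)
    fix z m b b' assume a: "z \<in> carr Q" "m \<in> carr M" "b \<in> B" "b' \<in> B"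
    have "lact M b (ract M (lact M x m) b') = lact M x (lact M b (ract M m b'))"
      using a xB xb[of b] by (simp add: M_assoc(2)) (simp flip: M_assoc(1))
    then show "epure (amul z (apure b b')) (lact M x m) = epure z (lact M x (lact M b (ract M m b')))"
      using a xB by (simp add: epure_balanced)
  qed (simp_all add: vector_space_pm_scale bilin_def klin_def xB)
  then show ?thesis using zm by (simp add: lambda_map_def)
qed

lemma lam_linear [simp]: "p \<in> carr P \<Longrightarrow> q \<in> carr P \<Longrightarrow> lam x (p + q) = lam x p + lam x q"
  "p \<in> carr P \<Longrightarrow> lam x (pm_scale c p) = pm_scale c (lam x p)" "lam x 0 = 0"
  by (simp_all add: lambda_map_def vector_space_pm_scale)

lemma lam_out: "p \<notin> carr P \<Longrightarrow> lam x p = 0"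
  by (simp add: lambda_map_def)

lemma centerB: "x \<in> center B \<Longrightarrow> x \<in> B"
  by (simp add: center_def)

lemma lam_in [simp]:
  assumes x: "x \<in> center B" and p: "p \<in> carr P" shows "lam x p \<in> carr P"
  using p by (induction rule: P_induct) (simp_all add: lam_epure[OF x] centerB[OF x])

lemma lam_act:
  assumes x: "x \<in> center B" and w: "w \<in> carr Q" and p: "p \<in> carr P"
  shows "lam x (act w p) = act w (lam x p)"
  using p by (rule P_eqI[where s=pm_scale])
    (simp_all add: klin_def vector_space_pm_scale act_epure lam_epure[OF x] w x centerB[OF x])

lemma galois_centralI: "x \<in> center B \<Longrightarrow> galois_central H A x"
  by unfold_locales

lemma mu_center: "x \<in> center B \<Longrightarrow> mu h x \<in> center B"
  using galois_central.\<chi>_center galois_central.mu_eq galois_centralI by metis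

lemma mu_linear: "x \<in> center B \<Longrightarrow> mu (g + h) x = mu g x + mu h x"
  "x \<in> center B \<Longrightarrow> mu (scl H c h) x = scl A c (mu h x)"
  by (simp_all add: galois_central.mu_eq[OF galois_centralI] galois_central.\<chi>_linear[OF galois_centralI])

lemma mu_one: "x \<in> center B \<Longrightarrow> mu 1 x = x"
  by (simp add: galois_central.mu_eq[OF galois_centralI] galois_central.\<chi>_one[OF galois_centralI] antipode_one)

lemma mult_central: "x \<in> center B \<Longrightarrow> LA (\<lambda>a0 a1. mu a1 x * a0) (\<rho> a) = a * x"
  by (simp add: galois_central.mu_eq[OF galois_centralI] galois_central.mult_x[OF galois_centralI])

lemma mu_apure [simp]: "x \<in> center B \<Longrightarrow> apure (mu h x) 1 \<in> carr Q"
  by (simp add: mu_center centerB)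

lemma lact_mu_bilin: "x \<in> center B \<Longrightarrow> bilin P H pm_scale (\<lambda>p0 p1. lact P (mu p1 x) p0)"
  by (rule bilinI) (simp_all add: lact_P mu_linear act_add_left act_scale_left)

lemma amul_mu:
  assumes x: "x \<in> center B" and z: "z \<in> carr Q"
  shows "tlin (\<lambda>z0 z1. amul (apure (mu z1 x) 1) z0) (sq_coact H A z) = amul z (apure x 1)"
proof -
  have g: "bilin Ae H pm_scale (\<lambda>z0 z1. amul (apure (mu z1 x) 1) z0)"
    by (rule bilinI) (simp_all add: mu_linear[OF x])
  have "tlin (\<lambda>z0 z1. amul (apure (mu z1 x) 1) z0) (sq_coact H A z) = tlin (\<lambda>z0 z1. amul (apure (mu z1 x) 1) z0) (ae_coact H A z)"
    by (rule linext_sq_coact[OF z vector_space_pm_scale g])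
  also have "\<dots> = tlin (\<lambda>a a'. tlin (\<lambda>a0 a1. apure (mu a1 x * a0) a') (\<rho> a)) z"
    unfolding ae_coact_def linext_linext[OF vector_space_pm_scale] linext_tpure[OF vector_space_pm_scale g]
    by (simp add: amul_tpure)
  also have "\<dots> = tlin (\<lambda>a a'. apure (a * x) a') z"
  proof -
    have "tlin (\<lambda>a0 a1. apure (mu a1 x * a0) a') (\<rho> a) = apure (a * x) a'" for a a'
      using klin_linext_UNIV[of "scl A" pm_scale "\<lambda>y. apure y a'" "\<lambda>a0 a1. mu a1 x * a0" "\<rho> a"]
      by (simp add: klin_def vector_space_pm_scale mult_central[OF x])
    then show ?thesis by simp
  qed
  also have "\<dots> = amul z (apure x 1)"
    unfolding ae_mult_def by (simp add: linext_tpure bilin_def klin_def amul_distrib)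
  finally show ?thesis .
qed

text \<open>
  The endomorphism \<open>\<lambda>\<^sub>x\<close> multiplies by \<open>x\<close> between the two tensor factors. By \<open>a x = (a\<^sub>1 \<sqdot> x) a\<^sub>0\<close>,
  this is the left action of \<open>B\<close> on \<open>P\<close> from the outside, with the coefficient twisted by the
  coaction of \<open>P\<close>. In this form \<open>\<lambda>\<^sub>x\<close> can be compared with colinear maps of \<open>P\<close>.
\<close>

lemma lam_eq_action:
  assumes x: "x \<in> center B" and p: "p \<in> carr P"
  shows "lam x p = tlin (\<lambda>p0 p1. lact P (mu p1 x) p0) (coact P p)"
  using p
proof (rule P_eqI[where s=pm_scale])
  fix z m assume zm: "z \<in> carr Q" "m \<in> carr M"
  have "tlin (\<lambda>p0 p1. lact P (mu p1 x) p0) (coact P (epure z m))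
     = tlin (\<lambda>z0 z1. act (apure (mu z1 x) 1) (epure z0 m)) (sq_coact H A z)"
    unfolding coact_epure[OF zm] linext_linext[OF vector_space_pm_scale]
      linext_tpure[OF vector_space_pm_scale lact_mu_bilin[OF x]] by (simp add: lact_P)
  also have "\<dots> = tlin (\<lambda>z0 z1. epure (amul (apure (mu z1 x) 1) z0) m) (sq_coact H A z)"
    by (simp add: act_epure x)
  also have "\<dots> = epure (tlin (\<lambda>z0 z1. amul (apure (mu z1 x) 1) z0) (sq_coact H A z)) m"
    by (rule klin_linext[where f="\<lambda>y. epure y m" and V="carr Q", symmetric])
      (use zm tensor_keys(1)[OF vspace_sq vspace_H sq_coact_in[OF zm(1)]] vspaceD(2)[OF vspace_sq] in
        \<open>simp_all add: klin_def vector_space_pm_scale x\<close>)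
  also have "\<dots> = lam x (epure z m)"
    using zm by (simp add: amul_mu[OF x] epure_balanced lam_epure[OF x] centerB[OF x])
  finally show "lam x (epure z m) = tlin (\<lambda>p0 p1. lact P (mu p1 x) p0) (coact P (epure z m))" ..
qed (simp_all add: klin_def vector_space_pm_scale)

lemma coact_lam:
  assumes x: "x \<in> center B" and p: "p \<in> carr P"
  shows "coact P (lam x p) = tlin (\<lambda>p0 p1. tpure P H (lam x p0) p1) (coact P p)"
  using p
proof (rule P_eqI[where s=pm_scale])
  fix z m assume zm: "z \<in> carr Q" "m \<in> carr M"
  have g: "bilin P H pm_scale (\<lambda>p0 p1. tpure P H (lam x p0) p1)"
    by (rule bilinI) (simp_all add: x)
  have "tlin (\<lambda>p0 p1. tpure P H (lam x p0) p1) (coact P (epure z m))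
     = tlin (\<lambda>z0 z1. tpure P H (lam x (epure z0 m)) z1) (sq_coact H A z)"
    unfolding coact_epure[OF zm] linext_linext[OF vector_space_pm_scale]
      linext_tpure[OF vector_space_pm_scale g] ..
  also have "\<dots> = tlin (\<lambda>z0 z1. tpure P H (epure z0 (lact M x m)) z1) (sq_coact H A z)"
    by (rule linext_tensor_cong[OF vspace_sq vspace_H sq_coact_in]) (simp_all add: zm lam_epure[OF x])
  also have "\<dots> = coact P (lam x (epure z m))"
    using zm by (simp add: lam_epure[OF x] coact_epure centerB[OF x])
  finally show "coact P (lam x (epure z m)) = tlin (\<lambda>p0 p1. tpure P H (lam x p0) p1) (coact P (epure z m))" ..
qed (simp_all add: klin_def vector_space_pm_scale x)

end

section \<open>The action of \<open>H\<close> on the coinvariants of \<open>E\<close>\<close>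

lemma sum_fun_apply: "(\<Sum>i\<in>I. F i) p = (\<Sum>i\<in>I. F i p)"
  for F :: "'i \<Rightarrow> 'p \<Rightarrow> 'v::ab_group_add"
  by (induction I rule: infinite_finite_induct) simp_all

lemma linext_pointwise: "linext (\<lambda>c f p. pm_scale c (f p)) g q p = tlin (\<lambda>x y. g x y p) q"
  by (simp add: linext_def sum_fun_apply)

context galois_bimod
begin

abbreviation "EndP \<equiv> sq_End H A M"

lemma EndP_D:
  assumes "f \<in> carr EndP"
  shows "p \<in> carr P \<Longrightarrow> f p \<in> carr P"
    "p \<in> carr P \<Longrightarrow> q \<in> carr P \<Longrightarrow> f (p + q) = f p + f q"
    "p \<in> carr P \<Longrightarrow> f (pm_scale c p) = pm_scale c (f p)"
    "w \<in> carr Q \<Longrightarrow> p \<in> carr P \<Longrightarrow> f (act w p) = act w (f p)"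
    "p \<notin> carr P \<Longrightarrow> f p = 0"
  using assms by (simp_all add: sq_End_def Let_def lin_def)

lemma scl_EndP [simp]: "scl EndP = (\<lambda>c f p. pm_scale c (f p))"
  by (simp add: sq_End_def Let_def)

lemma lam_EndP: "x \<in> center B \<Longrightarrow> lam x \<in> carr EndP"
  by (simp add: sq_End_def Let_def lin_def lam_act lam_out)

lemma bilin_E_coacts:
  assumes p: "p \<in> carr P"
  shows "bilin EndP H pm_scale (\<lambda>f0 f1. tlin (\<lambda>p0 p1. tpure P H (f0 p0) (p1 * f1)) (coact P p))"
proof (rule bilinI)
  note cong = linext_tensor_cong[OF vspace_P vspace_H coact_in[OF p]]
  fix f f' g g' c assume f: "f \<in> carr EndP"
  have "tlin (\<lambda>p0 p1. tpure P H (scl EndP c f p0) (p1 * g)) (coact P p)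
    = tlin (\<lambda>p0 p1. pm_scale c (tpure P H (f p0) (p1 * g))) (coact P p)"
    by (rule cong) (simp add: EndP_D[OF f])
  then show "tlin (\<lambda>p0 p1. tpure P H (scl EndP c f p0) (p1 * g)) (coact P p)
    = pm_scale c (tlin (\<lambda>p0 p1. tpure P H (f p0) (p1 * g)) (coact P p))" by (simp only: tlin_fun_scale)
  have "tlin (\<lambda>p0 p1. tpure P H (f p0) (p1 * scl H c g)) (coact P p)
    = tlin (\<lambda>p0 p1. pm_scale c (tpure P H (f p0) (p1 * g))) (coact P p)"
    by (rule cong) (simp add: EndP_D[OF f])
  then show "tlin (\<lambda>p0 p1. tpure P H (f p0) (p1 * scl H c g)) (coact P p)
    = pm_scale c (tlin (\<lambda>p0 p1. tpure P H (f p0) (p1 * g)) (coact P p))" by (simp only: tlin_fun_scale)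
  have "tlin (\<lambda>p0 p1. tpure P H (f p0) (p1 * (g + g'))) (coact P p)
    = tlin (\<lambda>p0 p1. tpure P H (f p0) (p1 * g) + tpure P H (f p0) (p1 * g')) (coact P p)"
    by (rule cong) (simp add: EndP_D[OF f] distrib_left)
  then show "tlin (\<lambda>p0 p1. tpure P H (f p0) (p1 * (g + g'))) (coact P p)
    = tlin (\<lambda>p0 p1. tpure P H (f p0) (p1 * g)) (coact P p) + tlin (\<lambda>p0 p1. tpure P H (f p0) (p1 * g')) (coact P p)"
    by (simp add: vector_space_pm_scale)
  assume f': "f' \<in> carr EndP"
  have "tlin (\<lambda>p0 p1. tpure P H ((f + f') p0) (p1 * g)) (coact P p)
    = tlin (\<lambda>p0 p1. tpure P H (f p0) (p1 * g) + tpure P H (f' p0) (p1 * g)) (coact P p)"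
    by (rule cong) (simp add: EndP_D[OF f] EndP_D[OF f'])
  then show "tlin (\<lambda>p0 p1. tpure P H ((f + f') p0) (p1 * g)) (coact P p)
    = tlin (\<lambda>p0 p1. tpure P H (f p0) (p1 * g)) (coact P p) + tlin (\<lambda>p0 p1. tpure P H (f' p0) (p1 * g)) (coact P p)"
    by (simp add: vector_space_pm_scale)
qed

lemma lam_coinv:
  assumes x: "x \<in> center B"
  shows "lam x \<in> E_coinv H A M"
proof -
  have "E_coacts H A M (lam x) (tpure EndP H (lam x) 1)"
    unfolding E_coacts_def Let_def
    by (simp add: lam_EndP[OF x] linext_tpure[OF vector_space_pm_scale bilin_E_coacts] coact_lam[OF x])
  then show ?thesis using lam_EndP[OF x] by (auto simp: E_coinv_def E_alg_def)
qed

lemma tpure_M_one_inj: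
  assumes "m \<in> carr M" "m' \<in> carr M" "tpure M H m 1 = tpure M H m' 1"
  shows "m = m'"
proof -
  interpret V: vector_space "scl M" using vspace_M by (rule vspaceD)
  have "linext (scl M) (\<lambda>m h. scl M (\<epsilon> h) m) (tpure M H m 1) = m" for m
    using linext_tpure[of "scl M" M H "\<lambda>m h. scl M (\<epsilon> h) m" m 1] vspaceD[OF vspace_M]
    by (simp add: bilin_def klin_def V.scale_left_distrib V.scale_right_distrib mult.commute)
  then show ?thesis using assms(3) by metis
qed

text \<open>
  The element is \<open>p = \<phi>\<^sup>-\<^sup>1 (m \<otimes> 1)\<close>. It is coinvariant, so \<open>\<lambda>\<^sub>x p = x p\<close> by \<open>lam_eq_action\<close>, and the
  left \<open>B\<close>-linear map \<open>\<phi>\<close> sends this to \<open>x m \<otimes> 1\<close>.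
\<close>

lemma hbimod_iso_lam:
  assumes \<phi>: "hbimod_iso B H P (tensorH H M) \<phi>"
    and m: "m \<in> carr M"
  obtains p where "p \<in> carr P" "\<And>x. x \<in> center B \<Longrightarrow> \<phi> (lam x p) = tpure M H (lact M x m) 1"
proof -
  let ?Y = "tensorH H M"
  have Y: "carr ?Y = carr (tensor M H)" "scl ?Y = pm_scale" by (simp_all add: tensorH_def)
  have tY: "tpure ?Y H = tpure (tensor M H) H" by (rule tpure_cong) (simp_all add: Y)
  have "tpure M H m 1 \<in> carr ?Y" using m by (simp add: Y)
  moreover have "\<phi> ` carr P = carr ?Y" using \<phi> by (simp add: hbimod_iso_def bij_betw_def)
  ultimately have "tpure M H m 1 \<in> \<phi> ` carr P" by (simp only:)
  then obtain p where p: "p \<in> carr P" "\<phi> p = tpure M H m 1" by (elim imageE) (rule that, assumption, rule sym)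
  have \<phi>_co: "coact ?Y (\<phi> q) = tlin (\<lambda>v h. tpure ?Y H (\<phi> v) h) (coact P q)" if "q \<in> carr P" for q
    using \<phi> that by (simp add: hbimod_iso_def)
  have co: "coact ?Y (tpure M H m 1) = tpure (tensor M H) H (tpure M H m 1) 1"
    unfolding tensorH_def using m
    by (simp add: linext_tpure linext_comult_one bilin_def klin_def vector_space_pm_scale cong: linext_simp_cong)
  have "\<phi> (lam x p) = tpure M H (lact M x m) 1" if x: "x \<in> center B" for x
  proof -
    note cong = linext_tensor_cong[OF vspace_M vspace_H]
    have lY: "lact ?Y b v = tlin (\<lambda>m h. tpure M H (lact M b m) h) v" for b v by (simp add: tensorH_def)
    have g: "bilin ?Y H pm_scale (\<lambda>v h. lact ?Y (mu h x) v)"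
      unfolding lY
    proof (rule bilinI)
      fix v g h c assume "v \<in> carr ?Y"
      then have v: "v \<in> carr (tensor M H)" by (simp add: Y)
      have lM: "lact M (b + b') m = lact M b m + lact M b' m" "lact M (scl A c b) m = scl M c (lact M b m)"
        if "b \<in> B" "b' \<in> B" "m \<in> carr M" for b b' m
        using bimod that by (simp_all add: bimodule_def)
      have muB: "mu h x \<in> B" for h using x by (simp add: mu_center centerB)
      have "tlin (\<lambda>m k. tpure M H (lact M (mu (g + h) x) m) k) v
        = tlin (\<lambda>m k. tpure M H (lact M (mu g x) m) k + tpure M H (lact M (mu h x) m) k) v"
        by (rule cong[OF v]) (simp add: mu_linear x lM muB)
      then show "tlin (\<lambda>m k. tpure M H (lact M (mu (g + h) x) m) k) v
        = tlin (\<lambda>m k. tpure M H (lact M (mu g x) m) k) v + tlin (\<lambda>m k. tpure M H (lact M (mu h x) m) k) v"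
        by (simp add: vector_space_pm_scale)
      have "tlin (\<lambda>m k. tpure M H (lact M (mu (scl H c h) x) m) k) v
        = tlin (\<lambda>m k. pm_scale c (tpure M H (lact M (mu h x) m) k)) v"
        by (rule cong[OF v]) (simp add: mu_linear x lM(2)[OF muB muB] muB)
      then show "tlin (\<lambda>m k. tpure M H (lact M (mu (scl H c h) x) m) k) v
        = pm_scale c (tlin (\<lambda>m k. tpure M H (lact M (mu h x) m) k) v)"
        by (simp only: tlin_fun_scale)
    qed (simp_all add: Y vector_space_pm_scale)
    have "\<phi> (lam x p) = \<phi> (tlin (\<lambda>p0 p1. lact P (mu p1 x) p0) (coact P p))"
      by (simp add: lam_eq_action[OF x p(1)])
    also have "\<dots> = tlin (\<lambda>p0 p1. \<phi> (lact P (mu p1 x) p0)) (coact P p)"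
    proof (rule klin_linext)
      show "klin (carr P) pm_scale pm_scale \<phi>"
        using \<phi> by (simp add: hbimod_iso_def lin_def klin_def Y)
      show "lact P (mu h x) q \<in> carr P" if "(q, h) \<in> Poly_Mapping.keys (coact P p)" for q h
        using tensor_keys(1)[OF vspace_P vspace_H coact_in[OF p(1)] that] by (simp add: lact_P x)
    qed (use vspaceD(2)[OF vspace_P] in \<open>simp_all add: vector_space_pm_scale\<close>)
    also have "\<dots> = tlin (\<lambda>p0 p1. lact ?Y (mu p1 x) (\<phi> p0)) (coact P p)"
      by (rule linext_tensor_cong[OF vspace_P vspace_H coact_in[OF p(1)]])
        (use \<phi> in \<open>simp add: hbimod_iso_def mu_center[OF x] centerB\<close>)
    also have "\<dots> = tlin (\<lambda>v h. lact ?Y (mu h x) v) (tlin (\<lambda>v h. tpure ?Y H (\<phi> v) h) (coact P p))"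
      unfolding linext_linext[OF vector_space_pm_scale] linext_tpure[OF vector_space_pm_scale g] ..
    also have "tlin (\<lambda>v h. tpure ?Y H (\<phi> v) h) (coact P p) = tpure ?Y H (tpure M H m 1) 1"
      using \<phi>_co[OF p(1)] by (simp only: p(2) co tY)
    also have "tlin (\<lambda>v h. lact ?Y (mu h x) v) (tpure ?Y H (tpure M H m 1) 1) = lact ?Y x (tpure M H m 1)"
      by (simp add: linext_tpure[OF vector_space_pm_scale g] mu_one x)
    also have "\<dots> = tpure M H (lact M x m) 1"
      unfolding lY by (rule linext_tpure) (simp_all add: bilin_def klin_def vector_space_pm_scale centerB[OF x])
    finally show ?thesis .
  qed
  with p(1) show ?thesis by (rule that)
qed

text \<open>
  If \<open>\<lambda>\<^sub>x = \<lambda>\<^sub>y\<close>, then \<open>x m = y m\<close> for all \<open>m \<in> M\<close>, and since \<open>\<alpha>\<close> maps \<open>M \<otimes>\<^sub>B N\<close> onto \<open>B\<close>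
  and is left \<open>B\<close>-linear, \<open>x b = y b\<close> for all \<open>b \<in> B\<close>.
\<close>

lemma lam_inj:
  fixes N :: "('k, 'a, 'n::ab_group_add) bimod"
  assumes morita: "strict_morita_context B A M N \<alpha> \<beta>"
    and \<phi>: "hbimod_iso B H P (tensorH H M) \<phi>"
  shows "inj_on lam (center B)"
proof (rule inj_onI)
  fix x y assume x: "x \<in> center B" and y: "y \<in> center B" and eq: "lam x = lam y"
  have lact_eq: "lact M x m = lact M y m" if m: "m \<in> carr M" for m
  proof -
    obtain p where p: "p \<in> carr P" "\<And>x. x \<in> center B \<Longrightarrow> \<phi> (lam x p) = tpure M H (lact M x m) 1"
      using hbimod_iso_lam[OF \<phi> m] by metis
    have "tpure M H (lact M x m) 1 = tpure M H (lact M y m) 1" using p(2)[OF x] p(2)[OF y] eq by simp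
    then show ?thesis by (intro tpure_M_one_inj) (simp_all add: m centerB x y)
  qed
  have N: "bimodule B A N" and \<alpha>: "bimod_iso B (btensor B M N) (mult_bimod B A) \<alpha>"
    using morita by (simp_all add: strict_morita_context_def)
  have "1 \<in> carr (mult_bimod B A)" by (simp add: mult_bimod_def)
  moreover have "\<alpha> ` carr (btensor B M N) = carr (mult_bimod B A)"
    using \<alpha> by (simp add: bimod_iso_def bij_betw_def)
  ultimately have "1 \<in> \<alpha> ` carr (btensor B M N)" by (simp only:)
  then obtain w where w: "w \<in> carr (btensor B M N)" "\<alpha> w = 1"
    by (elim imageE) (rule that, assumption, rule sym)
  have keys: "Poly_Mapping.keys w \<subseteq> carr M \<times> carr N"
    by (rule bal_carr_keys[where ra="ract M" and la="lact N" and R=B])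
      (use N w(1) in \<open>simp_all add: btensor_def btensor_carr_def bimodule_def right_module_def\<close>)
  have "lact (btensor B M N) x w = lact (btensor B M N) y w"
    unfolding btensor_def using keys lact_eq by (auto intro!: linext_cong)
  moreover have "\<alpha> (lact (btensor B M N) x w) = x * \<alpha> w" if "x \<in> B" for x
    using \<alpha> w(1) that by (simp add: bimod_iso_def mult_bimod_def)
  ultimately show "x = y" using w(2) centerB[OF x] centerB[OF y] by (metis mult_1_right)
qed

text \<open>
  Colinearity of \<open>t\<close> says that \<open>t(h) (1 \<otimes> m)\<close> has coaction \<open>t(h\<^sub>1) (1 \<otimes> m) \<otimes> h\<^sub>2\<close>, so that
  \<open>\<lambda>\<^sub>x\<close> acts on it as \<open>(h\<^sub>2 \<sqdot> x) t(h\<^sub>1) (1 \<otimes> m)\<close>. As \<open>u(h\<^sub>3)\<close> is left \<open>B\<close>-linear, the coefficient comes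
  out in front, and cocommutativity brings \<open>t\<close> and \<open>u\<close> together, where they cancel.
\<close>

lemma E_action_unit:
  assumes tu: "cleaving H A M t u" and x: "x \<in> center B" and m: "m \<in> carr M"
  shows "tlin (\<lambda>h1 h2. u h2 (lam x (t h1 (epure (apure 1 1) m)))) (\<Delta> h) = lam (mu h x) (epure (apure 1 1) m)"
proof -
  define p where "p = epure (apure 1 1) m"
  have p: "p \<in> carr P" and cp: "coact P p = tpure P H p 1"
    using m by (simp_all add: p_def coact_unit)
  have tE: "t h \<in> carr EndP" and uE: "u h \<in> carr EndP" for h
    using tu by (simp_all add: cleaving_def Let_def lin_def E_alg_def)
  have tl: "t (g + h) = t g + t h" "t (scl H c h) = (\<lambda>q. pm_scale c (t h q))"
    and ul: "u (g + h) = u g + u h" "u (scl H c h) = (\<lambda>q. pm_scale c (u h q))" for g h c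
    using tu by (simp_all add: cleaving_def Let_def lin_def E_alg_def)
  note D = EndP_D[OF tE] EndP_D[OF uE]
  have g: "bilin P H pm_scale (\<lambda>p0 p1. lact P (mu p1 x) p0)" by (rule lact_mu_bilin[OF x])
  have ct: "coact P (t h p) = tlin (\<lambda>h1 h2. tpure P H (t h1 p) h2) (\<Delta> h)" for h
  proof -
    have "coact P (t h p) = tlin (\<lambda>f0 f1. tlin (\<lambda>p0 p1. tpure P H (f0 p0) (p1 * f1)) (coact P p))
       (tlin (\<lambda>h1 h2. tpure EndP H (t h1) h2) (\<Delta> h))"
      using tu p by (simp add: cleaving_def Let_def E_coacts_def)
    also have "\<dots> = tlin (\<lambda>h1 h2. tlin (\<lambda>p0 p1. tpure P H (t h1 p0) (p1 * h2)) (coact P p)) (\<Delta> h)"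
      unfolding linext_linext[OF vector_space_pm_scale] linext_tpure[OF vector_space_pm_scale bilin_E_coacts[OF p]] ..
    also have "\<dots> = tlin (\<lambda>h1 h2. tlin (\<lambda>p0 p1. tpure P H (t h1 p0) (p1 * h2)) (tpure P H p 1)) (\<Delta> h)"
      unfolding cp ..
    also have "\<dots> = tlin (\<lambda>h1 h2. tpure P H (t h1 p) h2) (\<Delta> h)"
      by (simp add: linext_tpure bilin_def klin_def vector_space_pm_scale D distrib_right)
    finally show ?thesis .
  qed
  have lt: "lam x (t h p) = tlin (\<lambda>h1 h2. lact P (mu h2 x) (t h1 p)) (\<Delta> h)" for h
    unfolding lam_eq_action[OF x EndP_D(1)[OF tE p]] ct linext_linext[OF vector_space_pm_scale]
      linext_tpure[OF vector_space_pm_scale g] ..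
  have u_tlin: "u h (tlin f q) = tlin (\<lambda>v w. u h (f v w)) q" if "\<And>v w. f v w \<in> carr P" for h f and q :: "'h \<times> 'h \<Rightarrow>\<^sub>0 'k"
    by (rule klin_linext[where V="carr P"])
      (use that vspaceD(2)[OF vspace_P] in \<open>simp_all add: vector_space_pm_scale klin_def D\<close>)
  \<comment> \<open>\<open>v\<close>, \<open>w\<close>, \<open>y\<close> stand for \<open>h\<^sub>1\<close>, \<open>h\<^sub>2\<close>, \<open>h\<^sub>3\<close>\<close>
  define T where "T v w y = act (apure (mu w x) 1) (u y (t v p))" for v w y
  have T: "trilin H H H pm_scale T" and T': "trilin H H H pm_scale (\<lambda>v y w. T v w y)"
    unfolding T_def trilin_def
    by (auto intro!: bilinI klinI simp: tl ul D p x mu_linear act_add_left act_scale_left)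
  have "tlin (\<lambda>h1 h2. u h2 (lam x (t h1 p))) (\<Delta> h) = tlin (\<lambda>h1 h2. tlin (\<lambda>v w. T v w h2) (\<Delta> h1)) (\<Delta> h)"
    unfolding lt T_def lact_P by (simp add: u_tlin D p x)
  also have "\<dots> = tlin (\<lambda>v h2. tlin (\<lambda>w y. T v w y) (\<Delta> h2)) (\<Delta> h)"
    by (rule coassoc[OF vector_space_pm_scale T])
  also have "\<dots> = tlin (\<lambda>v h2. tlin (\<lambda>w y. T v y w) (\<Delta> h2)) (\<Delta> h)"
    by (subst comult_swap) (use T in \<open>auto simp: vector_space_pm_scale trilin_def bilin_def\<close>)
  also have "\<dots> = tlin (\<lambda>h1 h2. tlin (\<lambda>v y. T v h2 y) (\<Delta> h1)) (\<Delta> h)"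
    by (rule coassoc[OF vector_space_pm_scale T', symmetric])
  also have "\<dots> = tlin (\<lambda>h1 h2. pm_scale (\<epsilon> h1) (act (apure (mu h2 x) 1) p)) (\<Delta> h)"
  proof -
    have ut: "tlin (\<lambda>v y. u y (t v p)) (\<Delta> h) = pm_scale (\<epsilon> h) p" for h
    proof -
      have "linext (\<lambda>c f p. pm_scale c (f p)) (\<lambda>h1 h2. t h1 \<cdot>\<^sub>E u h2) (\<Delta> h) = (\<lambda>p. pm_scale (\<epsilon> h) (E_one H A M p))"
        using tu by (simp add: cleaving_def Let_def E_alg_def)
      from fun_cong[OF this, of p] show ?thesis using p by (simp add: linext_pointwise E_mult_def E_one_def)
    qed
    have "tlin (\<lambda>v y. T v w y) (\<Delta> h1) = pm_scale (\<epsilon> h1) (act (apure (mu w x) 1) p)" for h1 w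
      unfolding T_def using klin_linext_UNIV[of pm_scale pm_scale "act (apure (mu w x) 1)" "\<lambda>v y. u y (t v p)" "\<Delta> h1"]
      by (simp add: klin_def vector_space_pm_scale ut)
    then show ?thesis by simp
  qed
  also have "\<dots> = act (apure (mu h x) 1) p"
    by (rule counit_left) (simp_all add: vector_space_pm_scale klin_def mu_linear act_add_left act_scale_left p x)
  also have "\<dots> = lam (mu h x) p"
  proof -
    have mc: "mu h x \<in> center B" using x by (rule mu_center)
    have "act (apure (mu h x) 1) p = epure (amul (apure 1 1) (apure (mu h x) 1)) m"
      using x by (simp add: p_def act_epure amul_tpure)
    also have "\<dots> = lam (mu h x) p"
      using m mc by (simp only: epure_balanced tpure_sq coinv_one centerB M_one) (simp add: p_def lam_epure)
    finally show ?thesis .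
  qed
  finally show ?thesis by (simp add: p_def)
qed

text \<open>
  Both sides are \<open>A\<^sup>\<box>\<^sup>e\<close>-linear and the elements \<open>1 \<otimes> m\<close> generate \<open>P\<close>.
\<close>

lemma E_action_lam:
  assumes tu: "cleaving H A M t u" and x: "x \<in> center B"
  shows "E_action H A M t u h (lam x) = lam (mu h x)"
proof
  fix q
  have tE: "t h \<in> carr EndP" and uE: "u h \<in> carr EndP" for h
    using tu by (simp_all add: cleaving_def Let_def lin_def E_alg_def)
  note D = EndP_D[OF tE] EndP_D[OF uE]
  have mc: "mu h x \<in> center B" using x by (rule mu_center)
  have ev: "E_action H A M t u h (lam x) q = tlin (\<lambda>h1 h2. u h2 (lam x (t h1 q))) (\<Delta> h)" for q
    by (simp add: E_action_def E_alg_def linext_pointwise E_mult_def)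
  show "E_action H A M t u h (lam x) q = lam (mu h x) q"
  proof (cases "q \<in> carr P")
    case False
    have "u h 0 = 0" for h using D(8)[of 0 h 0] by simp
    then show ?thesis using False by (simp add: ev D lam_out vector_space_pm_scale)
  next
    case True
    then show ?thesis
    proof (rule P_eqI[where s=pm_scale])
      fix z m assume z: "z \<in> carr Q" and m: "m \<in> carr M"
      let ?p = "epure (apure 1 1) m"
      have p: "?p \<in> carr P" using m by simp
      have zm: "epure z m = act z ?p" using z m by (simp add: act_epure amul_one sq_in_Ae)
      have "E_action H A M t u h (lam x) (act z ?p) = tlin (\<lambda>h1 h2. act z (u h2 (lam x (t h1 ?p)))) (\<Delta> h)"
        unfolding ev by (simp add: D z p lam_act[OF x] x)
      also have "\<dots> = act z (tlin (\<lambda>h1 h2. u h2 (lam x (t h1 ?p))) (\<Delta> h))"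
        by (rule klin_linext_UNIV[symmetric]) (simp_all add: klin_def vector_space_pm_scale)
      also have "\<dots> = lam (mu h x) (act z ?p)"
        unfolding E_action_unit[OF tu x m] using lam_act[OF mc z p] by simp
      finally show "E_action H A M t u h (lam x) (epure z m) = lam (mu h x) (epure z m)" by (simp add: zm)
    qed (simp_all add: klin_def vector_space_pm_scale ev D x)
  qed
qed

end

theorem proposition7p3:
  fixes H :: "('k::field, 'h::ring_1) hopf"
    and A :: "('k, 'a::{ring,monoid_mult}, 'h) comod_alg"
    and M :: "('k, 'a, 'm::ab_group_add) bimod"
    and N :: "('k, 'a, 'n::ab_group_add) bimod"
    and \<alpha> :: "('m \<times> 'n \<Rightarrow>\<^sub>0 'k) \<Rightarrow> 'a"
    and \<beta> :: "('n \<times> 'm \<Rightarrow>\<^sub>0 'k) \<Rightarrow> 'a"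
    and t u :: "'h \<Rightarrow> (('a \<times> 'a \<Rightarrow>\<^sub>0 'k) \<times> 'm \<Rightarrow>\<^sub>0 'k) \<Rightarrow> (('a \<times> 'a \<Rightarrow>\<^sub>0 'k) \<times> 'm \<Rightarrow>\<^sub>0 'k)"
    and h :: 'h and x :: 'a
  assumes "hopf_algebra H" and "cocommutative H"
    and "ff_hopf_galois H A"
    and "strict_morita_context (coinv H A) A M N \<alpha> \<beta>"
    and "H_stable H A M N \<alpha> \<beta>"
    and "cleaving H A M t u"
    and "x \<in> center (coinv H A)"
  shows "lambda_map H A M x \<in> E_coinv H A M
    \<and> miyashita_ulbrich H A h x \<in> center (coinv H A)
    \<and> E_action H A M t u h (lambda_map H A M x)
        = lambda_map H A M (miyashita_ulbrich H A h x)
    \<and> inv_into (center (coinv H A)) (lambda_map H A M)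
        (E_action H A M t u h (lambda_map H A M x)) = miyashita_ulbrich H A h x"
proof -
  interpret galois_bimod H A M
    using assms(1-4) by unfold_locales (auto simp: ff_hopf_galois_def strict_morita_context_def)
  obtain \<phi> where "hbimod_iso (coinv H A) H (ind H A M) (tensorH H M) \<phi>"
    using assms(5) by (auto simp: H_stable_def)
  with assms(4) have "inj_on (lambda_map H A M) (center (coinv H A))" by (rule lam_inj)
  then show ?thesis
    using lam_coinv[OF assms(7)] mu_center[OF assms(7), of h] E_action_lam[OF assms(6,7), of h]
    by (simp add: inv_into_f_f)
qed

end
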